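(* Suppose the transition kernel $\rho$ is given by a density $p:\Omega\times\Omega\to[0,\infty)$, i.e. $\rho_x(\Delta)=\int_\Delta p(x,y)\,dy$ for all $x\in\Omega$ and all Borel sets $\Delta\subset\Omega$, and that $p$ satisfies $$\sum_{|\alpha|\le\ell}\left\|D_1^\alpha p(\cdot,\cdot)\right\|_{L^2(\Omega\times\Omega)}\le C$$ for some constant $C>0$ and some $\ell\in\mathbb N$. Then $\mathcal K\in L(H^s(\Omega),H^s(\Omega))$ for all $s\in(0,\ell]$.
   Context: $\Omega\subset\mathbb R^n$ is a bounded domain with Lipschitz boundary and $\rho:\Omega\times\mathcal B_\Omega\to[0,1]$ is a Markov transition kernel: $\rho_x:=\rho(x,\cdot)$ is a Borel probability measure on $\Omega$ for each $x$, and $x\mapsto\rho(x,\Delta)$ is measurable for each Borel set $\Delta$. The Koopman operator is $(\mathcal Kf)(x)=\int_\Omega f\,d\rho_x$, considered on (Lebesgue-a.e. classes of) functions in $L^2(\Omega)$. $D_1^\alpha p$, $\alpha\in\mathbb N_0^n$, denotes the $\alpha$-th weak partial derivative of $p$ with respect to its first argument $x$ (existence as an $L^2(\Omega\times\Omega)$ function is part of the assumption). $L(\mathcal Z,\mathcal Z)$ denotes the bounded linear operators on a Banach space $\mathcal Z$. For $\ell\in\mathbb N$, $H^\ell(\Omega)=W^{\ell,2}(\Omega)$; for real $s\ge0$ with $s=\lfloor s\rfloor+r$, $r\in(0,1)$, $H^s(\Omega)$ is the fractional Sobolev (Sobolev–Slobodeckij) space with squared norm $\sum_{|\alpha|\le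 \lfloor s\rfloor}\|D^\alpha f\|_{L^2}^2+\sum_{|\alpha|=\lfloor s\rfloor}\int_\Omega\int_\Omega\frac{|D^\alpha f(x)-D^\alpha f(y)|^2}{\|x-y\|_2^{n+2r}}\,dx\,dy$. *)

theory Defs
  imports "HOL-Probability.Probability"
begin

subsection \<open>Bounded domains with Lipschitz boundary\<close>

text \<open>
  Near each boundary point, and after a rotation, the set is the strict epigraph of a Lipschitz
  function of the remaining coordinates. The rotation is encoded by the unit vector \<open>e\<close> in the
  direction of the last rotated coordinate; the remaining coordinates of \<open>x\<close> are its projection
  \<open>x - (x \<bullet> e) *\<^sub>R e\<close> onto the hyperplane orthogonal to \<open>e\<close>.
\<close>

definition lipschitz_boundary :: "'a::euclidean_space set \<Rightarrow> bool" where
  "lipschitz_boundary \<Omega> \<longleftrightarrow>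
    (\<forall>x0 \<in> frontier \<Omega>. \<exists>r > 0. \<exists>e \<gamma> L. norm e = 1 \<and> L-lipschitz_on {v. v \<bullet> e = 0} \<gamma> \<and>
      \<Omega> \<inter> ball x0 r = {x \<in> ball x0 r. \<gamma> (x - (x \<bullet> e) *\<^sub>R e) < x \<bullet> e})"

definition bounded_lipschitz_domain :: "'a::euclidean_space set \<Rightarrow> bool" where
  "bounded_lipschitz_domain \<Omega> \<longleftrightarrow>
    open \<Omega> \<and> connected \<Omega> \<and> \<Omega> \<noteq> {} \<and> bounded \<Omega> \<and> lipschitz_boundary \<Omega>"


subsection \<open>Multi-indices and test functions\<close>

text \<open>
  A multi-index on a Euclidean space assigns an order of differentiation to each vector of the
  standard basis; it is set to zero elsewhere, so that there are only finitely many multi-indices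
  of bounded order.
\<close>

definition multi_indices :: "('a::euclidean_space \<Rightarrow> nat) set" where
  "multi_indices = {\<alpha>. \<forall>v. v \<notin> Basis \<longrightarrow> \<alpha> v = 0}"

definition mi_order :: "('a::euclidean_space \<Rightarrow> nat) \<Rightarrow> nat" where
  "mi_order \<alpha> = (\<Sum>b\<in>Basis. \<alpha> b)"

lemma finite_multi_indices_le:
  "finite {\<alpha> \<in> multi_indices :: ('a::euclidean_space \<Rightarrow> nat) set. mi_order \<alpha> \<le> k}"
proof (rule finite_subset)
  show "{\<alpha> \<in> multi_indices. mi_order \<alpha> \<le> k}
      \<subseteq> {\<alpha> :: 'a \<Rightarrow> nat. \<forall>v. (v \<in> Basis \<longrightarrow> \<alpha> v \<in> {..k}) \<and> (v \<notin> Basis \<longrightarrow> \<alpha> v = 0)}"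
  proof clarify
    fix \<alpha> :: "'a \<Rightarrow> nat" and v :: 'a
    assume *: "\<alpha> \<in> multi_indices" "mi_order \<alpha> \<le> k"
    have "\<alpha> v \<le> k" if "v \<in> Basis"
      using member_le_sum[of v Basis \<alpha>] that *(2) by (simp add: mi_order_def)
    then show "(v \<in> Basis \<longrightarrow> \<alpha> v \<in> {..k}) \<and> (v \<notin> Basis \<longrightarrow> \<alpha> v = 0)"
      using *(1) by (simp add: multi_indices_def)
  qed
  show "finite {\<alpha> :: 'a \<Rightarrow> nat. \<forall>v. (v \<in> Basis \<longrightarrow> \<alpha> v \<in> {..k}) \<and> (v \<notin> Basis \<longrightarrow> \<alpha> v = 0)}"
    by (rule finite_set_of_finite_funs) auto
qed

primrec iter_deriv :: "'a::euclidean_space list \<Rightarrow> ('a \<Rightarrow> real) \<Rightarrow> 'a \<Rightarrow> real" where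
  "iter_deriv [] \<phi> = \<phi>"
| "iter_deriv (v # vs) \<phi> = (\<lambda>x. frechet_derivative (iter_deriv vs \<phi>) (at x) v)"

text \<open>
  The coordinates are differentiated in some fixed order; the order does not matter because
  \<open>multi_deriv\<close> is only applied to smooth functions.
\<close>

definition basis_list :: "'a::euclidean_space list" where
  "basis_list = (SOME bs. distinct bs \<and> set bs = Basis)"

definition multi_deriv :: "('a::euclidean_space \<Rightarrow> nat) \<Rightarrow> ('a \<Rightarrow> real) \<Rightarrow> 'a \<Rightarrow> real" where
  "multi_deriv \<alpha> \<phi> = iter_deriv (concat (map (\<lambda>b. replicate (\<alpha> b) b) basis_list)) \<phi>"

definition smooth :: "('a::euclidean_space \<Rightarrow> real) \<Rightarrow> bool" where
  "smooth \<phi> \<longleftrightarrow> (\<forall>vs. set vs \<subseteq> Basis \<longrightarrow> (\<forall>x. iter_deriv vs \<phi> differentiable at x))"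

definition test_functions :: "'a::euclidean_space set \<Rightarrow> ('a \<Rightarrow> real) set" where
  "test_functions \<Omega> =
    {\<phi>. smooth \<phi> \<and> compact (closure {x. \<phi> x \<noteq> 0}) \<and> closure {x. \<phi> x \<noteq> 0} \<subseteq> \<Omega>}"


subsection \<open>Weak derivatives and Sobolev--Slobodeckij spaces\<close>

text \<open>
  Functions take values in the scalar field \<open>'k\<close>, which is \<open>real\<close> or \<open>complex\<close>
  (these are the only instances of \<open>real_normed_field\<close> and \<open>euclidean_space\<close>, up to isomorphism).
\<close>

definition locally_integrable ::
    "'a::euclidean_space set \<Rightarrow> ('a \<Rightarrow> 'k::{real_normed_field,euclidean_space}) \<Rightarrow> bool" where
  "locally_integrable \<Omega> f \<longleftrightarrow> (\<forall>K. compact K \<and> K \<subseteq> \<Omega> \<longrightarrow> set_integrable lebesgue K f)"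

definition has_weak_deriv ::
    "'a::euclidean_space set \<Rightarrow> ('a \<Rightarrow> nat) \<Rightarrow> ('a \<Rightarrow> 'k::{real_normed_field,euclidean_space})
      \<Rightarrow> ('a \<Rightarrow> 'k) \<Rightarrow> bool" where
  "has_weak_deriv \<Omega> \<alpha> f g \<longleftrightarrow>
    locally_integrable \<Omega> f \<and> locally_integrable \<Omega> g \<and>
    (\<forall>\<phi> \<in> test_functions \<Omega>.
      (LINT x:\<Omega>|lebesgue. multi_deriv \<alpha> \<phi> x *\<^sub>R f x) =
      (-1) ^ mi_order \<alpha> * (LINT x:\<Omega>|lebesgue. \<phi> x *\<^sub>R g x))"

definition weak_deriv ::
    "'a::euclidean_space set \<Rightarrow> ('a \<Rightarrow> nat) \<Rightarrow> ('a \<Rightarrow> 'k::{real_normed_field,euclidean_space})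
      \<Rightarrow> 'a \<Rightarrow> 'k" where
  "weak_deriv \<Omega> \<alpha> f = (SOME g. has_weak_deriv \<Omega> \<alpha> f g)"

definition L2 :: "'a::euclidean_space set \<Rightarrow> ('a \<Rightarrow> 'k::{real_normed_field,euclidean_space}) set" where
  "L2 \<Omega> = {g \<in> borel_measurable (lebesgue_on \<Omega>). integrable (lebesgue_on \<Omega>) (\<lambda>x. (norm (g x))\<^sup>2)}"

definition L2_norm ::
    "'a::euclidean_space set \<Rightarrow> ('a \<Rightarrow> 'k::{real_normed_field,euclidean_space}) \<Rightarrow> real" where
  "L2_norm \<Omega> g = sqrt (LINT x|lebesgue_on \<Omega>. (norm (g x))\<^sup>2)"

text \<open>The square of the Slobodeckij seminorm of order \<open>r\<close>, which may be infinite.\<close>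

definition slobodeckij ::
    "'a::euclidean_space set \<Rightarrow> real \<Rightarrow> ('a \<Rightarrow> 'k::{real_normed_field,euclidean_space}) \<Rightarrow> ennreal" where
  "slobodeckij \<Omega> r g =
    (\<integral>\<^sup>+x\<in>\<Omega>. (\<integral>\<^sup>+y\<in>\<Omega>.
        ennreal ((norm (g x - g y))\<^sup>2 / norm (x - y) powr (real DIM('a) + 2 * r)) \<partial>lebesgue) \<partial>lebesgue)"

text \<open>
  Elements of \<open>sobolev \<Omega> s\<close> are representatives of the almost-everywhere classes that form
  \<open>H\<^sup>s(\<Omega>)\<close>. The representatives are Borel functions (each class contains one), since otherwise
  integration against a Borel measure on \<open>\<Omega>\<close> would not be meaningful. Square integrability of
  \<open>f\<close> itself is the case of the zero multi-index.
\<close>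

definition sobolev ::
    "'a::euclidean_space set \<Rightarrow> real \<Rightarrow> ('a \<Rightarrow> 'k::{real_normed_field,euclidean_space}) set" where
  "sobolev \<Omega> s =
    {f \<in> borel_measurable (restrict_space borel \<Omega>).
      (\<forall>\<alpha> \<in> multi_indices. mi_order \<alpha> \<le> nat \<lfloor>s\<rfloor> \<longrightarrow> (\<exists>g \<in> L2 \<Omega>. has_weak_deriv \<Omega> \<alpha> f g)) \<and>
      (s \<notin> \<int> \<longrightarrow> (\<forall>\<alpha> \<in> multi_indices. mi_order \<alpha> = nat \<lfloor>s\<rfloor> \<longrightarrow>
        slobodeckij \<Omega> (frac s) (weak_deriv \<Omega> \<alpha> f) < \<infinity>))}"

definition sobolev_norm ::
    "'a::euclidean_space set \<Rightarrow> real \<Rightarrow> ('a \<Rightarrow> 'k::{real_normed_field,euclidean_space}) \<Rightarrow> real" where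
  "sobolev_norm \<Omega> s f = sqrt (
    (\<Sum>\<alpha> | \<alpha> \<in> multi_indices \<and> mi_order \<alpha> \<le> nat \<lfloor>s\<rfloor>. (L2_norm \<Omega> (weak_deriv \<Omega> \<alpha> f))\<^sup>2) +
    (if s \<in> \<int> then 0
     else \<Sum>\<alpha> | \<alpha> \<in> multi_indices \<and> mi_order \<alpha> = nat \<lfloor>s\<rfloor>.
       enn2real (slobodeckij \<Omega> (frac s) (weak_deriv \<Omega> \<alpha> f))))"

text \<open>
  \<open>\<alpha>\<close> as a multi-index on the product space that differentiates in the first argument only;
  the standard basis of the product consists of the vectors \<open>(b, 0)\<close> and \<open>(0, b)\<close>.
\<close>

definition first_arg ::
    "('a::euclidean_space \<Rightarrow> nat) \<Rightarrow> 'a \<times> 'b::euclidean_space \<Rightarrow> nat" where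
  "first_arg \<alpha> = (\<lambda>(u, v). if v = 0 then \<alpha> u else 0)"

lemma first_arg_multi_indices: "\<alpha> \<in> multi_indices \<Longrightarrow> first_arg \<alpha> \<in> multi_indices"
  by (auto simp: multi_indices_def first_arg_def Basis_prod_def)


subsection \<open>Koopman operator\<close>

abbreviation markov_kernel :: "'a::euclidean_space set \<Rightarrow> ('a \<Rightarrow> 'a measure) \<Rightarrow> bool" where
  "markov_kernel \<Omega> \<rho> \<equiv> \<rho> \<in> restrict_space borel \<Omega> \<rightarrow>\<^sub>M prob_algebra (restrict_space borel \<Omega>)"

definition koopman ::
    "('a \<Rightarrow> 'a measure) \<Rightarrow> ('a \<Rightarrow> 'k::{real_normed_field,euclidean_space}) \<Rightarrow> 'a \<Rightarrow> 'k" where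
  "koopman \<rho> f x = (LINT y|\<rho> x. f y)"

text \<open>
  \<open>T\<close>, given on representatives, induces a bounded linear operator on the normed space of
  \<open>M\<close>-almost-everywhere classes of the functions in \<open>Z\<close>, with norm \<open>N\<close>.
\<close>

definition bounded_operator_ae ::
    "'a measure \<Rightarrow> ('a \<Rightarrow> 'k::{real_normed_field,euclidean_space}) set \<Rightarrow> (('a \<Rightarrow> 'k) \<Rightarrow> real)
      \<Rightarrow> (('a \<Rightarrow> 'k) \<Rightarrow> 'a \<Rightarrow> 'k) \<Rightarrow> bool" where
  "bounded_operator_ae M Z N T \<longleftrightarrow>
    (\<forall>f \<in> Z. T f \<in> Z) \<and>
    (\<forall>f \<in> Z. \<forall>g \<in> Z. (AE x in M. f x = g x) \<longrightarrow> (AE x in M. T f x = T g x)) \<and>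
    (\<forall>f \<in> Z. \<forall>g \<in> Z. AE x in M. T (\<lambda>y. f y + g y) x = T f x + T g x) \<and>
    (\<forall>c. \<forall>f \<in> Z. AE x in M. T (\<lambda>y. c * f y) x = c * T f x) \<and>
    (\<exists>B. \<forall>f \<in> Z. N (T f) \<le> B * N f)"

end

theory Submission
  imports Defs
begin

text \<open>
  Let \<open>g\<^sub>\<alpha>\<close> be the weak derivatives of the density in its first argument. For \<open>f \<in> L\<^sup>2\<close> the
  function \<open>\<K>f(x) = \<integral> p(x,y) f(y) dy\<close> has the weak derivatives \<open>D\<^sup>\<alpha>\<K>f(x) = \<integral> g\<^sub>\<alpha>(x,y) f(y) dy\<close>, whose
  \<open>L\<^sup>2\<close> norms are at most \<open>\<parallel>g\<^sub>\<alpha>\<parallel> \<parallel>f\<parallel>\<close> by the Cauchy--Schwarz inequality. So \<open>\<K>\<close> maps \<open>L\<^sup>2\<close> boundedly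
  into \<open>H\<^sup>l\<close>, which settles integer orders.

  For a fractional order one needs the embedding of \<open>H\<^sup>1\<close> into \<open>H\<^sup>r\<close> for \<open>0 < r < 1\<close>, applied to the
  derivatives of order \<open>\<lfloor>s\<rfloor>\<close>. No extension operator is used: on a Lipschitz domain, nearby
  points \<open>x\<close> and \<open>x + z\<close> are joined by three segments of length \<open>O(|z|)\<close> inside the domain, and along
  each of them the \<open>L\<^sup>2\<close> norm of the increment of a function is bounded by \<open>|z|\<close> times that of its
  gradient. It remains to integrate \<open>|z|\<^sup>2\<close> against \<open>|z|\<close> to the power \<open>-n-2r\<close>, which is possible
  near zero because \<open>r < 1\<close>; away from the diagonal the kernel is bounded.
\<close>

subsection \<open>Smooth functions and test functions\<close>

text \<open>Three mismatches shape the proof. The weak derivatives of \<open>p\<close> are tested by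
  smooth functions on \<open>\<Omega> \<times> \<Omega>\<close>, whereas differentiating
  \<open>koopman \<rho> f\<close> amounts to testing with \<phi>(x) f(y) for a merely square
  integrable \<open>f\<close>; the fundamental lemma of the calculus of variations bridges this.
  \<open>weak_deriv\<close> is an arbitrary choice and integrals are taken over completed Lebesgue
  measure, whereas Fubini and translations are carried out for \<open>lborel\<close>; so classes are
  replaced by Borel representatives vanishing outside the domain, and uniqueness of weak derivatives
  carries the results back. Finally, \<open>p\<close> agrees with its Borel representative only
  almost everywhere, so the integral defining \<open>koopman \<rho> f x\<close> is controlled only
  for almost every \<open>x\<close>.

  Boundedness needs only L2 information on \<open>f\<close>: the H^s norm of the image is at most a
  multiple of the L2 norm of \<open>f\<close>, which the H^s norm of \<open>f\<close> dominates. A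
  noninteger s \<le> l leaves one derivative above the integer part of s, and this is the gradient
  that the embedding consumes.\<close>

abbreviation partial :: "'a::euclidean_space \<Rightarrow> ('a \<Rightarrow> real) \<Rightarrow> 'a \<Rightarrow> real" where
  "partial v \<phi> \<equiv> (\<lambda>x. frechet_derivative \<phi> (at x) v)"

lemma iter_deriv_append: "iter_deriv (vs @ ws) \<phi> = iter_deriv vs (iter_deriv ws \<phi>)"
  by (induction vs) auto

text \<open>Induction on the list of directions keeps every iterated partial derivative inside the
  class. Smoothness of a concrete function thus needs no formula for its higher derivatives, only a
  class of differentiable functions that is stable under one partial derivative.\<close>

lemma smooth_coinduct:
  assumes "S \<phi>"
    and diff: "\<And>\<phi> x. S \<phi> \<Longrightarrow> \<phi> differentiable at x"
    and closed: "\<And>\<phi> v. S \<phi> \<Longrightarrow> v \<in> Basis \<Longrightarrow> S (partial v \<phi>)"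
  shows "smooth \<phi>"
proof -
  have "S (iter_deriv vs \<phi>)" if "set vs \<subseteq> Basis" for vs
    using that by (induction vs) (auto intro: closed assms(1))
  then show ?thesis
    by (simp add: smooth_def diff)
qed

lemma smooth_differentiable: "smooth \<phi> \<Longrightarrow> \<phi> differentiable at x"
  unfolding smooth_def by (metis iter_deriv.simps(1) empty_set empty_subsetI)

lemma smooth_has_derivative: "smooth \<phi> \<Longrightarrow> (\<phi> has_derivative frechet_derivative \<phi> (at x)) (at x)"
  using frechet_derivative_works smooth_differentiable by blast

lemma smooth_continuous: "smooth \<phi> \<Longrightarrow> continuous_on S \<phi>"
  by (simp add: continuous_at_imp_continuous_on differentiable_imp_continuous_within smooth_differentiable)

lemma smooth_iter_deriv:
  assumes "smooth \<phi>" "set ws \<subseteq> Basis"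
  shows "smooth (iter_deriv ws \<phi>)"
  unfolding smooth_def
proof (intro allI impI)
  fix vs :: "'a list" and x assume "set vs \<subseteq> Basis"
  with assms have "iter_deriv (vs @ ws) \<phi> differentiable at x"
    unfolding smooth_def by (metis Un_least set_append)
  then show "iter_deriv vs (iter_deriv ws \<phi>) differentiable at x"
    by (simp add: iter_deriv_append)
qed

lemma smooth_partial: "smooth \<phi> \<Longrightarrow> v \<in> Basis \<Longrightarrow> smooth (partial v \<phi>)"
  using smooth_iter_deriv[of \<phi> "[v]"] by simp

lemma smooth_has_field_derivative_line:
  assumes "smooth \<phi>"
  shows "((\<lambda>s. \<phi> (x + s *\<^sub>R u)) has_real_derivative partial u \<phi> (x + s *\<^sub>R u)) (at s)"
proof -
  have "((\<lambda>s. x + s *\<^sub>R u) has_derivative (\<lambda>h. h *\<^sub>R u)) (at s)"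
    by (auto intro!: derivative_eq_intros)
  from has_derivative_compose[OF this smooth_has_derivative[OF assms]]
  have "((\<lambda>s. \<phi> (x + s *\<^sub>R u)) has_derivative
      (\<lambda>h. frechet_derivative \<phi> (at (x + s *\<^sub>R u)) (h *\<^sub>R u))) (at s)" .
  moreover have "linear (frechet_derivative \<phi> (at (x + s *\<^sub>R u)))"
    using linear_frechet_derivative smooth_differentiable[OF assms] by blast
  ultimately show ?thesis
    by (simp add: has_field_derivative_def linear_scale mult_commute_abs)
qed

text \<open>Schwarz's theorem. The second difference of \<open>\<phi>\<close> over a small
  parallelogram is symmetric in \<open>u\<close> and \<open>v\<close>, and two applications of the
  mean value theorem express it through either mixed derivative at a nearby point. Both mixed
  derivatives are continuous, being differentiable.\<close>

lemma partial_commute: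
  assumes \<phi>: "smooth \<phi>" and uv: "u \<in> Basis" "v \<in> Basis"
  shows "partial u (partial v \<phi>) = partial v (partial u \<phi>)"
proof
  fix x
  let ?a = "partial u (partial v \<phi>)" and ?b = "partial v (partial u \<phi>)"
  have mvt: "\<exists>y. dist y x < 2 * t \<and>
      \<phi> (x + t *\<^sub>R u + t *\<^sub>R v) - \<phi> (x + t *\<^sub>R v) - \<phi> (x + t *\<^sub>R u) + \<phi> x
        = t * t * partial v (partial u \<phi>) y"
    if uv: "u \<in> Basis" "v \<in> Basis" and t: "t > 0" for u v t
  proof -
    \<comment> \<open>The second difference is \<open>k t - k 0\<close>: the mean value theorem in
      direction \<open>u\<close> turns it into a difference of \<open>partial u \<phi>\<close>, to
      which it is applied again in direction \<open>v\<close>.\<close>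
    define k where "k s = \<phi> ((x + t *\<^sub>R v) + s *\<^sub>R u) - \<phi> (x + s *\<^sub>R u)" for s
    have "(k has_real_derivative partial u \<phi> (x + t *\<^sub>R v + s *\<^sub>R u) - partial u \<phi> (x + s *\<^sub>R u)) (at s)" for s
      unfolding k_def by (intro DERIV_diff smooth_has_field_derivative_line \<phi>)
    from MVT2[OF t, of k, OF this] obtain s where s: "0 < s" "s < t"
      "k t - k 0 = t * (partial u \<phi> (x + t *\<^sub>R v + s *\<^sub>R u) - partial u \<phi> (x + s *\<^sub>R u))"
      by auto
    have "((\<lambda>r. partial u \<phi> ((x + s *\<^sub>R u) + r *\<^sub>R v)) has_real_derivative
        partial v (partial u \<phi>) ((x + s *\<^sub>R u) + r *\<^sub>R v)) (at r)" for r
      by (rule smooth_has_field_derivative_line[OF smooth_partial[OF \<phi> uv(1)]])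
    from MVT2[OF t, of "\<lambda>r. partial u \<phi> ((x + s *\<^sub>R u) + r *\<^sub>R v)", OF this] obtain r where r: "0 < r" "r < t"
      "partial u \<phi> (x + s *\<^sub>R u + t *\<^sub>R v) - partial u \<phi> (x + s *\<^sub>R u)
         = t * partial v (partial u \<phi>) (x + s *\<^sub>R u + r *\<^sub>R v)"
      by auto
    have "dist (x + s *\<^sub>R u + r *\<^sub>R v) x = norm (s *\<^sub>R u + r *\<^sub>R v)"
      by (simp add: dist_norm add.assoc)
    also have "\<dots> \<le> s + r"
      using norm_triangle_ineq[of "s *\<^sub>R u" "r *\<^sub>R v"] s r uv by simp
    finally have "dist (x + s *\<^sub>R u + r *\<^sub>R v) x < 2 * t"
      using s r by linarith
    moreover have "k t - k 0 = t * t * partial v (partial u \<phi>) (x + s *\<^sub>R u + r *\<^sub>R v)"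
      using s(3) r(3) by (simp add: add.assoc add.commute add.left_commute)
    ultimately show ?thesis
      unfolding k_def by (intro exI[of _ "x + s *\<^sub>R u + r *\<^sub>R v"])
        (auto simp: add.assoc add.commute add.left_commute)
  qed
  show "?a x = ?b x"
  proof (rule ccontr)
    assume ne: "?a x \<noteq> ?b x"
    \<comment> \<open>Half of the supposed gap: the two derivatives coincide at points where each is
      within \<open>e\<close> of its value at \<open>x\<close>, so the gap would be less than
      \<open>2 * e\<close>.\<close>
    define e where "e = \<bar>?a x - ?b x\<bar> / 2"
    have e: "e > 0" using ne by (simp add: e_def)
    have "continuous (at x) ?a" "continuous (at x) ?b"
      using \<phi> uv by (auto intro!: differentiable_imp_continuous_within smooth_differentiable smooth_partial)
    then obtain d1 d2 where d: "d1 > 0" "\<And>y. dist y x < d1 \<Longrightarrow> dist (?a y) (?a x) < e"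
      "d2 > 0" "\<And>y. dist y x < d2 \<Longrightarrow> dist (?b y) (?b x) < e"
      using e unfolding continuous_at_eps_delta dist_norm[symmetric] by metis
    define t where "t = min d1 d2 / 2"
    have t: "t > 0" "2 * t \<le> d1" "2 * t \<le> d2" using d by (auto simp: t_def)
    obtain y where y: "dist y x < 2 * t" "\<phi> (x + t *\<^sub>R u + t *\<^sub>R v) - \<phi> (x + t *\<^sub>R v) - \<phi> (x + t *\<^sub>R u) + \<phi> x
        = t * t * ?b y"
      using mvt[OF uv t(1)] by auto
    obtain z where z: "dist z x < 2 * t" "\<phi> (x + t *\<^sub>R v + t *\<^sub>R u) - \<phi> (x + t *\<^sub>R u) - \<phi> (x + t *\<^sub>R v) + \<phi> x
        = t * t * ?a z"
      using mvt[OF uv(2) uv(1) t(1)] by auto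
    have "t * t * ?a z = t * t * ?b y"
      unfolding y(2)[symmetric] z(2)[symmetric] by (simp add: add.assoc add.commute[of "t *\<^sub>R u"])
    then have "?a z = ?b y" using t by simp
    moreover have "dist (?a z) (?a x) < e" "dist (?b y) (?b x) < e"
      using d t y z by auto
    ultimately show False
      unfolding dist_real_def e_def by (simp add: abs_if split: if_splits)
  qed
qed

lemma iter_deriv_move_front:
  assumes "smooth \<phi>" "u \<in> Basis" "set vs \<subseteq> Basis" "set ws \<subseteq> Basis"
  shows "iter_deriv (vs @ u # ws) \<phi> = iter_deriv (u # vs @ ws) \<phi>"
  using assms(3)
proof (induction vs)
  case (Cons v vs)
  then have "iter_deriv ((v # vs) @ u # ws) \<phi> = partial v (partial u (iter_deriv (vs @ ws) \<phi>))"
    by simp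
  also have "\<dots> = partial u (partial v (iter_deriv (vs @ ws) \<phi>))"
    using Cons.prems assms by (intro partial_commute smooth_iter_deriv) auto
  finally show ?case by simp
qed simp

text \<open>\<open>basis_list\<close> is an arbitrary enumeration of the basis, so nothing is known
  about the order in which \<open>multi_deriv\<close> differentiates; only the multiplicities can be
  compared.\<close>

lemma iter_deriv_mset_cong:
  assumes \<phi>: "smooth \<phi>" and "mset vs = mset ws" "set ws \<subseteq> Basis"
  shows "iter_deriv vs \<phi> = iter_deriv ws \<phi>"
  using assms(2,3)
proof (induction vs arbitrary: ws)
  case (Cons v vs)
  then have "v \<in> set ws"
    by (metis list.set_intros(1) set_mset_mset)
  then obtain as bs where ws: "ws = as @ v # bs"
    by (meson split_list)
  then have "iter_deriv vs \<phi> = iter_deriv (as @ bs) \<phi>"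
    using Cons by (intro Cons.IH) auto
  then have "iter_deriv (v # vs) \<phi> = iter_deriv (v # as @ bs) \<phi>"
    by simp
  also have "\<dots> = iter_deriv ws \<phi>"
    unfolding ws using Cons.prems(2) ws by (intro iter_deriv_move_front[symmetric] \<phi>) auto
  finally show ?case .
qed simp

section \<open>Derivatives indexed by multi-indices\<close>

abbreviation mi_list :: "('a::euclidean_space \<Rightarrow> nat) \<Rightarrow> 'a list" where
  "mi_list \<alpha> \<equiv> concat (map (\<lambda>b. replicate (\<alpha> b) b) basis_list)"

lemma basis_list: "distinct (basis_list :: 'a::euclidean_space list)" "set (basis_list :: 'a list) = Basis"
proof -
  have "\<exists>bs :: 'a list. distinct bs \<and> set bs = Basis"
    using finite_distinct_list[OF finite_Basis] by auto
  from someI_ex[OF this] show "distinct (basis_list :: 'a list)" "set (basis_list :: 'a list) = Basis"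
    by (simp_all add: basis_list_def)
qed

lemma set_mi_list: "set (mi_list \<alpha>) \<subseteq> Basis"
  by (auto simp: basis_list)

lemma count_mi_list:
  "count (mset (mi_list \<alpha>)) v = (if v \<in> Basis then \<alpha> v else 0)"
proof -
  have "count (mset (concat (map (\<lambda>b. replicate (\<alpha> b) b) bs))) v = (if v \<in> set bs then \<alpha> v else 0)"
    if "distinct bs" for bs
    using that by (induction bs) auto
  from this[OF basis_list(1)] show ?thesis by (simp add: basis_list)
qed

lemma multi_deriv_zero: "multi_deriv (\<lambda>_. 0) \<phi> = \<phi>"
proof -
  have "concat (map (\<lambda>b. replicate 0 b) bs) = []" for bs :: "'a list" by simp
  then show ?thesis by (simp only: multi_deriv_def iter_deriv.simps)
qed

text \<open>Raising \<alpha> at \<open>b\<close> inserts a \<open>b\<close> somewhere inside the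
  list of directions; by symmetry it can be moved to the innermost position, where it becomes a
  derivative of the test function.\<close>

lemma multi_deriv_Suc:
  assumes "smooth \<phi>" "b \<in> Basis"
  shows "multi_deriv (\<alpha>(b := Suc (\<alpha> b))) \<phi> = multi_deriv \<alpha> (partial b \<phi>)"
proof -
  have "mset (mi_list (\<alpha>(b := Suc (\<alpha> b)))) = mset (mi_list \<alpha> @ [b])"
    unfolding multiset_eq_iff mset_append count_union count_mi_list using assms(2) by auto
  then have "multi_deriv (\<alpha>(b := Suc (\<alpha> b))) \<phi> = iter_deriv (mi_list \<alpha> @ [b]) \<phi>"
    unfolding multi_deriv_def using set_mi_list assms
    by (intro iter_deriv_mset_cong) auto
  then show ?thesis
    by (simp add: iter_deriv_append multi_deriv_def)
qed

lemma mi_order_Suc: "b \<in> Basis \<Longrightarrow> mi_order (\<alpha>(b := Suc (\<alpha> b))) = Suc (mi_order \<alpha>)"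
  unfolding mi_order_def by (simp add: sum.remove[of Basis b])

lemma multi_indices_Suc: "\<alpha> \<in> multi_indices \<Longrightarrow> b \<in> Basis \<Longrightarrow> \<alpha>(b := Suc (\<alpha> b)) \<in> multi_indices"
  by (auto simp: multi_indices_def)

section \<open>Tensor products and translates of smooth functions\<close>

lemma has_derivative_tensor:
  assumes "smooth \<phi>" "smooth \<psi>"
  shows "((\<lambda>(x, y). \<phi> x * \<psi> y) has_derivative
    (\<lambda>(u, v). \<phi> x * frechet_derivative \<psi> (at y) v + frechet_derivative \<phi> (at x) u * \<psi> y)) (at (x, y))"
proof -
  have "((\<lambda>z. \<phi> (fst z)) has_derivative (\<lambda>h. frechet_derivative \<phi> (at x) (fst h))) (at (x, y))"
    using has_derivative_compose[OF has_derivative_fst[OF has_derivative_ident], of \<phi> _ "(x, y)" UNIV]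
      smooth_has_derivative[OF assms(1)] by simp
  moreover have "((\<lambda>z. \<psi> (snd z)) has_derivative (\<lambda>h. frechet_derivative \<psi> (at y) (snd h))) (at (x, y))"
    using has_derivative_compose[OF has_derivative_snd[OF has_derivative_ident], of \<psi> _ "(x, y)" UNIV]
      smooth_has_derivative[OF assms(2)] by simp
  ultimately show ?thesis
    unfolding case_prod_beta
    using has_derivative_mult[of "\<lambda>z. \<phi> (fst z)" _ "(x, y)" UNIV "\<lambda>z. \<psi> (snd z)"] by fastforce
qed

lemma partial_tensor:
  assumes "smooth \<phi>" "smooth \<psi>"
  shows "partial (u, v) (\<lambda>(x, y). \<phi> x * \<psi> y) (x, y) = \<phi> x * partial v \<psi> y + partial u \<phi> x * \<psi> y"
  using frechet_derivative_at[OF has_derivative_tensor[OF assms, of x y]] by (metis case_prod_conv)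

lemma frechet_derivative_zero_right: "smooth \<phi> \<Longrightarrow> frechet_derivative \<phi> (at x) 0 = 0"
  using linear_0 linear_frechet_derivative smooth_differentiable by blast

lemma partial_tensor_fst:
  assumes "smooth \<phi>" "smooth \<psi>"
  shows "partial (u, 0) (\<lambda>(x, y). \<phi> x * \<psi> y) = (\<lambda>(x, y). partial u \<phi> x * \<psi> y)"
  using partial_tensor[OF assms] by (auto simp: fun_eq_iff frechet_derivative_zero_right assms)

lemma partial_tensor_snd:
  assumes "smooth \<phi>" "smooth \<psi>"
  shows "partial (0, v) (\<lambda>(x, y). \<phi> x * \<psi> y) = (\<lambda>(x, y). \<phi> x * partial v \<psi> y)"
  using partial_tensor[OF assms] by (auto simp: fun_eq_iff frechet_derivative_zero_right assms)

text \<open>A basis vector of the product space lies in one of the two factors, so a partial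
  derivative of a tensor product is again a single tensor product, with no sum from the product
  rule.\<close>

lemma smooth_tensor:
  assumes "smooth \<phi>" "smooth \<psi>"
  shows "smooth (\<lambda>(x, y). \<phi> x * \<psi> y)"
proof (rule smooth_coinduct)
  let ?S = "\<lambda>h. \<exists>\<phi> \<psi>. smooth \<phi> \<and> smooth \<psi> \<and> h = (\<lambda>(x, y). \<phi> x * \<psi> y)"
  show "?S (\<lambda>(x, y). \<phi> x * \<psi> y)" using assms by blast
  show "h differentiable at z" if "?S h" for h z
    using that has_derivative_tensor by (cases z) (auto simp: differentiable_def, blast)
  show "?S (partial w h)" if S: "?S h" and w: "w \<in> Basis" for h w
  proof -
    obtain \<phi> \<psi> where *: "smooth \<phi>" "smooth \<psi>" "h = (\<lambda>(x, y). \<phi> x * \<psi> y)"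
      using S by blast
    from w consider u where "u \<in> Basis" "w = (u, 0)" | v where "v \<in> Basis" "w = (0, v)"
      by (auto simp: Basis_prod_def)
    then show ?thesis
      using * by cases (auto simp: partial_tensor_fst partial_tensor_snd intro: smooth_partial)
  qed
qed

text \<open>
  On the product space, \<open>basis_list\<close> may enumerate the vectors \<open>(b, 0)\<close> in an order unrelated
  to its order on the first factor; hence the detour through multisets.
\<close>

lemma multi_deriv_tensor:
  fixes \<phi> :: "'a::euclidean_space \<Rightarrow> real" and \<psi> :: "'b::euclidean_space \<Rightarrow> real"
  assumes \<phi>: "smooth \<phi>" and \<psi>: "smooth \<psi>"
  shows "multi_deriv (first_arg \<alpha>) (\<lambda>(x, y). \<phi> x * \<psi> y) = (\<lambda>(x, y). multi_deriv \<alpha> \<phi> x * \<psi> y)"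
proof -
  let ?emb = "\<lambda>b::'a. (b, 0::'b)"
  have *: "iter_deriv (map ?emb vs) (\<lambda>(x, y). \<phi> x * \<psi> y) = (\<lambda>(x, y). iter_deriv vs \<phi> x * \<psi> y)"
    if "set vs \<subseteq> Basis" for vs
    using that
    by (induction vs) (auto simp: partial_tensor_fst smooth_iter_deriv \<phi> \<psi> simp del: split_paired_All)
  have "mset (mi_list (first_arg \<alpha>)) = mset (map ?emb (mi_list \<alpha>))"
  proof (rule multiset_eqI)
    fix w :: "'a \<times> 'b"
    obtain u v where w: "w = (u, v)" by fastforce
    have "count (mset (map ?emb (mi_list \<alpha>))) w = (if v = 0 then count (mset (mi_list \<alpha>)) u else 0)"
    proof (cases "v = 0")
      case True
      have "count (image_mset ?emb M) (?emb u) = count M u" for M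
        by (induction M) auto
      then show ?thesis using True w by simp
    qed (auto simp: w count_eq_zero_iff simp flip: set_mset_mset)
    also have "\<dots> = count (mset (mi_list (first_arg \<alpha>))) w"
      unfolding count_mi_list w by (auto simp: first_arg_def Basis_prod_def)
    finally show "count (mset (mi_list (first_arg \<alpha>))) w = count (mset (map ?emb (mi_list \<alpha>))) w" ..
  qed
  then have "multi_deriv (first_arg \<alpha>) (\<lambda>(x, y). \<phi> x * \<psi> y)
      = iter_deriv (map ?emb (mi_list \<alpha>)) (\<lambda>(x, y). \<phi> x * \<psi> y)"
    unfolding multi_deriv_def using set_mi_list[of \<alpha>]
    by (intro iter_deriv_mset_cong smooth_tensor \<phi> \<psi>) (auto simp: Basis_prod_def)
  then show ?thesis
    using *[OF set_mi_list] by (simp add: multi_deriv_def)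
qed

lemma smooth_translate:
  assumes "smooth \<phi>"
  shows "smooth (\<lambda>x. \<phi> (x - w))" "partial v (\<lambda>x. \<phi> (x - w)) = (\<lambda>x. partial v \<phi> (x - w))"
proof -
  have deriv: "((\<lambda>x. \<phi> (x - w)) has_derivative frechet_derivative \<phi> (at (x - w))) (at x)"
    if "smooth \<phi>" for x \<phi>
  proof -
    have "((\<lambda>x. x - w) has_derivative (\<lambda>h. h)) (at x)"
      by (auto intro!: derivative_eq_intros)
    from has_derivative_compose[OF this smooth_has_derivative[OF that]] show ?thesis .
  qed
  have eq: "partial v (\<lambda>x. \<phi> (x - w)) = (\<lambda>x. partial v \<phi> (x - w))" if "smooth \<phi>" for \<phi> v
    using frechet_derivative_at[OF deriv[OF that]] by (auto simp: fun_eq_iff)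
  then show "partial v (\<lambda>x. \<phi> (x - w)) = (\<lambda>x. partial v \<phi> (x - w))"
    using assms by blast
  show "smooth (\<lambda>x. \<phi> (x - w))"
  proof (rule smooth_coinduct)
    let ?S = "\<lambda>h. \<exists>\<phi>. smooth \<phi> \<and> h = (\<lambda>x. \<phi> (x - w))"
    show "?S (\<lambda>x. \<phi> (x - w))" using assms by blast
    show "h differentiable at z" if "?S h" for h z
      using that deriv by (auto simp: differentiable_def)
    show "?S (partial v h)" if "?S h" "v \<in> Basis" for h v
      using that eq smooth_partial by (metis (no_types, lifting))
  qed
qed

section \<open>Stability of the space of test functions\<close>

lemma test_functions_smooth: "\<phi> \<in> test_functions \<Omega> \<Longrightarrow> smooth \<phi>"
  by (simp add: test_functions_def)

lemma test_functions_support: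
  assumes "\<phi> \<in> test_functions \<Omega>"
  obtains K where "compact K" "K \<subseteq> \<Omega>" "\<And>x. x \<notin> K \<Longrightarrow> \<phi> x = 0"
  using assms closure_subset[of "{x. \<phi> x \<noteq> 0}"]
  by (intro that[of "closure {x. \<phi> x \<noteq> 0}"]) (auto simp: test_functions_def)

lemma test_functionsI:
  assumes "smooth \<phi>" "compact K" "K \<subseteq> \<Omega>" "\<And>x. x \<notin> K \<Longrightarrow> \<phi> x = 0"
  shows "\<phi> \<in> test_functions \<Omega>"
proof -
  have "{x. \<phi> x \<noteq> 0} \<subseteq> K"
    using assms(4) by blast
  then have "closure {x. \<phi> x \<noteq> 0} \<subseteq> K" "bounded {x. \<phi> x \<noteq> 0}"
    using assms(2) closure_minimal[of _ K] by (auto simp: compact_eq_bounded_closed intro: bounded_subset)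
  then show ?thesis
    using assms(1,3) by (auto simp: test_functions_def)
qed

lemma partial_eq_zero_outside:
  assumes "compact K" "\<And>x. x \<notin> K \<Longrightarrow> \<phi> x = 0" "x \<notin> K"
  shows "partial v \<phi> x = 0"
proof -
  have "open (- K)" using assms(1) by (simp add: compact_imp_closed open_Compl)
  then have "(\<phi> has_derivative (\<lambda>_. 0)) (at x)"
    using assms by (intro has_derivative_transform_within_open[of "\<lambda>_. 0" "\<lambda>_. 0" x UNIV "- K" \<phi>]) auto
  then show ?thesis
    by (metis frechet_derivative_at)
qed

lemma test_functions_partial:
  assumes "\<phi> \<in> test_functions \<Omega>" "v \<in> Basis"
  shows "partial v \<phi> \<in> test_functions \<Omega>"
proof -
  obtain K where K: "compact K" "K \<subseteq> \<Omega>" "\<And>x. x \<notin> K \<Longrightarrow> \<phi> x = 0"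
    using test_functions_support[OF assms(1)] by blast
  show ?thesis
    by (rule test_functionsI[OF smooth_partial K(1,2)])
      (use assms partial_eq_zero_outside[OF K(1,3)] in \<open>auto simp: test_functions_smooth\<close>)
qed

lemma test_functions_iter_deriv:
  assumes "\<phi> \<in> test_functions \<Omega>" "set vs \<subseteq> Basis"
  shows "iter_deriv vs \<phi> \<in> test_functions \<Omega>"
  using assms(2) by (induction vs) (auto intro: assms test_functions_partial)

lemma test_functions_multi_deriv:
  "\<phi> \<in> test_functions \<Omega> \<Longrightarrow> multi_deriv \<alpha> \<phi> \<in> test_functions \<Omega>"
  unfolding multi_deriv_def by (rule test_functions_iter_deriv[OF _ set_mi_list])

lemma test_functions_tensor:
  assumes "\<phi> \<in> test_functions A" "\<psi> \<in> test_functions B"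
  shows "(\<lambda>(x, y). \<phi> x * \<psi> y) \<in> test_functions (A \<times> B)"
proof -
  obtain K where K: "compact K" "K \<subseteq> A" "\<And>x. x \<notin> K \<Longrightarrow> \<phi> x = 0"
    using test_functions_support[OF assms(1)] by blast
  obtain L where L: "compact L" "L \<subseteq> B" "\<And>x. x \<notin> L \<Longrightarrow> \<psi> x = 0"
    using test_functions_support[OF assms(2)] by blast
  show ?thesis
    by (rule test_functionsI[OF smooth_tensor, of _ _ "K \<times> L"])
      (use assms K L in \<open>auto simp: test_functions_smooth compact_Times dest: contrapos_np[OF _ K(3)] contrapos_np[OF _ L(3)]\<close>)
qed

lemma test_functions_translate:
  assumes "\<phi> \<in> test_functions A" "(\<lambda>x. x + w) ` A \<subseteq> B"
  shows "(\<lambda>x. \<phi> (x - w)) \<in> test_functions B"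
proof -
  obtain K where K: "compact K" "K \<subseteq> A" "\<And>x. x \<notin> K \<Longrightarrow> \<phi> x = 0"
    using test_functions_support[OF assms(1)] by blast
  show ?thesis
  proof (rule test_functionsI[OF smooth_translate(1), of _ "(\<lambda>x. x + w) ` K"])
    show "compact ((\<lambda>x. x + w) ` K)"
      using K(1) by (intro compact_continuous_image continuous_intros)
    show "\<phi> (x - w) = 0" if "x \<notin> (\<lambda>x. x + w) ` K" for x
      using that by (intro K(3)) (metis diff_add_cancel imageI)
  qed (use assms K in \<open>auto simp: test_functions_smooth\<close>)
qed

lemma test_functions_measurable: "\<phi> \<in> test_functions \<Omega> \<Longrightarrow> \<phi> \<in> borel_measurable borel"
  using smooth_continuous test_functions_smooth borel_measurable_continuous_onI by blast

lemma test_functions_bounded: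
  assumes "\<phi> \<in> test_functions \<Omega>"
  obtains B where "B \<ge> 0" "\<And>x. \<bar>\<phi> x\<bar> \<le> B"
proof -
  obtain K where K: "compact K" "K \<subseteq> \<Omega>" "\<And>x. x \<notin> K \<Longrightarrow> \<phi> x = 0"
    using test_functions_support[OF assms(1)] by blast
  have "bounded (\<phi> ` K)"
    using K(1) assms by (intro compact_imp_bounded compact_continuous_image smooth_continuous test_functions_smooth)
  then obtain B where B: "\<And>x. x \<in> K \<Longrightarrow> \<bar>\<phi> x\<bar> \<le> B"
    unfolding bounded_iff by auto
  show ?thesis
    by (rule that[of "max B 0"]) (use B K in \<open>force simp: le_max_iff_disj\<close>)+
qed

subsection \<open>Bump functions\<close>

definition flat :: "real poly \<Rightarrow> real \<Rightarrow> real" where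
  "flat P t = (if t > 0 then poly P (1 / t) * exp (- (1 / t)) else 0)"

lemma poly_times_exp_tendsto_0: "((\<lambda>x::real. poly P x * exp (- x)) \<longlongrightarrow> 0) at_top"
proof -
  have "((\<lambda>x::real. \<Sum>i\<le>degree P. coeff P i * (x ^ i / exp x)) \<longlongrightarrow> (\<Sum>i\<le>degree P. coeff P i * 0)) at_top"
    by (intro tendsto_intros tendsto_power_div_exp_0)
  then show ?thesis
    by (simp add: poly_altdef exp_minus sum_distrib_right sum_distrib_left field_simps)
qed

lemma flat_tendsto_0: "(flat P \<longlongrightarrow> 0) (at_right 0)"
proof (rule Lim_transform_eventually)
  show "((\<lambda>t. poly P (inverse t) * exp (- inverse t)) \<longlongrightarrow> 0) (at_right (0::real))"
    by (rule filterlim_compose[OF poly_times_exp_tendsto_0 filterlim_inverse_at_top_right])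
  show "\<forall>\<^sub>F t in at_right 0. poly P (inverse t) * exp (- inverse t) = flat P t"
    unfolding eventually_at_right_field by (auto simp: flat_def inverse_eq_divide intro!: exI[of _ 1])
qed

text \<open>The chain rule for P(1/t) exp(-1/t) yields the factor (P - P')(1/t) / t^2, that is, the
  polynomial x^2 (P - P') evaluated at 1/t. At 0 the exponential beats every power of 1/t.\<close>

lemma flat_has_derivative:
  "(flat P has_real_derivative flat ([:0, 0, 1:] * (P - pderiv P)) t) (at t)"
proof -
  consider "t > 0" | "t < 0" | "t = 0" by linarith
  then show ?thesis
  proof cases
    case 1
    have "((\<lambda>t. poly P (1 / t) * exp (- (1 / t))) has_real_derivative
        flat ([:0, 0, 1:] * (P - pderiv P)) t) (at t)"
      using 1 by (auto intro!: derivative_eq_intros simp: flat_def field_simps power2_eq_square)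
    then show ?thesis
      by (rule has_field_derivative_transform_within_open[of _ _ _ "{0<..}"]) (use 1 in \<open>auto simp: flat_def\<close>)
  next
    case 2
    have "((\<lambda>_. 0) has_real_derivative flat ([:0, 0, 1:] * (P - pderiv P)) t) (at t)"
      using 2 by (simp add: flat_def)
    then show ?thesis
      by (rule has_field_derivative_transform_within_open[of _ _ _ "{..<0}"]) (use 2 in \<open>auto simp: flat_def\<close>)
  next
    case 3
    have "((\<lambda>h. flat P h / h) \<longlongrightarrow> 0) (at_left 0)"
      by (rule Lim_transform_eventually[of "\<lambda>_. 0"])
        (auto simp: flat_def eventually_at_left_field intro!: exI[of _ "-1"])
    \<comment> \<open>For positive \<open>h\<close> the difference quotient at 0 is itself a
      \<open>flat\<close> function, its polynomial being multiplied by the variable.\<close>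
    moreover have "((\<lambda>h. flat P h / h) \<longlongrightarrow> 0) (at_right 0)"
      by (rule Lim_transform_eventually[OF flat_tendsto_0[of "[:0, 1:] * P"]])
        (auto simp: flat_def eventually_at_right_field intro!: exI[of _ 1])
    ultimately have "((\<lambda>h. flat P h / h) \<longlongrightarrow> 0) (at 0)"
      using filterlim_split_at by blast
    then show ?thesis
      unfolding 3 DERIV_def by (simp add: flat_def)
  qed
qed

text \<open>
  The class is closed under partial derivatives, so that its members are smooth by coinduction.
\<close>

inductive flat_algebra :: "('a::euclidean_space \<Rightarrow> real) \<Rightarrow> bool" where
  flat: "flat_algebra (\<lambda>x. flat P (c \<bullet> x + d))"
| const: "flat_algebra (\<lambda>_. a)"
| add: "flat_algebra f \<Longrightarrow> flat_algebra g \<Longrightarrow> flat_algebra (\<lambda>x. f x + g x)"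
| mult: "flat_algebra f \<Longrightarrow> flat_algebra g \<Longrightarrow> flat_algebra (\<lambda>x. f x * g x)"

lemma flat_algebra_derivative:
  assumes "flat_algebra f"
  shows "\<exists>D. (\<forall>x. (f has_derivative D x) (at x)) \<and> (\<forall>v. flat_algebra (\<lambda>x. D x v))"
  using assms
proof induction
  case (flat P c d)
  let ?Q = "[:0, 0, 1:] * (P - pderiv P)"
  have "((\<lambda>x. flat P (c \<bullet> x + d)) has_derivative (\<lambda>v. flat ?Q (c \<bullet> x + d) * (c \<bullet> v))) (at x)" for x
  proof -
    have "((\<lambda>x. c \<bullet> x + d) has_derivative (\<lambda>v. c \<bullet> v)) (at x)"
      by (auto intro!: derivative_eq_intros)
    from has_derivative_compose[OF this flat_has_derivative[unfolded has_field_derivative_def]]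
    show ?thesis .
  qed
  then show ?case
    by (intro exI[of _ "\<lambda>x v. flat ?Q (c \<bullet> x + d) * (c \<bullet> v)"]) (auto intro: flat_algebra.intros)
next
  case (const a)
  show ?case
    by (intro exI[of _ "\<lambda>x v. 0"]) (auto intro: flat_algebra.intros)
next
  case (add f g)
  then obtain D E where "\<And>x. (f has_derivative D x) (at x)" "\<And>v. flat_algebra (\<lambda>x. D x v)"
    "\<And>x. (g has_derivative E x) (at x)" "\<And>v. flat_algebra (\<lambda>x. E x v)" by blast
  then show ?case
    by (intro exI[of _ "\<lambda>x v. D x v + E x v"]) (auto intro: flat_algebra.intros has_derivative_add)
next
  case (mult f g)
  then obtain D E where "\<And>x. (f has_derivative D x) (at x)" "\<And>v. flat_algebra (\<lambda>x. D x v)"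
    "\<And>x. (g has_derivative E x) (at x)" "\<And>v. flat_algebra (\<lambda>x. E x v)" by blast
  then show ?case using mult.hyps
    by (intro exI[of _ "\<lambda>x v. f x * E x v + D x v * g x"])
      (auto intro!: flat_algebra.intros has_derivative_mult)
qed

lemma flat_algebra_smooth:
  assumes "flat_algebra f"
  shows "smooth f"
proof (rule smooth_coinduct[of flat_algebra, OF assms])
  show "\<phi> differentiable at x" if "flat_algebra \<phi>" for \<phi> :: "'a \<Rightarrow> real" and x
    using flat_algebra_derivative[OF that] by (auto simp: differentiable_def)
  show "flat_algebra (partial v \<phi>)" if \<phi>: "flat_algebra \<phi>" for \<phi> :: "'a \<Rightarrow> real" and v
  proof -
    obtain D where D: "\<And>x. (\<phi> has_derivative D x) (at x)" "\<And>v. flat_algebra (\<lambda>x. D x v)"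
      using flat_algebra_derivative[OF \<phi>] by blast
    have "partial v \<phi> = (\<lambda>x. D x v)"
      using frechet_derivative_at[OF D(1)] by (auto simp: fun_eq_iff)
    with D(2) show ?thesis by simp
  qed
qed

lemma flat_algebra_prod:
  assumes "finite I" "\<And>i. i \<in> I \<Longrightarrow> flat_algebra (f i)"
  shows "flat_algebra (\<lambda>x. \<Prod>i\<in>I. f i x)"
  using assms by (induction I) (auto intro: flat_algebra.intros)

text \<open>Each factor is exp(-1/t) with t proportional to the signed distance from a face of the
  box. The slope \<open>Suc m\<close> drives the factors to 1 inside the box, so indicators of open
  boxes become bounded pointwise limits of test functions without any mollification.\<close>

definition bump :: "'a::euclidean_space \<Rightarrow> 'a \<Rightarrow> nat \<Rightarrow> 'a \<Rightarrow> real" where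
  "bump a b m x = (\<Prod>i\<in>Basis. flat 1 (real (Suc m) * ((x - a) \<bullet> i)) * flat 1 (real (Suc m) * ((b - x) \<bullet> i)))"

lemma bump_smooth: "smooth (bump a b m)"
proof -
  have 1: "flat_algebra (\<lambda>x. flat 1 (real (Suc m) * ((x - a) \<bullet> i)))" for i
    using flat_algebra.flat[of 1 "real (Suc m) *\<^sub>R i" "- real (Suc m) * (a \<bullet> i)"]
    by (simp add: algebra_simps inner_diff_left inner_commute)
  have 2: "flat_algebra (\<lambda>x. flat 1 (real (Suc m) * ((b - x) \<bullet> i)))" for i
    using flat_algebra.flat[of 1 "- real (Suc m) *\<^sub>R i" "real (Suc m) * (b \<bullet> i)"]
    by (simp add: algebra_simps inner_diff_left inner_commute)
  show ?thesis
    unfolding bump_def[abs_def]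
    by (intro flat_algebra_smooth flat_algebra_prod flat_algebra.mult 1 2) auto
qed

lemma bump_eq_0: "x \<notin> box a b \<Longrightarrow> bump a b m x = 0"
  unfolding bump_def box_def
  by (intro prod_zero, simp)
    (auto simp: flat_def inner_diff_left not_less zero_less_mult_iff dest: leD intro: bexI[rotated])

lemma bump_test_function:
  assumes "cbox a b \<subseteq> \<Omega>"
  shows "bump a b m \<in> test_functions \<Omega>"
  using box_subset_cbox[of a b]
  by (intro test_functionsI[OF bump_smooth compact_cbox assms] bump_eq_0) auto

lemma flat_1_bounds: "0 \<le> flat 1 t" "flat 1 t \<le> 1"
  by (auto simp: flat_def)

lemma bump_bounds: "\<bar>bump a b m x\<bar> \<le> 1"
proof -
  have "\<bar>flat 1 s * flat 1 t\<bar> \<le> 1" for s t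
    using flat_1_bounds[of s] flat_1_bounds[of t] by (simp add: mult_le_one)
  then show ?thesis
    unfolding bump_def abs_prod by (intro prod_le_1) auto
qed

lemma bump_tendsto: "(\<lambda>m. bump a b m x) \<longlonglongrightarrow> indicator (box a b) x"
proof (cases "x \<in> box a b")
  case True
  have *: "(\<lambda>m. flat 1 (real (Suc m) * s)) \<longlonglongrightarrow> 1" if "s > 0" for s
  proof -
    have "(\<lambda>m. exp (- (inverse (real (Suc m)) * (1 / s)))) \<longlonglongrightarrow> exp (- (0 * (1 / s)))"
      by (intro tendsto_intros LIMSEQ_inverse_real_of_nat)
    moreover have "(\<lambda>m. exp (- (inverse (real (Suc m)) * (1 / s)))) = (\<lambda>m. flat 1 (real (Suc m) * s))"
      using that by (auto simp: flat_def field_simps fun_eq_iff simp del: of_nat_Suc)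
    ultimately show ?thesis by (simp only: mult_zero_left minus_zero exp_zero)
  qed
  have "(\<lambda>m. bump a b m x) \<longlonglongrightarrow> (\<Prod>i\<in>(Basis::'a set). 1 * 1)"
    unfolding bump_def using True
    by (intro tendsto_prod tendsto_mult *) (auto simp: box_def inner_diff_left)
  then show ?thesis using True by simp
qed (simp add: bump_eq_0)

subsection \<open>The fundamental lemma of the calculus of variations\<close>

text \<open>Componentwise: each coordinate has a real Borel representative, and the union of the
  finitely many exceptional sets is still null.\<close>

lemma lebesgue_ex_borel_measurable:
  fixes g :: "'a::euclidean_space \<Rightarrow> 'k::euclidean_space"
  assumes "g \<in> borel_measurable lebesgue"
  obtains g' where "g' \<in> borel_measurable borel" "AE x in lebesgue. g x = g' x"
proof -
  have "\<exists>g'\<in>borel_measurable lborel. AE x in lborel. g x \<bullet> i = g' x" for i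
    using assms by (intro completion_ex_borel_measurable_real) auto
  then obtain G where G: "\<And>i. G i \<in> borel_measurable lborel" "\<And>i. AE x in lborel. g x \<bullet> i = G i x"
    by metis
  show thesis
  proof
    show "(\<lambda>x. \<Sum>i\<in>Basis. G i x *\<^sub>R i) \<in> borel_measurable borel"
      using G(1) by simp
    have "AE x in lborel. \<forall>i\<in>Basis. g x \<bullet> i = G i x"
      using G(2) by (intro AE_finite_allI) auto
    then have "AE x in lborel. g x = (\<Sum>i\<in>Basis. G i x *\<^sub>R i)"
      by eventually_elim (metis (no_types, lifting) euclidean_representation sum.cong)
    then show "AE x in lebesgue. g x = (\<Sum>i\<in>Basis. G i x *\<^sub>R i)"
      by (rule AE_completion)
  qed
qed

text \<open>Dynkin's argument: open boxes form an intersection-stable generator of the Borel sets,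
  and the sets over which \<open>h\<close> integrates to zero are closed under countable disjoint
  unions and, since the total integral is zero, under complements.\<close>

lemma AE_zero_if_box_integrals_zero:
  fixes h :: "'a::euclidean_space \<Rightarrow> 'k::{banach, second_countable_topology}"
  assumes h: "integrable lborel h" and zero: "integral\<^sup>L lborel h = 0"
    and box: "\<And>c d. set_lebesgue_integral lborel (box c d) h = 0"
  shows "AE x in lborel. h x = 0"
proof (rule sigma_finite_measure.density_zero[OF sigma_finite_lborel h])
  fix A :: "'a set" assume "A \<in> sets lborel"
  then have A: "A \<in> sigma_sets UNIV (range (\<lambda>(a, b). box a b))"
    by (simp add: borel_eq_box)
  have sets: "B \<in> sets lborel" if "B \<in> sigma_sets UNIV (range (\<lambda>(a, b). box a b))" for B :: "'a set"
    using that by (simp add: borel_eq_box)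
  have set_int: "set_integrable lborel B h" if "B \<in> sets lborel" for B
    using h that unfolding set_integrable_def by (intro integrable_mult_indicator)
  have "Int_stable (range (\<lambda>(a, b). box a b :: 'a set))"
    by (auto simp: Int_stable_def box_Int_box)
  moreover have "range (\<lambda>(a, b). box a b :: 'a set) \<subseteq> Pow UNIV" by simp
  ultimately show "set_lebesgue_integral lborel A h = 0"
    using A
  proof (induction rule: sigma_sets_induct_disjoint)
    case (basic A)
    then show ?case using box by auto
  next
    case empty
    show ?case by (simp add: set_lebesgue_integral_def)
  next
    case (compl A)
    have "set_lebesgue_integral lborel (A \<union> (UNIV - A)) h
        = set_lebesgue_integral lborel A h + set_lebesgue_integral lborel (UNIV - A) h"
      using sets[OF compl(1)] by (intro set_integral_Un set_int) auto
    then show ?case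
      using compl(2) zero by (simp add: set_lebesgue_integral_def)
  next
    case (union A)
    have "set_lebesgue_integral lborel (\<Union>i. A i) h = (\<Sum>i. set_lebesgue_integral lborel (A i) h)"
    proof (intro lebesgue_integral_countable_add set_int)
      show "A i \<in> sets lborel" for i
        using union(2) by (intro sets) auto
      then show "(\<Union>i. A i) \<in> sets lborel" by blast
    qed (use union(1) in \<open>auto simp: disjoint_family_on_def\<close>)
    then show ?case using union(3) by simp
  qed
qed

text \<open>\<open>f\<close> is a pointwise limit of its restrictions to the members of a compact
  exhaustion. This is how \<open>weak_deriv\<close>, known only through its defining property, is
  seen to be measurable.\<close>

lemma locally_integrable_measurable:
  fixes f :: "'a::euclidean_space \<Rightarrow> 'k::{real_normed_field,euclidean_space}"
  assumes "open \<Omega>" "locally_integrable \<Omega> f"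
  shows "f \<in> borel_measurable (lebesgue_on \<Omega>)"
proof -
  obtain C where C: "\<And>n. compact (C n)" "\<And>n. C n \<subseteq> \<Omega>" "\<And>n. C n \<subseteq> interior (C (Suc n))" "\<Union> (range C) = \<Omega>"
    using open_Union_compact_subsets[OF assms(1)] by metis
  have mono: "C m \<subseteq> C n" if "m \<le> n" for m n
    using lift_Suc_mono_le[of C, OF _ that] C(3) interior_subset by blast
  have lim: "(\<lambda>n. indicator (C n) x *\<^sub>R f x) \<longlonglongrightarrow> indicator \<Omega> x *\<^sub>R f x" for x
  proof (cases "x \<in> \<Omega>")
    case True
    then obtain m where "x \<in> C m" using C(4) by blast
    then have "\<forall>n\<ge>m. indicator (C n) x *\<^sub>R f x = indicator \<Omega> x *\<^sub>R f x"
      using mono True by (auto simp: indicator_def)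
    then show ?thesis
      by (intro tendsto_eventually) (auto simp: eventually_sequentially)
  next
    case False
    then have "x \<notin> C n" for n
      using C(2)[of n] by auto
    then show ?thesis using False by simp
  qed
  have meas: "(\<lambda>x. indicator (C n) x *\<^sub>R f x) \<in> borel_measurable lebesgue" for n
    using assms(2) C(1,2)[of n] unfolding locally_integrable_def set_integrable_def
    by (intro borel_measurable_integrable) simp
  have "(\<lambda>x. indicator \<Omega> x *\<^sub>R f x) \<in> borel_measurable lebesgue"
    by (rule borel_measurable_LIMSEQ_metric[OF meas lim])
  then show ?thesis
    using assms(1) by (simp add: borel_measurable_restrict_space_iff)
qed

text \<open>The bump functions of the box are test functions because the closed box lies in
  \<open>\<Omega>\<close>, and \<open>norm (h x)\<close> on that closed box dominates the sequence;
  the limit of the vanishing integrals is the integral over the open box.\<close>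

lemma integral_box_eq_zero:
  fixes h :: "'a::euclidean_space \<Rightarrow> 'k::{real_normed_field,euclidean_space}"
  assumes "locally_integrable \<Omega> h" "cbox a b \<subseteq> \<Omega>" "\<Omega> \<in> sets lebesgue"
    and test: "\<And>\<phi>. \<phi> \<in> test_functions \<Omega> \<Longrightarrow> (LINT x:\<Omega>|lebesgue. \<phi> x *\<^sub>R h x) = 0"
  shows "set_lebesgue_integral lebesgue (box a b) h = 0"
proof -
  let ?h = "\<lambda>x. indicator (cbox a b) x *\<^sub>R h x"
  have h: "integrable lebesgue ?h"
    using assms(1,2) by (auto simp: locally_integrable_def set_integrable_def)
  have "(\<lambda>m. LINT x|lebesgue. bump a b m x *\<^sub>R ?h x) \<longlonglongrightarrow> (LINT x|lebesgue. indicator (box a b) x *\<^sub>R ?h x)"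
  proof (rule integral_dominated_convergence[where w = "\<lambda>x. norm (?h x)"])
    show "(\<lambda>x. bump a b m x *\<^sub>R ?h x) \<in> borel_measurable lebesgue" for m
      using test_functions_measurable[OF bump_test_function[OF order.refl, of a b m]]
      by (intro borel_measurable_scaleR[OF _ borel_measurable_integrable[OF h]]) (simp add: measurable_completion)
    show "AE x in lebesgue. (\<lambda>m. bump a b m x *\<^sub>R ?h x) \<longlonglongrightarrow> indicator (box a b) x *\<^sub>R ?h x"
      by (intro AE_I2 tendsto_intros bump_tendsto)
    show "AE x in lebesgue. norm (bump a b m x *\<^sub>R ?h x) \<le> norm (?h x)" for m
      unfolding norm_scaleR[of "bump a b m _"] by (intro AE_I2 mult_left_le_one_le bump_bounds) auto
    show "(\<lambda>x. indicator (box a b) x *\<^sub>R ?h x) \<in> borel_measurable lebesgue"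
      by (intro borel_measurable_scaleR[OF _ borel_measurable_integrable[OF h]] borel_measurable_indicator) simp
  qed (rule integrable_norm[OF h])
  moreover have "(LINT x|lebesgue. bump a b m x *\<^sub>R ?h x) = 0" for m
  proof -
    have "(LINT x|lebesgue. bump a b m x *\<^sub>R ?h x) = (LINT x:\<Omega>|lebesgue. bump a b m x *\<^sub>R h x)"
      unfolding set_lebesgue_integral_def using assms(2) box_subset_cbox[of a b]
      by (intro Bochner_Integration.integral_cong) (auto simp: indicator_def intro!: bump_eq_0)
    then show ?thesis
      using test[OF bump_test_function[OF assms(2)]] by simp
  qed
  ultimately have "(LINT x|lebesgue. indicator (box a b) x *\<^sub>R ?h x) = 0"
    by (simp add: LIMSEQ_const_iff)
  moreover have "(LINT x|lebesgue. indicator (box a b) x *\<^sub>R ?h x) = set_lebesgue_integral lebesgue (box a b) h"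
    unfolding set_lebesgue_integral_def using box_subset_cbox[of a b]
    by (intro Bochner_Integration.integral_cong) (auto simp: indicator_def)
  ultimately show ?thesis by simp
qed

text \<open>Countably many closed boxes cover \<open>\<Omega>\<close>, so one box suffices. There a
  Borel representative of the truncated function has zero integral over every open box.\<close>

lemma locally_integrable_AE_zero:
  fixes h :: "'a::euclidean_space \<Rightarrow> 'k::{real_normed_field,euclidean_space}"
  assumes \<Omega>: "open \<Omega>" and h: "locally_integrable \<Omega> h"
    and test: "\<And>\<phi>. \<phi> \<in> test_functions \<Omega> \<Longrightarrow> (LINT x:\<Omega>|lebesgue. \<phi> x *\<^sub>R h x) = 0"
  shows "AE x in lebesgue. x \<in> \<Omega> \<longrightarrow> h x = 0"
proof -
  have cbox: "AE x in lebesgue. x \<in> cbox a b \<longrightarrow> h x = 0" if ab: "cbox a b \<subseteq> \<Omega>" for a b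
  proof -
    let ?h = "\<lambda>x. indicator (box a b) x *\<^sub>R h x"
    have "set_integrable lebesgue (cbox a b) h"
      using h ab by (auto simp: locally_integrable_def)
    then have h1: "integrable lebesgue ?h"
      using set_integrable_subset[of lebesgue "cbox a b" h "box a b"] box_subset_cbox[of a b]
      by (auto simp: set_integrable_def)
    then obtain h' where h': "h' \<in> borel_measurable borel" "AE x in lebesgue. ?h x = h' x"
      by (metis lebesgue_ex_borel_measurable borel_measurable_integrable)
    have meas: "h' \<in> borel_measurable lebesgue"
      using h'(1) by (simp add: measurable_completion)
    have "integrable lebesgue h'"
      using integrable_cong_AE_imp[OF h1 meas h'(2)] .
    then have int: "integrable lborel h'"
      using h'(1) by (simp add: integrable_completion)
    \<comment> \<open>The box \<open>box c d\<close> may leave \<open>\<Omega>\<close>, but only its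
      intersection with \<open>box a b\<close> counts, and that is again an open box.\<close>
    have box: "(LINT x:box c d|lborel. h' x) = 0" for c d
    proof -
      have "(LINT x:box c d|lborel. h' x) = (LINT x|lebesgue. indicator (box c d) x *\<^sub>R h' x)"
        unfolding set_lebesgue_integral_def using h'(1) by (intro integral_completion[symmetric]) simp
      also have "\<dots> = (LINT x|lebesgue. indicator (box c d) x *\<^sub>R ?h x)"
      proof (rule integral_cong_AE)
        show "AE x in lebesgue. indicator (box c d) x *\<^sub>R h' x = indicator (box c d) x *\<^sub>R ?h x"
          using h'(2) by eventually_elim simp
      qed (intro borel_measurable_scaleR borel_measurable_indicator meas borel_measurable_integrable[OF h1], simp)+
      also have "\<dots> = (LINT x:box a b \<inter> box c d|lebesgue. h x)"
        unfolding set_lebesgue_integral_def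
        by (intro Bochner_Integration.integral_cong) (auto simp: indicator_def)
      also have "\<dots> = 0"
      proof (cases "box a b \<inter> box c d = {}")
        case False
        obtain e f where ef: "box a b \<inter> box c d = box e f"
          using box_Int_box by blast
        \<comment> \<open>This needs the open box to be nonempty: otherwise \<open>cbox e f\<close>
          may be a degenerate box outside \<open>\<Omega>\<close>.\<close>
        have "cbox e f = closure (box e f)"
          using False ef by (simp add: closure_box)
        also have "\<dots> \<subseteq> cbox a b"
          unfolding ef[symmetric] using box_subset_cbox[of a b]
          by (intro closure_minimal) auto
        finally show ?thesis
          unfolding ef using ab \<Omega> by (intro integral_box_eq_zero[OF h _ _ test]) auto
      qed (simp add: set_lebesgue_integral_def)
      finally show ?thesis .
    qed
    have "integral\<^sup>L lborel h' = (LINT x:box a b|lborel. h' x)"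
      unfolding set_lebesgue_integral_def
    proof (rule integral_cong_AE)
      have "AE x in lebesgue. h' x = indicator (box a b) x *\<^sub>R h' x"
        using h'(2) by eventually_elim (auto simp: indicator_def)
      then show "AE x in lborel. h' x = indicator (box a b) x *\<^sub>R h' x"
        by (simp add: AE_completion_iff)
    qed (use h' in auto)
    then have "AE x in lborel. h' x = 0"
      using box by (intro AE_zero_if_box_integrals_zero int) auto
    then have "AE x in lebesgue. h' x = 0"
      by (rule AE_completion)
    moreover have "AE x in lebesgue. x \<notin> cbox a b - box a b"
      using negligible_frontier_interval[of a b]
      by (intro AE_not_in) (simp add: negligible_iff_null_sets)
    ultimately show ?thesis
      using h'(2) by eventually_elim (auto simp: indicator_def split: if_splits)
  qed
  obtain \<D> where D: "countable \<D>" "\<D> \<subseteq> Pow \<Omega>" "\<And>X. X \<in> \<D> \<Longrightarrow> \<exists>a b. X = cbox a b" "\<Union>\<D> = \<Omega>"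
    using open_countable_Union_open_cbox[OF \<Omega>] by metis
  have "AE x in lebesgue. \<forall>X\<in>\<D>. x \<in> X \<longrightarrow> h x = 0"
    unfolding AE_ball_countable[OF D(1)] using D(2,3) cbox by fast
  then show ?thesis
    by eventually_elim (use D(4) in auto)
qed

lemma locally_integrable_diff:
  "locally_integrable \<Omega> f \<Longrightarrow> locally_integrable \<Omega> g \<Longrightarrow> locally_integrable \<Omega> (\<lambda>x. f x - g x)"
  by (auto simp: locally_integrable_def intro!: set_integral_diff(1))

lemma test_function_integrable:
  fixes f :: "'a::euclidean_space \<Rightarrow> 'k::{real_normed_field,euclidean_space}"
  assumes \<phi>: "\<phi> \<in> test_functions \<Omega>" and f: "locally_integrable \<Omega> f"
  shows "set_integrable lebesgue \<Omega> (\<lambda>x. \<phi> x *\<^sub>R f x)"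
proof -
  obtain K where K: "compact K" "K \<subseteq> \<Omega>" "\<And>x. x \<notin> K \<Longrightarrow> \<phi> x = 0"
    using test_functions_support[OF \<phi>] by blast
  obtain B where B: "B \<ge> 0" "\<And>x. \<bar>\<phi> x\<bar> \<le> B"
    using test_functions_bounded[OF \<phi>] by blast
  have fK: "integrable lebesgue (\<lambda>x. indicator K x *\<^sub>R f x)"
    using f K by (auto simp: locally_integrable_def set_integrable_def)
  have "integrable lebesgue (\<lambda>x. \<phi> x *\<^sub>R (indicator K x *\<^sub>R f x))"
  proof (rule Bochner_Integration.integrable_bound)
    show "integrable lebesgue (\<lambda>x. B *\<^sub>R (indicator K x *\<^sub>R f x))"
      using fK by (intro integrable_scaleR_right)
    show "(\<lambda>x. \<phi> x *\<^sub>R (indicator K x *\<^sub>R f x)) \<in> borel_measurable lebesgue"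
      using test_functions_measurable[OF \<phi>]
      by (intro borel_measurable_scaleR[OF _ borel_measurable_integrable[OF fK]]) (simp add: measurable_completion)
    show "AE x in lebesgue. norm (\<phi> x *\<^sub>R (indicator K x *\<^sub>R f x)) \<le> norm (B *\<^sub>R (indicator K x *\<^sub>R f x))"
      unfolding norm_scaleR[of "\<phi> _"] norm_scaleR[of B] using B by (intro AE_I2 mult_right_mono) auto
  qed
  moreover have "(\<lambda>x. \<phi> x *\<^sub>R (indicator K x *\<^sub>R f x)) = (\<lambda>x. indicator \<Omega> x *\<^sub>R \<phi> x *\<^sub>R f x)"
    using K by (auto simp: indicator_def fun_eq_iff)
  ultimately show ?thesis
    by (simp add: set_integrable_def)
qed

text \<open>The difference of two candidates is annihilated by all test functions. Hence whatever
  \<open>weak_deriv\<close> selects agrees almost everywhere with any explicitly constructed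
  derivative.\<close>

lemma has_weak_deriv_unique:
  fixes f :: "'a::euclidean_space \<Rightarrow> 'k::{real_normed_field,euclidean_space}"
  assumes \<Omega>: "open \<Omega>" and "has_weak_deriv \<Omega> \<alpha> f g" "has_weak_deriv \<Omega> \<alpha> f g'"
  shows "AE x in lebesgue. x \<in> \<Omega> \<longrightarrow> g x = g' x"
proof -
  have g: "locally_integrable \<Omega> g" "locally_integrable \<Omega> g'"
    using assms by (auto simp: has_weak_deriv_def)
  have "AE x in lebesgue. x \<in> \<Omega> \<longrightarrow> g x - g' x = 0"
  proof (rule locally_integrable_AE_zero[OF \<Omega> locally_integrable_diff[OF g]])
    fix \<phi> assume \<phi>: "\<phi> \<in> test_functions \<Omega>"
    have "(-1) ^ mi_order \<alpha> * (LINT x:\<Omega>|lebesgue. \<phi> x *\<^sub>R g x)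
        = (-1) ^ mi_order \<alpha> * (LINT x:\<Omega>|lebesgue. \<phi> x *\<^sub>R g' x)"
      using assms \<phi> unfolding has_weak_deriv_def by metis
    then show "(LINT x:\<Omega>|lebesgue. \<phi> x *\<^sub>R (g x - g' x)) = 0"
      by (simp add: scaleR_diff_right set_integral_diff(2) test_function_integrable[OF \<phi>] g)
  qed
  then show ?thesis by simp
qed

text \<open>A weak derivative of order zero is some function in the class of \<open>f\<close>, not
  \<open>f\<close> itself; information given for the zero multi-index is transferred to
  \<open>f\<close> here.\<close>

lemma has_weak_deriv_zero_AE_eq:
  fixes f :: "'a::euclidean_space \<Rightarrow> 'k::{real_normed_field,euclidean_space}"
  assumes "open \<Omega>" "has_weak_deriv \<Omega> (\<lambda>_. 0) f g"
  shows "AE x in lebesgue. x \<in> \<Omega> \<longrightarrow> f x = g x"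
proof (rule has_weak_deriv_unique[OF assms(1) _ assms(2)])
  show "has_weak_deriv \<Omega> (\<lambda>_. 0) f f"
    using assms(2) by (auto simp: has_weak_deriv_def multi_deriv_zero mi_order_def)
qed

subsection \<open>Square integrable functions and Borel representatives\<close>

text \<open>With values in \<open>ennreal\<close>, estimates can precede finiteness;
  \<open>L2_norm\<close> rests on a Bochner integral, which is 0 when the square is not
  integrable.\<close>

definition L2_sq ::
    "'a::euclidean_space set \<Rightarrow> ('a \<Rightarrow> 'k::{real_normed_field,euclidean_space}) \<Rightarrow> ennreal" where
  "L2_sq \<Omega> u = (\<integral>\<^sup>+x\<in>\<Omega>. ennreal ((norm (u x))\<^sup>2) \<partial>lebesgue)"

lemma L2_sq_cong_AE:
  assumes "AE x in lebesgue. x \<in> \<Omega> \<longrightarrow> u x = v x"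
  shows "L2_sq \<Omega> u = L2_sq \<Omega> v"
  unfolding L2_sq_def
  by (intro nn_integral_cong_AE) (use assms in \<open>eventually_elim, auto simp: indicator_def\<close>)

lemma L2_iff:
  assumes "\<Omega> \<in> sets lebesgue"
  shows "u \<in> L2 \<Omega> \<longleftrightarrow> u \<in> borel_measurable (lebesgue_on \<Omega>) \<and> L2_sq \<Omega> u < \<infinity>"
proof -
  have "integrable (lebesgue_on \<Omega>) (\<lambda>x. (norm (u x))\<^sup>2) \<longleftrightarrow> L2_sq \<Omega> u < \<infinity>"
    if "u \<in> borel_measurable (lebesgue_on \<Omega>)"
    using that assms by (simp add: integrable_iff_bounded nn_integral_restrict_space L2_sq_def)
  then show ?thesis
    by (auto simp: L2_def)
qed

lemma L2_norm_sq:
  assumes "\<Omega> \<in> sets lebesgue" "u \<in> L2 \<Omega>"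
  shows "ennreal ((L2_norm \<Omega> u)\<^sup>2) = L2_sq \<Omega> u"
proof -
  have "ennreal ((L2_norm \<Omega> u)\<^sup>2) = ennreal (LINT x|lebesgue_on \<Omega>. (norm (u x))\<^sup>2)"
    by (simp add: L2_norm_def)
  also have "\<dots> = (\<integral>\<^sup>+x. ennreal ((norm (u x))\<^sup>2) \<partial>lebesgue_on \<Omega>)"
    using assms(2) by (intro nn_integral_eq_integral[symmetric]) (auto simp: L2_def)
  also have "\<dots> = L2_sq \<Omega> u"
    using assms(1) by (simp add: nn_integral_restrict_space L2_sq_def)
  finally show ?thesis .
qed

text \<open>Extension by zero makes the representative Borel on the whole space, so that translation
  invariance and Fubini apply to \<open>lborel\<close> and its products without tracking domains or
  completions.\<close>

lemma ex_borel_representative: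
  fixes u :: "'a::euclidean_space \<Rightarrow> 'k::{real_normed_field,euclidean_space}"
  assumes \<Omega>: "open \<Omega>" and u: "u \<in> borel_measurable (lebesgue_on \<Omega>)"
  obtains v where "v \<in> borel_measurable borel" "\<And>x. x \<notin> \<Omega> \<Longrightarrow> v x = 0"
    "AE x in lebesgue. x \<in> \<Omega> \<longrightarrow> u x = v x"
proof -
  have "(\<lambda>x. indicator \<Omega> x *\<^sub>R u x) \<in> borel_measurable lebesgue"
    using assms by (simp add: borel_measurable_restrict_space_iff)
  then obtain v where v: "v \<in> borel_measurable borel" "AE x in lebesgue. indicator \<Omega> x *\<^sub>R u x = v x"
    by (rule lebesgue_ex_borel_measurable)
  show thesis
  proof
    show "(\<lambda>x. indicator \<Omega> x *\<^sub>R v x) \<in> borel_measurable borel"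
      using v(1) \<Omega> by (intro borel_measurable_scaleR borel_measurable_indicator) auto
    show "AE x in lebesgue. x \<in> \<Omega> \<longrightarrow> u x = indicator \<Omega> x *\<^sub>R v x"
      using v(2) by eventually_elim auto
  qed auto
qed

lemma L2_sq_lborel:
  assumes "\<And>x. x \<notin> \<Omega> \<Longrightarrow> v x = 0"
  shows "L2_sq \<Omega> v = (\<integral>\<^sup>+x. ennreal ((norm (v x))\<^sup>2) \<partial>lborel)"
  unfolding L2_sq_def nn_integral_completion
  by (intro nn_integral_cong) (use assms in \<open>auto simp: indicator_def\<close>)

lemma borel_measurable_lebesgue_onI: "v \<in> borel_measurable borel \<Longrightarrow> v \<in> borel_measurable (lebesgue_on \<Omega>)"
  by (intro measurable_restrict_space1 measurable_completion) simp

lemma norm_le_1_plus_square: "norm (x::'a::real_normed_vector) \<le> 1 + (norm x)\<^sup>2"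
  using sum_squares_bound[of 1 "norm x", simplified] norm_ge_zero[of x] zero_le_power2[of "norm x"] by linarith

text \<open>On a set of finite measure the majorant 1 + |u|^2 is integrable and dominates
  |u|.\<close>

lemma L2_set_integrable:
  fixes u :: "'a::euclidean_space \<Rightarrow> 'k::{real_normed_field,euclidean_space}"
  assumes u: "u \<in> L2 \<Omega>" and A: "A \<in> lmeasurable" "A \<subseteq> \<Omega>" "\<Omega> \<in> sets lebesgue"
  shows "set_integrable lebesgue A u"
proof -
  have meas: "(\<lambda>x. indicator \<Omega> x *\<^sub>R u x) \<in> borel_measurable lebesgue"
    using u A(3) by (simp add: L2_def borel_measurable_restrict_space_iff)
  have "integrable lebesgue (\<lambda>x. indicator \<Omega> x *\<^sub>R (norm (u x))\<^sup>2)"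
    using u A(3) by (simp add: L2_def integrable_restrict_space)
  moreover have "integrable lebesgue (indicator A :: _ \<Rightarrow> real)"
    using A(1) by (simp add: integrable_indicator_iff fmeasurable_def del: emeasure_completion)
  ultimately have "integrable lebesgue (\<lambda>x. indicator A x + indicator \<Omega> x *\<^sub>R (norm (u x))\<^sup>2)"
    by (intro Bochner_Integration.integrable_add)
  then have "integrable lebesgue (\<lambda>x. indicator A x *\<^sub>R (indicator \<Omega> x *\<^sub>R u x))"
  proof (rule Bochner_Integration.integrable_bound)
    show "(\<lambda>x. indicator A x *\<^sub>R (indicator \<Omega> x *\<^sub>R u x)) \<in> borel_measurable lebesgue"
      by (rule borel_measurable_scaleR[OF borel_measurable_indicator[OF fmeasurableD[OF A(1)]] meas])
    show "AE x in lebesgue. norm (indicator A x *\<^sub>R (indicator \<Omega> x *\<^sub>R u x))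
        \<le> norm (indicator A x + indicator \<Omega> x *\<^sub>R (norm (u x))\<^sup>2)"
      using norm_le_1_plus_square[of "u _"] by (intro AE_I2) (auto simp: indicator_def)
  qed
  moreover have "(\<lambda>x. indicator A x *\<^sub>R (indicator \<Omega> x *\<^sub>R u x)) = (\<lambda>x. indicator A x *\<^sub>R u x)"
    using A(2) by (auto simp: indicator_def fun_eq_iff)
  ultimately show ?thesis
    by (simp add: set_integrable_def)
qed

lemma L2_locally_integrable:
  assumes "u \<in> L2 \<Omega>" "\<Omega> \<in> sets lebesgue"
  shows "locally_integrable \<Omega> u"
  using L2_set_integrable[OF assms(1) lmeasurable_compact _ assms(2)]
  by (auto simp: locally_integrable_def)

lemma set_integrable_cong_AE:
  fixes f :: "'a::euclidean_space \<Rightarrow> 'k::euclidean_space"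
  assumes "set_integrable lebesgue A f" "AE x in lebesgue. x \<in> A \<longrightarrow> f x = g x"
  shows "set_integrable lebesgue A g" "(LINT x:A|lebesgue. f x) = (LINT x:A|lebesgue. g x)"
proof -
  have f: "integrable lebesgue (\<lambda>x. indicator A x *\<^sub>R f x)"
    using assms(1) by (simp add: set_integrable_def)
  have eq: "AE x in lebesgue. indicator A x *\<^sub>R f x = indicator A x *\<^sub>R g x"
    using assms(2) by eventually_elim (auto simp: indicator_def)
  have g: "(\<lambda>x. indicator A x *\<^sub>R g x) \<in> borel_measurable lebesgue"
    using borel_measurable_AE[OF borel_measurable_integrable[OF f] eq] .
  show "set_integrable lebesgue A g"
    using integrable_cong_AE_imp[OF f g eq] by (simp add: set_integrable_def)
  show "(LINT x:A|lebesgue. f x) = (LINT x:A|lebesgue. g x)"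
    unfolding set_lebesgue_integral_def
    by (rule integral_cong_AE[OF borel_measurable_integrable[OF f] g eq])
qed

lemma locally_integrable_cong_AE:
  fixes f :: "'a::euclidean_space \<Rightarrow> 'k::{real_normed_field,euclidean_space}"
  assumes "locally_integrable \<Omega> f" "AE x in lebesgue. x \<in> \<Omega> \<longrightarrow> f x = g x"
  shows "locally_integrable \<Omega> g"
  unfolding locally_integrable_def
proof (intro allI impI)
  fix K assume K: "compact K \<and> K \<subseteq> \<Omega>"
  have "AE x in lebesgue. x \<in> K \<longrightarrow> f x = g x"
    using assms(2) by eventually_elim (use K in auto)
  then show "set_integrable lebesgue K g"
    using set_integrable_cong_AE(1)[of K f g] assms(1) K by (simp add: locally_integrable_def)
qed

lemma has_weak_deriv_cong_AE:
  fixes f :: "'a::euclidean_space \<Rightarrow> 'k::{real_normed_field,euclidean_space}"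
  assumes fg: "has_weak_deriv \<Omega> \<alpha> f g"
    and f': "AE x in lebesgue. x \<in> \<Omega> \<longrightarrow> f x = f' x" and g': "AE x in lebesgue. x \<in> \<Omega> \<longrightarrow> g x = g' x"
  shows "has_weak_deriv \<Omega> \<alpha> f' g'"
proof -
  have int: "locally_integrable \<Omega> f" "locally_integrable \<Omega> g"
    using fg by (auto simp: has_weak_deriv_def)
  have eq: "(LINT x:\<Omega>|lebesgue. \<phi> x *\<^sub>R h x) = (LINT x:\<Omega>|lebesgue. \<phi> x *\<^sub>R h' x)"
    if "\<phi> \<in> test_functions \<Omega>" "locally_integrable \<Omega> h" "AE x in lebesgue. x \<in> \<Omega> \<longrightarrow> h x = h' x"
    for \<phi> and h h' :: "'a \<Rightarrow> 'k"
    by (rule set_integrable_cong_AE(2)[OF test_function_integrable[OF that(1,2)]])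
      (use that(3) in \<open>eventually_elim, auto\<close>)
  show ?thesis
    unfolding has_weak_deriv_def
  proof (intro conjI ballI)
    show "locally_integrable \<Omega> f'" "locally_integrable \<Omega> g'"
      using locally_integrable_cong_AE int f' g' by blast+
    fix \<phi> assume \<phi>: "\<phi> \<in> test_functions \<Omega>"
    show "(LINT x:\<Omega>|lebesgue. multi_deriv \<alpha> \<phi> x *\<^sub>R f' x) =
        (-1) ^ mi_order \<alpha> * (LINT x:\<Omega>|lebesgue. \<phi> x *\<^sub>R g' x)"
      using fg \<phi> eq[OF test_functions_multi_deriv[OF \<phi>, of \<alpha>] int(1) f'] eq[OF \<phi> int(2) g']
      unfolding has_weak_deriv_def by metis
  qed
qed

lemma set_integral_lborel:
  fixes v :: "'a::euclidean_space \<Rightarrow> 'k::{real_normed_field,euclidean_space}"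
  assumes "v \<in> borel_measurable borel" "\<phi> \<in> borel_measurable borel" "\<And>x. x \<notin> \<Omega> \<Longrightarrow> v x = 0 \<or> \<phi> x = 0"
  shows "(LINT x:\<Omega>|lebesgue. \<phi> x *\<^sub>R v x) = (LINT x|lborel. \<phi> x *\<^sub>R v x)"
proof -
  have "(LINT x:\<Omega>|lebesgue. \<phi> x *\<^sub>R v x) = (LINT x|lebesgue. \<phi> x *\<^sub>R v x)"
    unfolding set_lebesgue_integral_def
    by (intro Bochner_Integration.integral_cong) (use assms(3) in \<open>auto simp: indicator_def\<close>)
  also have "\<dots> = (LINT x|lborel. \<phi> x *\<^sub>R v x)"
    using assms(1,2) by (intro integral_completion borel_measurable_scaleR) auto
  finally show ?thesis .
qed

text \<open>The identity for \<alpha> tested with \<open>partial b \<phi>\<close> and the identity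
  for the raised index tested with \<phi> have the same integral over \<open>u\<close>; cancelling
  the common sign of order \<alpha> leaves a first order derivative of \<open>v\<close>.\<close>

lemma has_weak_deriv_Suc:
  fixes u :: "'a::euclidean_space \<Rightarrow> 'k::{real_normed_field,euclidean_space}"
  assumes b: "b \<in> Basis" and "has_weak_deriv \<Omega> \<alpha> u v" "has_weak_deriv \<Omega> (\<alpha>(b := Suc (\<alpha> b))) u w"
  shows "has_weak_deriv \<Omega> ((\<lambda>_. 0)(b := Suc 0)) v w"
proof -
  have "(LINT x:\<Omega>|lebesgue. multi_deriv ((\<lambda>_. 0)(b := Suc 0)) \<phi> x *\<^sub>R v x) =
      (-1) ^ mi_order ((\<lambda>_. 0)(b := Suc 0)) * (LINT x:\<Omega>|lebesgue. \<phi> x *\<^sub>R w x)"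
    if \<phi>: "\<phi> \<in> test_functions \<Omega>" for \<phi>
  proof -
    note sm = test_functions_smooth[OF \<phi>]
    have ord: "mi_order ((\<lambda>_. 0)(b := Suc 0)) = Suc 0"
      using mi_order_Suc[OF b, of "\<lambda>_. 0"] by (simp add: mi_order_def)
    have md: "multi_deriv ((\<lambda>_. 0)(b := Suc 0)) \<phi> = partial b \<phi>"
      using multi_deriv_Suc[OF sm b, of "\<lambda>_. 0"] by (simp add: multi_deriv_zero)
    have "(-1) ^ mi_order \<alpha> * (LINT x:\<Omega>|lebesgue. partial b \<phi> x *\<^sub>R v x)
        = (LINT x:\<Omega>|lebesgue. multi_deriv \<alpha> (partial b \<phi>) x *\<^sub>R u x)"
      using assms(2) test_functions_partial[OF \<phi> b] by (simp add: has_weak_deriv_def)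
    also have "\<dots> = (-1) ^ mi_order (\<alpha>(b := Suc (\<alpha> b))) * (LINT x:\<Omega>|lebesgue. \<phi> x *\<^sub>R w x)"
      using assms(3) \<phi> by (simp add: has_weak_deriv_def flip: multi_deriv_Suc[OF sm b])
    also have "\<dots> = (-1) ^ mi_order \<alpha> * ((-1) * (LINT x:\<Omega>|lebesgue. \<phi> x *\<^sub>R w x))"
      by (simp add: mi_order_Suc[OF b])
    finally have "(LINT x:\<Omega>|lebesgue. partial b \<phi> x *\<^sub>R v x) = (-1) * (LINT x:\<Omega>|lebesgue. \<phi> x *\<^sub>R w x)"
      by (rule mult_left_cancel[THEN iffD1, rotated]) simp
    then show ?thesis
      unfolding md ord by simp
  qed
  then show ?thesis
    using assms(2,3) by (auto simp: has_weak_deriv_def)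
qed

subsection \<open>Translations of functions with weak derivatives\<close>

lemma nn_integral_translate:
  fixes f :: "'a::euclidean_space \<Rightarrow> ennreal"
  assumes "f \<in> borel_measurable borel"
  shows "(\<integral>\<^sup>+x. f (x + c) \<partial>lborel) = (\<integral>\<^sup>+x. f x \<partial>lborel)"
proof -
  have "(\<integral>\<^sup>+x. f x \<partial>lborel) = (\<integral>\<^sup>+x. f x \<partial>distr lborel borel ((+) c))"
    by (simp add: lborel_distr_plus)
  also have "\<dots> = (\<integral>\<^sup>+x. f (c + x) \<partial>lborel)"
    using assms by (intro nn_integral_distr) auto
  finally show ?thesis by (simp add: add.commute)
qed

lemma integral_translate:
  fixes f :: "'a::euclidean_space \<Rightarrow> 'k::{banach, second_countable_topology}"
  assumes "f \<in> borel_measurable borel"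
  shows "(LINT x|lborel. f (x + c)) = integral\<^sup>L lborel f"
proof -
  have "integral\<^sup>L lborel f = integral\<^sup>L (distr lborel borel ((+) c)) f"
    by (simp add: lborel_distr_plus)
  also have "\<dots> = (LINT x|lborel. f (c + x))"
    using assms by (intro integral_distr) auto
  finally show ?thesis by (simp add: add.commute)
qed

lemma integrable_translate:
  fixes f :: "'a::euclidean_space \<Rightarrow> 'k::{banach, second_countable_topology}"
  assumes "integrable lborel f"
  shows "integrable lborel (\<lambda>x. f (x + c))"
proof -
  have "integrable (distr lborel borel ((+) c)) f"
    using assms by (simp add: lborel_distr_plus)
  then have "integrable lborel (\<lambda>x. f (c + x))"
    using assms by (subst (asm) integrable_distr_eq) auto
  then show ?thesis by (simp add: add.commute)
qed

text \<open>By translation invariance the integral of the majorant over \<open>x\<close> is the same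
  for every \<open>t\<close> in the unit interval. This licenses the exchanges of the segment
  integral with the space integral.\<close>

lemma strip_integrable:
  fixes f :: "real \<times> 'a::euclidean_space \<Rightarrow> 'k::{banach, second_countable_topology}"
    and g :: "'a \<Rightarrow> 'k"
  assumes f: "f \<in> borel_measurable (lborel \<Otimes>\<^sub>M lborel)" and g: "integrable lborel g"
    and bound: "\<And>t x. norm (f (t, x)) \<le> indicator {0..1} t * (B * norm (g (x + t *\<^sub>R w)))"
  shows "integrable (lborel \<Otimes>\<^sub>M lborel) f"
proof -
  have [measurable]: "g \<in> borel_measurable borel"
    using g by auto
  let ?F = "\<lambda>(t, x). indicator {0..1} t * (B * norm (g (x + t *\<^sub>R w))) :: real"
  have "integrable (lborel \<Otimes>\<^sub>M lborel) ?F"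
  proof (rule lborel_pair.Fubini_integrable)
    show "?F \<in> borel_measurable (lborel \<Otimes>\<^sub>M lborel)"
      by measurable
    have "(LINT x|lborel. norm (?F (t, x))) = indicator {0..1} t * (\<bar>B\<bar> * (LINT x|lborel. norm (g x)))" for t
      using integral_translate[of "\<lambda>x. norm (g x)" "t *\<^sub>R w"] by (simp add: abs_mult)
    then show "integrable lborel (\<lambda>t. LINT x|lborel. norm (?F (t, x)))"
      by simp
    show "AE t in lborel. integrable lborel (\<lambda>x. ?F (t, x))"
      using integrable_translate[OF g] by (intro AE_I2) simp
  qed
  then show ?thesis
    by (rule Bochner_Integration.integrable_bound)
      (use f bound in \<open>auto intro!: AE_I2 order.trans[OF bound]\<close>)
qed

text \<open>The intersection of the translates of \<open>\<Omega>\<close> by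
  \<open>- t *\<^sub>R w\<close>: a test function supported in it may be moved by any such
  \<open>t *\<^sub>R w\<close> and is still a test function on \<open>\<Omega>\<close>.\<close>

definition segment_kernel :: "'a::euclidean_space set \<Rightarrow> 'a \<Rightarrow> 'a set" where
  "segment_kernel \<Omega> w = {x. \<forall>t\<in>{0..1}. x + t *\<^sub>R w \<in> \<Omega>}"

text \<open>The segment is compact, so it has a neighbourhood of uniform width inside
  \<open>\<Omega>\<close>.\<close>

lemma open_segment_kernel:
  assumes "open \<Omega>"
  shows "open (segment_kernel \<Omega> w)"
  unfolding open_contains_ball
proof
  fix x assume x: "x \<in> segment_kernel \<Omega> w"
  have "compact ((\<lambda>t. x + t *\<^sub>R w) ` {0..1})"
    by (intro compact_continuous_image continuous_intros compact_Icc)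
  moreover have "(\<lambda>t. x + t *\<^sub>R w) ` {0..1} \<subseteq> \<Omega>"
    using x by (auto simp: segment_kernel_def)
  ultimately obtain e where e: "e > 0" "(\<Union>y\<in>(\<lambda>t. x + t *\<^sub>R w) ` {0..1}. ball y e) \<subseteq> \<Omega>"
    by (rule compact_subset_open_imp_ball_epsilon_subset[OF _ assms])
  have "ball x e \<subseteq> segment_kernel \<Omega> w"
  proof
    fix y assume "y \<in> ball x e"
    then have "y + t *\<^sub>R w \<in> ball (x + t *\<^sub>R w) e" for t
      by (simp add: dist_norm)
    then show "y \<in> segment_kernel \<Omega> w"
      using e(2) by (fastforce simp: segment_kernel_def)
  qed
  with e(1) show "\<exists>e>0. ball x e \<subseteq> segment_kernel \<Omega> w"
    by blast
qed

lemma partial_eq_sum_Basis: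
  assumes "smooth \<phi>"
  shows "partial w \<phi> x = (\<Sum>b\<in>Basis. (w \<bullet> b) * partial b \<phi> x)"
proof -
  interpret linear "frechet_derivative \<phi> (at x)"
    using linear_frechet_derivative smooth_differentiable[OF assms] by blast
  have "partial w \<phi> x = partial (\<Sum>b\<in>Basis. (w \<bullet> b) *\<^sub>R b) \<phi> x"
    by (simp add: euclidean_representation)
  then show ?thesis
    by (simp add: sum scaleR)
qed

text \<open>The functions are integrable on the whole space and vanish off \<open>\<Omega>\<close>,
  so integrals of translates are ordinary \<open>lborel\<close> integrals. The zero extensions need
  not be weakly differentiable across the boundary; the derivative is required only on
  \<open>\<Omega>\<close>.\<close>

locale weak_gradient =
  fixes \<Omega> :: "'a::euclidean_space set" and u :: "'a \<Rightarrow> 'k::{real_normed_field,euclidean_space}"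
    and G :: "'a \<Rightarrow> 'a \<Rightarrow> 'k"
  assumes \<Omega>: "open \<Omega>"
    and u: "integrable lborel u" "\<And>x. x \<notin> \<Omega> \<Longrightarrow> u x = 0"
    and G: "\<And>b. b \<in> Basis \<Longrightarrow> integrable lborel (G b)" "\<And>b x. b \<in> Basis \<Longrightarrow> x \<notin> \<Omega> \<Longrightarrow> G b x = 0"
    and deriv: "\<And>b. b \<in> Basis \<Longrightarrow> has_weak_deriv \<Omega> ((\<lambda>_. 0)(b := Suc 0)) u (G b)"
begin

definition dir :: "'a \<Rightarrow> 'a \<Rightarrow> 'k" where
  "dir w x = (\<Sum>b\<in>Basis. (w \<bullet> b) *\<^sub>R G b x)"

lemma dir_integrable: "integrable lborel (dir w)"
  unfolding dir_def using G(1) by (intro Bochner_Integration.integrable_sum integrable_scaleR_right) auto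

lemma [measurable]: "u \<in> borel_measurable borel" "dir w \<in> borel_measurable borel"
  using u(1) dir_integrable by (auto dest: borel_measurable_integrable)

lemma test_times_integrable:
  fixes f :: "'a \<Rightarrow> 'k"
  assumes \<phi>: "\<phi> \<in> test_functions A" and f: "integrable lborel f"
  shows "integrable lborel (\<lambda>x. \<phi> x *\<^sub>R f x)"
proof -
  obtain B where B: "B \<ge> 0" "\<And>x. \<bar>\<phi> x\<bar> \<le> B"
    using test_functions_bounded[OF \<phi>] by blast
  show ?thesis
  proof (rule Bochner_Integration.integrable_bound)
    show "integrable lborel (\<lambda>x. B *\<^sub>R f x)"
      using f by (intro integrable_scaleR_right)
    show "(\<lambda>x. \<phi> x *\<^sub>R f x) \<in> borel_measurable lborel"
      using test_functions_measurable[OF \<phi>] f by (intro borel_measurable_scaleR) auto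
    show "AE x in lborel. norm (\<phi> x *\<^sub>R f x) \<le> norm (B *\<^sub>R f x)"
      unfolding norm_scaleR using B by (intro AE_I2 mult_right_mono) auto
  qed
qed

text \<open>Both sides are linear in the direction, so integration by parts passes from the basis
  vectors to arbitrary \<open>w\<close>.\<close>

lemma integral_partial:
  assumes \<phi>: "\<phi> \<in> test_functions \<Omega>"
  shows "(LINT x|lborel. partial w \<phi> x *\<^sub>R u x) = - (LINT x|lborel. \<phi> x *\<^sub>R dir w x)"
proof -
  note sm = test_functions_smooth[OF \<phi>]
  have 1: "(LINT x|lborel. partial b \<phi> x *\<^sub>R u x) = - (LINT x|lborel. \<phi> x *\<^sub>R G b x)"
    if b: "b \<in> Basis" for b
  proof -
    have ord: "mi_order ((\<lambda>_. 0)(b := Suc 0)) = Suc 0"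
      using mi_order_Suc[OF b, of "\<lambda>_. 0"] by (simp add: mi_order_def)
    have md: "multi_deriv ((\<lambda>_. 0)(b := Suc 0)) \<phi> = partial b \<phi>"
      using multi_deriv_Suc[OF sm b, of "\<lambda>_. 0"] by (simp add: multi_deriv_zero)
    have "(LINT x:\<Omega>|lebesgue. multi_deriv ((\<lambda>_. 0)(b := Suc 0)) \<phi> x *\<^sub>R u x)
        = (-1) ^ mi_order ((\<lambda>_. 0)(b := Suc 0)) * (LINT x:\<Omega>|lebesgue. \<phi> x *\<^sub>R G b x)"
      using deriv[OF b] \<phi> by (auto simp: has_weak_deriv_def)
    then have "(LINT x:\<Omega>|lebesgue. partial b \<phi> x *\<^sub>R u x) = - (LINT x:\<Omega>|lebesgue. \<phi> x *\<^sub>R G b x)"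
      unfolding md ord by simp
    then show ?thesis
      using test_functions_measurable[OF \<phi>] test_functions_measurable[OF test_functions_partial[OF \<phi> b]]
        u(2) G(2)[OF b] borel_measurable_integrable[OF G(1)[OF b]]
      by (subst (asm) (1 2) set_integral_lborel) auto
  qed
  have "(LINT x|lborel. partial w \<phi> x *\<^sub>R u x) = (LINT x|lborel. (\<Sum>b\<in>Basis. (w \<bullet> b) *\<^sub>R partial b \<phi> x *\<^sub>R u x))"
    unfolding partial_eq_sum_Basis[OF sm, where w = w] by (simp add: scaleR_sum_left)
  also have "\<dots> = (\<Sum>b\<in>Basis. (w \<bullet> b) *\<^sub>R (LINT x|lborel. partial b \<phi> x *\<^sub>R u x))"
    using test_times_integrable[OF test_functions_partial[OF \<phi>] u(1)]
    by (subst Bochner_Integration.integral_sum) (auto simp del: scaleR_scaleR)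
  also have "\<dots> = - (\<Sum>b\<in>Basis. (w \<bullet> b) *\<^sub>R (LINT x|lborel. \<phi> x *\<^sub>R G b x))"
    by (simp add: 1 sum_negf)
  also have "\<dots> = - (LINT x|lborel. (\<Sum>b\<in>Basis. (w \<bullet> b) *\<^sub>R \<phi> x *\<^sub>R G b x))"
    using test_times_integrable[OF \<phi> G(1)]
    by (subst Bochner_Integration.integral_sum) (auto simp del: scaleR_scaleR)
  also have "\<dots> = - (LINT x|lborel. \<phi> x *\<^sub>R dir w x)"
    by (simp add: dir_def scaleR_sum_right mult.commute)
  finally show ?thesis .
qed

text \<open>
  The weak form of the formula for smooth functions: the increment is moved to the test
  function, whose translates along the segment are still supported in \<open>\<Omega>\<close>.
\<close>

lemma translation_formula:
  "AE x in lborel. x \<in> segment_kernel \<Omega> w \<longrightarrow>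
    u (x + w) - u x = (LINT t|lborel. indicator {0..1} t *\<^sub>R dir w (x + t *\<^sub>R w))"
proof -
  let ?A = "segment_kernel \<Omega> w"
  let ?I = "\<lambda>x. LINT t|lborel. indicator {0..1} t *\<^sub>R dir w (x + t *\<^sub>R w)"
  define h where "h x = u (x + w) - u x - ?I x" for x
  have strip: "integrable (lborel \<Otimes>\<^sub>M lborel) (\<lambda>(t, x). indicator {0..1} t *\<^sub>R dir w (x + t *\<^sub>R w))"
    by (rule strip_integrable[of _ "dir w" 1 w]) (auto simp: dir_integrable)
  have intI: "integrable lborel ?I"
    using lborel_pair.integrable_snd[OF strip] by simp
  have int_uw: "integrable lborel (\<lambda>x. u (x + w))"
    by (rule integrable_translate[OF u(1)])
  have h: "integrable lborel h"
    unfolding h_def using u(1) int_uw intI by (intro Bochner_Integration.integrable_diff)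
  have "AE x in lebesgue. x \<in> ?A \<longrightarrow> h x = 0"
  proof (rule locally_integrable_AE_zero[OF open_segment_kernel[OF \<Omega>]])
    have "integrable lebesgue h"
      using h by (simp add: integrable_completion)
    then show "locally_integrable ?A h"
      unfolding locally_integrable_def set_integrable_def
      by (auto intro!: integrable_mult_indicator dest: compact_imp_closed)
    fix \<psi> assume \<psi>: "\<psi> \<in> test_functions ?A"
    note sm = test_functions_smooth[OF \<psi>] and [measurable] = test_functions_measurable[OF \<psi>]
    have \<psi>_shift: "(\<lambda>x. \<psi> (x - t *\<^sub>R w)) \<in> test_functions \<Omega>" if "t \<in> {0..1}" for t
      using that by (intro test_functions_translate[OF \<psi>]) (auto simp: segment_kernel_def)
    obtain K where K: "compact K" "K \<subseteq> ?A" "\<And>x. x \<notin> K \<Longrightarrow> \<psi> x = 0"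
      using test_functions_support[OF \<psi>] by blast
    obtain B where B: "B \<ge> 0" "\<And>x. \<bar>\<psi> x\<bar> \<le> B"
      using test_functions_bounded[OF \<psi>] by blast
    have dw: "partial (- w) \<psi> x = - partial w \<psi> x" for x
      unfolding partial_eq_sum_Basis[OF sm, where w = w] partial_eq_sum_Basis[OF sm, where w = "- w"] by (simp add: sum_negf)
    have cont_dw: "continuous_on S (partial w \<psi>)" for S
      unfolding partial_eq_sum_Basis[OF sm, where w = w]
      by (intro continuous_intros smooth_continuous smooth_partial sm)
    then have [measurable]: "partial w \<psi> \<in> borel_measurable borel"
      by (intro borel_measurable_continuous_onI)
    \<comment> \<open>As \<open>w\<close> need not be a basis vector,
      \<open>partial w \<psi>\<close> is bounded by continuity on the support and by vanishing
      elsewhere.\<close>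
    obtain B' where B': "\<And>x. \<bar>partial w \<psi> x\<bar> \<le> B'"
    proof -
      have "bounded (partial w \<psi> ` K)"
        using K(1) cont_dw by (intro compact_imp_bounded compact_continuous_image)
      then obtain C where "\<And>x. x \<in> K \<Longrightarrow> \<bar>partial w \<psi> x\<bar> \<le> C"
        unfolding bounded_iff by auto
      then have "\<bar>partial w \<psi> x\<bar> \<le> max C 0" for x
        using partial_eq_zero_outside[OF K(1,3), where v = w and x = x] by (cases "x \<in> K") (auto simp: le_max_iff_disj)
      then show thesis by (rule that)
    qed
    \<comment> \<open>Shifting the argument of \<open>u\<close> by \<open>w\<close> shifts that of
      the test function by \<open>- w\<close>, so the fundamental theorem of calculus is used along
      the reversed segment.\<close>
    have ftc: "\<psi> (x - w) - \<psi> x = - (LINT t|lborel. indicator {0..1} t *\<^sub>R partial w \<psi> (x - t *\<^sub>R w))"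
      "integrable lborel (\<lambda>t. indicator {0..1} t *\<^sub>R partial w \<psi> (x - t *\<^sub>R w))" for x
    proof -
      have "has_bochner_integral lborel (\<lambda>t. indicator {0..1} t *\<^sub>R partial (- w) \<psi> (x + t *\<^sub>R (- w)))
          (\<psi> (x + 1 *\<^sub>R (- w)) - \<psi> (x + 0 *\<^sub>R (- w)))"
      proof (rule has_bochner_integral_FTC_Icc)
        show "((\<lambda>t. \<psi> (x + t *\<^sub>R (- w))) has_vector_derivative partial (- w) \<psi> (x + t *\<^sub>R (- w)))
            (at t within {0..1})" for t
          using smooth_has_field_derivative_line[OF sm, of x "- w" t]
          by (simp add: has_real_derivative_iff_has_vector_derivative has_vector_derivative_at_within)
        show "continuous_on {0..1} (\<lambda>t. partial (- w) \<psi> (x + t *\<^sub>R (- w)))"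
          unfolding dw
          by (intro continuous_intros continuous_on_compose2[OF cont_dw[of UNIV]]) auto
      qed auto
      then show "\<psi> (x - w) - \<psi> x = - (LINT t|lborel. indicator {0..1} t *\<^sub>R partial w \<psi> (x - t *\<^sub>R w))"
        "integrable lborel (\<lambda>t. indicator {0..1} t *\<^sub>R partial w \<psi> (x - t *\<^sub>R w))"
        by (simp_all add: dw has_bochner_integral_iff)
    qed
    have "(LINT x|lborel. \<psi> x *\<^sub>R u (x + w)) = (LINT x|lborel. \<psi> (x - w) *\<^sub>R u x)"
      using integral_translate[of "\<lambda>x. \<psi> (x - w) *\<^sub>R u x" w] by simp
    then have "(LINT x|lborel. \<psi> x *\<^sub>R u (x + w)) - (LINT x|lborel. \<psi> x *\<^sub>R u x)
        = (LINT x|lborel. (\<psi> (x - w) - \<psi> x) *\<^sub>R u x)"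
      using test_times_integrable[OF \<psi>_shift[of 1] u(1)] test_times_integrable[OF \<psi> u(1)]
      by (simp add: scaleR_diff_left)
    also have "\<dots> = - (LINT x|lborel. LINT t|lborel. (indicator {0..1} t * partial w \<psi> (x - t *\<^sub>R w)) *\<^sub>R u x)"
      using ftc by (simp add: integral_scaleR_left)
    also have "(LINT x|lborel. LINT t|lborel. (indicator {0..1} t * partial w \<psi> (x - t *\<^sub>R w)) *\<^sub>R u x)
        = (LINT t|lborel. LINT x|lborel. (indicator {0..1} t * partial w \<psi> (x - t *\<^sub>R w)) *\<^sub>R u x)"
    proof (rule lborel_pair.Fubini_integral, rule strip_integrable[OF _ u(1)])
      show "norm (case (t, x) of (t, x) \<Rightarrow> (indicator {0..1} t * partial w \<psi> (x - t *\<^sub>R w)) *\<^sub>R u x)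
          \<le> indicator {0..1} t * (B' * norm (u (x + t *\<^sub>R 0)))" for t x
        using B' by (auto simp: indicator_def intro: mult_right_mono)
    qed measurable
    also have "\<dots> = (LINT t|lborel. indicator {0..1} t *\<^sub>R (LINT x|lborel. partial w \<psi> (x - t *\<^sub>R w) *\<^sub>R u x))"
      by (simp flip: scaleR_scaleR)
    \<comment> \<open>Integration by parts for fixed \<open>t\<close>. The shifted test function is
      supported in \<open>\<Omega>\<close> only for \<open>t\<close> in the unit interval; for the
      other \<open>t\<close> the indicator is zero.\<close>
    also have "\<dots> = (LINT t|lborel. indicator {0..1} t *\<^sub>R - (LINT x|lborel. \<psi> x *\<^sub>R dir w (x + t *\<^sub>R w)))"
    proof (intro Bochner_Integration.integral_cong refl)
      fix t
      have "(LINT x|lborel. partial w \<psi> (x - t *\<^sub>R w) *\<^sub>R u x) = - (LINT x|lborel. \<psi> (x - t *\<^sub>R w) *\<^sub>R dir w x)"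
        if "t \<in> {0..1}"
        using integral_partial[OF \<psi>_shift[OF that], of w] by (simp add: fun_cong[OF smooth_translate(2)[OF sm]])
      moreover have "(LINT x|lborel. \<psi> (x - t *\<^sub>R w) *\<^sub>R dir w x) = (LINT x|lborel. \<psi> x *\<^sub>R dir w (x + t *\<^sub>R w))"
        using integral_translate[of "\<lambda>x. \<psi> (x - t *\<^sub>R w) *\<^sub>R dir w x" "t *\<^sub>R w"] by simp
      ultimately show "indicator {0..1} t *\<^sub>R (LINT x|lborel. partial w \<psi> (x - t *\<^sub>R w) *\<^sub>R u x)
          = indicator {0..1} t *\<^sub>R - (LINT x|lborel. \<psi> x *\<^sub>R dir w (x + t *\<^sub>R w))"
        by (auto simp: indicator_def)
    qed
    also have "\<dots> = - (LINT t|lborel. LINT x|lborel. (indicator {0..1} t * \<psi> x) *\<^sub>R dir w (x + t *\<^sub>R w))"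
      by (simp flip: scaleR_scaleR)
    also have "(LINT t|lborel. LINT x|lborel. (indicator {0..1} t * \<psi> x) *\<^sub>R dir w (x + t *\<^sub>R w))
        = (LINT x|lborel. LINT t|lborel. (indicator {0..1} t * \<psi> x) *\<^sub>R dir w (x + t *\<^sub>R w))"
    proof (rule lborel_pair.Fubini_integral[symmetric], rule strip_integrable[OF _ dir_integrable])
      show "norm (case (t, x) of (t, x) \<Rightarrow> (indicator {0..1} t * \<psi> x) *\<^sub>R dir w (x + t *\<^sub>R w))
          \<le> indicator {0..1} t * (B * norm (dir w (x + t *\<^sub>R w)))" for t x
        using B by (auto simp: indicator_def intro: mult_right_mono)
    qed measurable
    also have "\<dots> = (LINT x|lborel. \<psi> x *\<^sub>R ?I x)"
      by (simp add: mult.commute[of "indicator _ _"] flip: scaleR_scaleR)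
    finally have "(LINT x|lborel. \<psi> x *\<^sub>R u (x + w)) - (LINT x|lborel. \<psi> x *\<^sub>R u x)
        = (LINT x|lborel. \<psi> x *\<^sub>R ?I x)" by simp
    then have "(LINT x|lborel. \<psi> x *\<^sub>R h x) = 0"
      using test_times_integrable[OF \<psi> int_uw] test_times_integrable[OF \<psi> u(1)]
        test_times_integrable[OF \<psi> intI]
      by (simp add: h_def scaleR_diff_right)
    moreover have "(LINT x:?A|lebesgue. \<psi> x *\<^sub>R h x) = (LINT x|lborel. \<psi> x *\<^sub>R h x)"
      using h K by (intro set_integral_lborel) auto
    ultimately show "(LINT x:?A|lebesgue. \<psi> x *\<^sub>R h x) = 0" by simp
  qed
  then have "AE x in lborel. x \<in> ?A \<longrightarrow> h x = 0"
    by (simp add: AE_completion_iff)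
  then show ?thesis
    by eventually_elim (simp add: h_def)
qed

text \<open>The squared L2 norm of the gradient (the Dirichlet energy, without a factor
  1/2).\<close>

definition energy :: ennreal where
  "energy = (\<Sum>b\<in>Basis. \<integral>\<^sup>+x. ennreal ((norm (G b x))\<^sup>2) \<partial>lborel)"

lemma nn_integral_dir: "(\<integral>\<^sup>+x. ennreal ((norm (dir w x))\<^sup>2) \<partial>lborel) \<le> ennreal ((norm w)\<^sup>2) * energy"
proof -
  have "(norm (dir w x))\<^sup>2 \<le> (norm w)\<^sup>2 * (\<Sum>b\<in>Basis. (norm (G b x))\<^sup>2)" for x
  proof -
    have "norm (dir w x) \<le> (\<Sum>b\<in>Basis. \<bar>w \<bullet> b\<bar> * norm (G b x))"
      unfolding dir_def by (rule order.trans[OF norm_sum]) simp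
    then have "(norm (dir w x))\<^sup>2 \<le> (\<Sum>b\<in>Basis. \<bar>w \<bullet> b\<bar> * norm (G b x))\<^sup>2"
      by (intro power_mono) auto
    also have "\<dots> \<le> (\<Sum>b\<in>Basis. \<bar>w \<bullet> b\<bar>\<^sup>2) * (\<Sum>b\<in>Basis. (norm (G b x))\<^sup>2)"
      by (rule Cauchy_Schwarz_ineq_sum)
    also have "(\<Sum>b\<in>Basis. \<bar>w \<bullet> b\<bar>\<^sup>2) = (norm w)\<^sup>2"
      unfolding power2_norm_eq_inner euclidean_inner[of w w] by (simp add: power2_eq_square)
    finally show ?thesis .
  qed
  then have "(\<integral>\<^sup>+x. ennreal ((norm (dir w x))\<^sup>2) \<partial>lborel)
      \<le> (\<integral>\<^sup>+x. ennreal ((norm w)\<^sup>2) * (\<Sum>b\<in>Basis. ennreal ((norm (G b x))\<^sup>2)) \<partial>lborel)"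
    by (intro nn_integral_mono) (simp add: sum_ennreal sum_nonneg flip: ennreal_mult)
  also have "\<dots> = ennreal ((norm w)\<^sup>2) * energy"
    unfolding energy_def using borel_measurable_integrable[OF G(1)]
    by (subst nn_integral_cmult, simp, subst nn_integral_sum) simp_all
  finally show ?thesis .
qed

text \<open>The squared integral along the segment is at most the integral of the squares, and after
  exchanging the integrals translation invariance makes the space integral independent of the
  position on the segment.\<close>

lemma translation_estimate:
  "(\<integral>\<^sup>+x\<in>segment_kernel \<Omega> w. ennreal ((norm (u (x + w) - u x))\<^sup>2) \<partial>lborel) \<le> ennreal ((norm w)\<^sup>2) * energy"
proof -
  let ?A = "segment_kernel \<Omega> w"
  let ?f = "\<lambda>t x. ennreal (indicator {0..1} t * norm (dir w (x + t *\<^sub>R w)))"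
  have pointwise: "ennreal ((norm (u (x + w) - u x))\<^sup>2) \<le> (\<integral>\<^sup>+t. (?f t x)\<^sup>2 \<partial>lborel)"
    if "u (x + w) - u x = (LINT t|lborel. indicator {0..1} t *\<^sub>R dir w (x + t *\<^sub>R w))" for x
  proof -
    have "ennreal (norm (u (x + w) - u x)) \<le> (\<integral>\<^sup>+t. ?f t x \<partial>lborel)"
    \<comment> \<open>Where the segment integral is not absolutely convergent it has the default
      value 0, and so does the increment.\<close>
    proof (cases "integrable lborel (\<lambda>t. indicator {0..1} t *\<^sub>R dir w (x + t *\<^sub>R w))")
      case True
      from integral_norm_bound_ennreal[OF this] show ?thesis
        unfolding that by simp
    qed (simp add: that not_integrable_integral_eq)
    then have "(ennreal (norm (u (x + w) - u x)))\<^sup>2 \<le> (\<integral>\<^sup>+t. ?f t x \<partial>lborel)\<^sup>2"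
      by (intro power_mono) auto
    \<comment> \<open>The extra indicator is the second factor for Cauchy--Schwarz; its square
      integrates to 1, the length of the parameter interval.\<close>
    also have "(\<integral>\<^sup>+t. ?f t x \<partial>lborel) = (\<integral>\<^sup>+t. indicator {0..1} t * ?f t x \<partial>lborel)"
      by (intro nn_integral_cong) (auto simp: indicator_def)
    also have "\<dots>\<^sup>2 \<le> (\<integral>\<^sup>+t. (indicator {0..1::real} t)\<^sup>2 \<partial>lborel) * (\<integral>\<^sup>+t. (?f t x)\<^sup>2 \<partial>lborel)"
      by (intro Cauchy_Schwarz_nn_integral) measurable
    also have "(\<lambda>t. (indicator {0..1::real} t :: ennreal)\<^sup>2) = indicator {0..1}"
      by (auto simp: fun_eq_iff indicator_def)
    finally show ?thesis by (simp add: ennreal_power)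
  qed
  have "(\<integral>\<^sup>+x\<in>?A. ennreal ((norm (u (x + w) - u x))\<^sup>2) \<partial>lborel) \<le> (\<integral>\<^sup>+x. \<integral>\<^sup>+t. (?f t x)\<^sup>2 \<partial>lborel \<partial>lborel)"
  proof (rule nn_integral_mono_AE)
    show "AE x in lborel. ennreal ((norm (u (x + w) - u x))\<^sup>2) * indicator ?A x
        \<le> (\<integral>\<^sup>+t. (?f t x)\<^sup>2 \<partial>lborel)"
      using translation_formula[of w] by eventually_elim (use pointwise in \<open>auto simp: indicator_def\<close>)
  qed
  also have "\<dots> = (\<integral>\<^sup>+t. \<integral>\<^sup>+x. (?f t x)\<^sup>2 \<partial>lborel \<partial>lborel)"
    by (rule lborel_pair.Fubini') measurable
  also have "\<dots> = (\<integral>\<^sup>+t. indicator {0..1::real} t * (\<integral>\<^sup>+x. ennreal ((norm (dir w x))\<^sup>2) \<partial>lborel) \<partial>lborel)"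
  proof (intro nn_integral_cong)
    fix t
    show "(\<integral>\<^sup>+x. (?f t x)\<^sup>2 \<partial>lborel) = indicator {0..1::real} t * (\<integral>\<^sup>+x. ennreal ((norm (dir w x))\<^sup>2) \<partial>lborel)"
      using nn_integral_translate[of "\<lambda>x. ennreal ((norm (dir w x))\<^sup>2)" "t *\<^sub>R w"]
      by (cases "t \<in> {0..1}") (simp_all add: ennreal_power)
  qed
  also have "\<dots> = (\<integral>\<^sup>+x. ennreal ((norm (dir w x))\<^sup>2) \<partial>lborel)"
    by (subst nn_integral_multc) auto
  also have "\<dots> \<le> ennreal ((norm w)\<^sup>2) * energy"
    by (rule nn_integral_dir)
  finally show ?thesis .
qed

end

subsection \<open>The embedding of the first order Sobolev space on a Lipschitz domain\<close>

text \<open>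
  The points \<open>x\<close> and \<open>x + z\<close> are joined inside the domain by three segments, each of length
  comparable to \<open>norm z\<close>: both are lifted by \<open>norm z *\<^sub>R w\<close>, where \<open>w\<close> points into the domain
  steeply enough for the segment between the lifted points to stay above the boundary graph.
\<close>

definition chain :: "'a::euclidean_space set \<Rightarrow> 'a \<Rightarrow> 'a \<Rightarrow> 'a \<Rightarrow> bool" where
  "chain \<Omega> w x z \<longleftrightarrow> x \<in> segment_kernel \<Omega> (norm z *\<^sub>R w) \<and>
    x + norm z *\<^sub>R w \<in> segment_kernel \<Omega> z \<and> x + z \<in> segment_kernel \<Omega> (norm z *\<^sub>R w)"

lemma norm_projection_le:
  fixes v e :: "'a::real_inner"
  assumes "norm e = 1"
  shows "norm (v - (v \<bullet> e) *\<^sub>R e) \<le> norm v"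
proof -
  define c where "c = v \<bullet> e"
  have e: "e \<bullet> e = 1" using assms by (simp add: norm_eq_1)
  have "(norm (v - c *\<^sub>R e))\<^sup>2 = v \<bullet> v - c * (e \<bullet> v) - c * (v \<bullet> e - c * (e \<bullet> e))"
    unfolding power2_norm_eq_inner by (simp only: inner_diff_left inner_diff_right inner_scaleR_left inner_scaleR_right)
  also have "\<dots> = (norm v)\<^sup>2 - c\<^sup>2"
    unfolding e inner_commute[of e v] c_def[symmetric] power2_norm_eq_inner
    by (simp add: power2_eq_square)
  finally have "(norm (v - c *\<^sub>R e))\<^sup>2 \<le> (norm v)\<^sup>2" by simp
  then show ?thesis
    unfolding c_def by (rule power2_le_imp_le) simp
qed

text \<open>Seen from the graph, lifting raises a point by \<open>t * (norm z * M)\<close>, while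
  moving by \<open>s *\<^sub>R z\<close> lowers it by at most \<open>s * norm z\<close> and raises
  the graph below it by at most \<open>L * (s * norm z)\<close>. A slope \<open>M = L + 1\<close>
  compensates both.\<close>

lemma chain_frontier:
  fixes \<Omega> :: "'a::euclidean_space set"
  assumes "lipschitz_boundary \<Omega>" "x0 \<in> frontier \<Omega>"
  obtains \<rho> w where "\<rho> > 0"
    "\<And>x y. x \<in> \<Omega> \<Longrightarrow> y \<in> \<Omega> \<Longrightarrow> x \<in> ball x0 \<rho> \<Longrightarrow> y \<in> ball x0 \<rho> \<Longrightarrow> chain \<Omega> w x (y - x)"
proof -
  obtain r e \<gamma> L where r: "r > 0" and e: "norm e = 1" and lip: "L-lipschitz_on {v. v \<bullet> e = 0} \<gamma>"
    and \<Omega>: "\<Omega> \<inter> ball x0 r = {x \<in> ball x0 r. \<gamma> (x - (x \<bullet> e) *\<^sub>R e) < x \<bullet> e}"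
    using assms(1)[unfolded lipschitz_boundary_def, rule_format, OF assms(2)] by blast
  have L: "L \<ge> 0" using lip by (rule lipschitz_on_nonneg)
  have ee: "e \<bullet> e = 1" using e by (simp add: norm_eq_1)
  define M where "M = L + 1"
  \<comment> \<open>A point within \<rho> of \<open>x0\<close> is moved by at most (M + 1) 2\<rho>,
    so it stays within (2M + 3)\<rho> < r of \<open>x0\<close>, where the graph describes
    \<open>\<Omega>\<close>.\<close>
  define \<rho> where "\<rho> = r / (2 * M + 4)"
  have \<rho>: "\<rho> > 0" "(2 * M + 4) * \<rho> = r"
    using r L by (auto simp: \<rho>_def M_def field_simps)
  let ?P = "\<lambda>v. v - (v \<bullet> e) *\<^sub>R e"
  \<comment> \<open>One claim for all three segments: \<open>s = 0\<close> is the lift of either end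
    point, \<open>t = 1\<close> the move by \<open>z\<close> at full height.\<close>
  have inside: "x + t *\<^sub>R norm z *\<^sub>R M *\<^sub>R e + s *\<^sub>R z \<in> \<Omega>"
    if x: "x \<in> \<Omega>" "x \<in> ball x0 \<rho>" and z: "norm z < 2 * \<rho>" and t: "t \<in> {0..1}" and s: "s \<in> {0..1}"
      and st: "s = 0 \<or> t = 1" for x z s t
  proof -
    let ?q = "x + t *\<^sub>R norm z *\<^sub>R M *\<^sub>R e + s *\<^sub>R z"
    have "norm (t *\<^sub>R norm z *\<^sub>R M *\<^sub>R e + s *\<^sub>R z) \<le> norm (t *\<^sub>R norm z *\<^sub>R M *\<^sub>R e) + norm (s *\<^sub>R z)"
      by (rule norm_triangle_ineq)
    also have "\<dots> = t * (norm z * M) + s * norm z"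
      using t s L e by (simp add: M_def abs_mult)
    also have "\<dots> \<le> 1 * (norm z * M) + 1 * norm z"
      using t s L by (intro add_mono mult_right_mono) (auto simp: M_def)
    also have "\<dots> = (M + 1) * norm z"
      by (simp add: algebra_simps)
    also have "\<dots> \<le> (M + 1) * (2 * \<rho>)"
      using z L by (intro mult_left_mono) (auto simp: M_def)
    finally have n: "norm (t *\<^sub>R norm z *\<^sub>R M *\<^sub>R e + s *\<^sub>R z) \<le> (M + 1) * (2 * \<rho>)" .
    have "dist x0 ?q \<le> dist x0 x + dist x ?q"
      by (rule dist_triangle)
    also have "dist x ?q = norm (t *\<^sub>R norm z *\<^sub>R M *\<^sub>R e + s *\<^sub>R z)"
      by (simp only: dist_norm norm_minus_commute[of x] add.assoc add_diff_cancel_left')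
    finally have "dist x0 ?q < \<rho> + (M + 1) * (2 * \<rho>)"
      using n x(2) by simp
    also have "\<dots> < r"
      using \<rho> by (simp add: algebra_simps)
    finally have q: "?q \<in> ball x0 r" by simp
    have "1 * \<rho> < (2 * M + 4) * \<rho>"
      using \<rho>(1) L by (intro mult_strict_right_mono) (auto simp: M_def)
    then have "\<rho> < r" using \<rho>(2) by simp
    then have "x \<in> ball x0 r" using x(2) by simp
    then have gx: "\<gamma> (?P x) < x \<bullet> e" using x(1) \<Omega> by blast
    have Pq: "?P ?q - ?P x = s *\<^sub>R ?P z"
      using ee by (simp add: algebra_simps inner_add_left)
    have "\<gamma> (?P ?q) - \<gamma> (?P x) \<le> dist (\<gamma> (?P ?q)) (\<gamma> (?P x))"
      by (simp add: dist_real_def)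
    also have "\<dots> \<le> L * dist (?P ?q) (?P x)"
      by (rule lipschitz_onD[OF lip]) (simp_all add: inner_diff_left ee)
    also have "\<dots> = L * (s * norm (?P z))"
      unfolding dist_norm Pq norm_scaleR using s by simp
    also have "\<dots> \<le> L * (s * norm z)"
      using s L norm_projection_le[OF e] by (intro mult_left_mono) auto
    finally have g: "\<gamma> (?P ?q) \<le> \<gamma> (?P x) + L * (s * norm z)" by simp
    have "- (s * norm z) \<le> s * (z \<bullet> e)"
      using Cauchy_Schwarz_ineq2[of z e] e s mult_left_mono[of "- norm z" "z \<bullet> e" s] by auto
    then have "x \<bullet> e + t * (norm z * M) - s * norm z \<le> ?q \<bullet> e"
      using ee by (simp add: inner_add_left)
    moreover have "L * (s * norm z) + s * norm z \<le> t * (norm z * M)"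
    proof -
      have "s * (norm z * M) \<le> t * (norm z * M)"
        using st s t L by (intro mult_right_mono) (auto simp: M_def)
      then show ?thesis by (simp add: M_def algebra_simps)
    qed
    ultimately have "\<gamma> (?P ?q) < ?q \<bullet> e"
      using g gx by linarith
    then show ?thesis
      using q \<Omega> by blast
  qed
  show thesis
  proof (rule that[OF \<rho>(1), of "M *\<^sub>R e"])
    fix x y assume xy: "x \<in> \<Omega>" "y \<in> \<Omega>" "x \<in> ball x0 \<rho>" "y \<in> ball x0 \<rho>"
    have "dist x y < \<rho> + \<rho>"
      using xy(3,4) dist_triangle[of x y x0] by (simp add: dist_commute)
    then have z: "norm (y - x) < 2 * \<rho>"
      by (simp add: dist_norm norm_minus_commute)
    show "chain \<Omega> (M *\<^sub>R e) x (y - x)"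
      unfolding chain_def segment_kernel_def
      using inside[OF xy(1,3) z, of _ 0] inside[OF xy(1,3) z, of 1] inside[OF xy(2,4) z, of _ 0]
      by auto
  qed
qed

lemma chain_interior:
  fixes \<Omega> :: "'a::euclidean_space set"
  assumes "ball x0 \<rho> \<subseteq> \<Omega>" "x \<in> ball x0 \<rho>" "y \<in> ball x0 \<rho>"
  shows "chain \<Omega> 0 x (y - x)"
proof -
  have "x + t *\<^sub>R (y - x) \<in> \<Omega>" if "t \<in> {0..1}" for t
  proof -
    have "(1 - t) *\<^sub>R x + t *\<^sub>R y \<in> ball x0 \<rho>"
      using that assms(2,3) by (intro convexD[OF convex_ball]) auto
    then show ?thesis
      using assms(1) by (auto simp: algebra_simps)
  qed
  then show ?thesis
    using assms by (auto simp: chain_def segment_kernel_def)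
qed

text \<open>Compactness of the closure leaves finitely many directions, and a Lebesgue number
  \<delta> of the cover puts \<open>x\<close> and \<open>x + z\<close> into a common ball.\<close>

lemma lipschitz_domain_chain:
  fixes \<Omega> :: "'a::euclidean_space set"
  assumes "bounded_lipschitz_domain \<Omega>"
  obtains W \<delta> where "finite W" "\<delta> > 0"
    "\<And>x z. x \<in> \<Omega> \<Longrightarrow> x + z \<in> \<Omega> \<Longrightarrow> norm z < \<delta> \<Longrightarrow> \<exists>w\<in>W. chain \<Omega> w x z"
proof -
  have \<Omega>: "open \<Omega>" "bounded \<Omega>" "lipschitz_boundary \<Omega>"
    using assms by (auto simp: bounded_lipschitz_domain_def)
  have "\<exists>\<rho> w. \<rho> > 0 \<and> (\<forall>x y. x \<in> \<Omega> \<longrightarrow> y \<in> \<Omega> \<longrightarrow> x \<in> ball x0 \<rho> \<longrightarrow> y \<in> ball x0 \<rho> \<longrightarrow> chain \<Omega> w x (y - x))"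
    if "x0 \<in> closure \<Omega>" for x0
  proof (cases "x0 \<in> \<Omega>")
    case True
    then obtain \<rho> where "\<rho> > 0" "ball x0 \<rho> \<subseteq> \<Omega>"
      using \<Omega>(1) open_contains_ball by blast
    then show ?thesis
      using chain_interior by blast
  next
    case False
    then have "x0 \<in> frontier \<Omega>"
      using that \<Omega>(1) by (simp add: frontier_def interior_open)
    then show ?thesis
      by (metis chain_frontier[OF \<Omega>(3)])
  qed
  then obtain \<rho> w where \<rho>w: "\<And>x0. x0 \<in> closure \<Omega> \<Longrightarrow> \<rho> x0 > 0"
    "\<And>x0 x y. x0 \<in> closure \<Omega> \<Longrightarrow> x \<in> \<Omega> \<Longrightarrow> y \<in> \<Omega> \<Longrightarrow> x \<in> ball x0 (\<rho> x0) \<Longrightarrow> y \<in> ball x0 (\<rho> x0)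
      \<Longrightarrow> chain \<Omega> (w x0) x (y - x)"
    by metis
  have comp: "compact (closure \<Omega>)"
    using \<Omega>(2) by simp
  obtain C where C: "C \<subseteq> closure \<Omega>" "finite C" "closure \<Omega> \<subseteq> (\<Union>c\<in>C. ball c (\<rho> c))"
  proof (rule compactE_image[OF comp, of "closure \<Omega>" "\<lambda>c. ball c (\<rho> c)"])
    show "closure \<Omega> \<subseteq> (\<Union>c\<in>closure \<Omega>. ball c (\<rho> c))"
      using \<rho>w(1) by force
  qed auto
  obtain \<delta> where \<delta>: "\<delta> > 0" "\<And>x. x \<in> closure \<Omega> \<Longrightarrow> \<exists>G\<in>(\<lambda>c. ball c (\<rho> c)) ` C. ball x \<delta> \<subseteq> G"
    using Heine_Borel_lemma[OF comp, of "(\<lambda>c. ball c (\<rho> c)) ` C"] C(3) by blast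
  show thesis
  proof (rule that[of "w ` C" \<delta>])
    fix x z assume x: "x \<in> \<Omega>" "x + z \<in> \<Omega>" "norm z < \<delta>"
    have "x \<in> closure \<Omega>" using x(1) closure_subset by blast
    then obtain c where c: "c \<in> C" "ball x \<delta> \<subseteq> ball c (\<rho> c)"
      using \<delta>(2) by blast
    have "x \<in> ball x \<delta>" "x + z \<in> ball x \<delta>"
      using \<delta>(1) x(3) by (auto simp: dist_norm)
    then have "chain \<Omega> (w c) x (x + z - x)"
      using \<rho>w(2)[of c x "x + z"] c C(1) x by blast
    then show "\<exists>w\<in>w ` C. chain \<Omega> w x z"
      using c(1) by auto
  qed (use C(2) \<delta>(1) in auto)
qed

text \<open>Dyadic shells take the place of polar coordinates: the sup of the integrand on a shell
  times the volume of the ball containing it gives a geometric series.\<close>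

lemma nn_integral_norm_powr_ball:
  assumes a: "a > 0" and \<delta>: "\<delta> > 0"
  shows "(\<integral>\<^sup>+z\<in>ball (0::'a::euclidean_space) \<delta>. ennreal (norm z powr (a - real DIM('a))) \<partial>lborel) < \<infinity>"
proof -
  let ?n = "DIM('a)" and ?f = "\<lambda>z::'a. ennreal (norm z powr (a - real DIM('a)))"
  define R where "R k = \<delta> / 2 ^ k" for k :: nat
  have R: "R k > 0" "R (Suc k) = R k / 2" for k
    using \<delta> by (auto simp: R_def)
  \<comment> \<open>Upper bound of |z|^a / |z|^n on the shell between \<open>R (Suc k)\<close> and
    \<open>R k\<close>: the numerator is taken at the outer radius, the denominator at the inner
    one.\<close>
  define c where "c k = R k powr a / R (Suc k) ^ ?n" for k
  \<comment> \<open>A single term of the series already dominates. At the origin the left side is 0,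
    the value of \<open>0 powr _\<close>.\<close>
  have pointwise: "?f z * indicator (ball 0 \<delta>) z \<le> (\<Sum>k. ennreal (c k) * indicator (ball 0 (R k)) z)" for z
  proof (cases "z \<in> ball 0 \<delta> \<and> z \<noteq> 0")
    case True
    have "(\<lambda>k. \<delta> * (1 / 2) ^ k) \<longlonglongrightarrow> \<delta> * 0"
      by (intro tendsto_intros LIMSEQ_realpow_zero) auto
    then have "eventually (\<lambda>k. \<delta> * (1 / 2) ^ k < norm z) sequentially"
      using True by (intro order_tendstoD(2)) auto
    then obtain m where m: "R m < norm z"
      by (auto simp: R_def eventually_sequentially power_divide)
    have "R 0 = \<delta>" by (simp add: R_def)
    then have "\<not> R 0 \<le> norm z" using True by simp
    then obtain k where k: "\<not> R k \<le> norm z" "R (Suc k) \<le> norm z"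
      using m nat_induct[of "\<lambda>k. \<not> R k \<le> norm z" m] by force
    have "norm z powr (a - real ?n) = norm z powr a / norm z ^ ?n"
      using True by (simp add: powr_diff powr_realpow)
    also have "\<dots> \<le> c k"
      unfolding c_def using k a R[of k] R(1)[of "Suc k"]
      by (intro frac_le powr_mono2 power_mono) auto
    finally have "?f z * indicator (ball 0 \<delta>) z \<le> ennreal (c k) * indicator (ball 0 (R k)) z"
      using k(1) True by (auto intro: ennreal_leI)
    also have "\<dots> \<le> (\<Sum>k. ennreal (c k) * indicator (ball 0 (R k)) z)"
    proof -
      define F where "F k = ennreal (c k) * indicator (ball 0 (R k)) z" for k
      show ?thesis
        using sum_le_suminf[of F "{k}"] by (simp flip: F_def)
    qed
    finally show ?thesis .
  qed (auto simp: indicator_def)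
  define V where "V = unit_ball_vol (real ?n)"
  have V: "V \<ge> 0" by (simp add: V_def)
  \<comment> \<open>The value of \<open>c k\<close> times the volume of the ball of radius
    \<open>R k\<close>: the n-th powers cancel up to \<open>2 ^ ?n\<close>, leaving the ratio
    \<open>2 powr (- a) < 1\<close>.\<close>
  define b where "b k = \<delta> powr a * 2 ^ ?n * V * (2 powr (- a)) ^ k" for k :: nat
  have cb: "ennreal (c k) * emeasure lborel (ball (0::'a) (R k)) = ennreal (b k)" for k
  proof -
    have "R k powr a = \<delta> powr a * (2 powr (- a)) ^ k"
      using \<delta> by (simp add: R_def powr_divide powr_realpow[symmetric] powr_powr powr_minus field_simps)
    moreover have "R (Suc k) ^ ?n = R k ^ ?n / 2 ^ ?n"
      by (simp add: R(2) power_divide)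
    ultimately have "c k * (V * R k ^ ?n) = b k"
      using R(1)[of k] by (simp add: c_def b_def)
    moreover have "emeasure lborel (ball (0::'a) (R k)) = ennreal (V * R k ^ ?n)"
      using R(1)[of k] by (simp add: emeasure_ball V_def)
    moreover have "c k \<ge> 0"
      using R(1) by (simp add: c_def less_imp_le)
    ultimately show ?thesis
      by (simp add: ennreal_mult'[symmetric])
  qed
  have [measurable]: "ball (0::'a) (R k) \<in> sets borel" for k
    by simp
  have "(\<integral>\<^sup>+z\<in>ball 0 \<delta>. ?f z \<partial>lborel) \<le> (\<integral>\<^sup>+z. (\<Sum>k. ennreal (c k) * indicator (ball (0::'a) (R k)) z) \<partial>lborel)"
    by (intro nn_integral_mono pointwise)
  also have "\<dots> = (\<Sum>k. \<integral>\<^sup>+z. ennreal (c k) * indicator (ball (0::'a) (R k)) z \<partial>lborel)"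
    by (intro nn_integral_suminf) measurable
  also have "\<dots> = (\<Sum>k. ennreal (b k))"
    by (subst nn_integral_cmult_indicator) (simp_all add: cb)
  also have "\<dots> < \<infinity>"
  proof -
    have "2 powr (- a) < 1"
      using a by (simp add: powr_minus inverse_less_1_iff)
    then have "summable b"
      unfolding b_def by (intro summable_mult summable_geometric) simp
    then show ?thesis
      using V \<delta> by (subst suminf_ennreal2) (auto simp: b_def)
  qed
  finally show ?thesis .
qed

lemma norm_add_square_le: "(norm (a + b :: 'a::real_normed_vector))\<^sup>2 \<le> 2 * (norm a)\<^sup>2 + 2 * (norm b)\<^sup>2"
proof -
  have "(norm (a + b))\<^sup>2 \<le> (norm a + norm b)\<^sup>2"
    by (intro power_mono norm_triangle_ineq) auto
  also have "\<dots> \<le> 2 * (norm a)\<^sup>2 + 2 * (norm b)\<^sup>2"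
    using sum_squares_bound[of "norm a" "norm b"] by (simp add: power2_sum)
  finally show ?thesis .
qed

text \<open>Two uses of the two-term inequality give the weights 4, 4 and 2, and the last is rounded
  up. The last term reads \<open>c - d\<close> because both end points are lifted upwards.\<close>

lemma norm_diff_square_le_chain:
  fixes a b c d :: "'a::real_normed_vector"
  shows "(norm (a - d))\<^sup>2 \<le> 4 * (norm (b - a))\<^sup>2 + 4 * (norm (c - b))\<^sup>2 + 4 * (norm (c - d))\<^sup>2"
proof -
  have "(norm (a - d))\<^sup>2 = (norm ((- (b - a) + - (c - b)) + (c - d)))\<^sup>2" by simp
  also have "\<dots> \<le> 2 * (norm (- (b - a) + - (c - b)))\<^sup>2 + 2 * (norm (c - d))\<^sup>2"
    by (rule norm_add_square_le)
  also have "(norm (- (b - a) + - (c - b)))\<^sup>2 \<le> 2 * (norm (- (b - a)))\<^sup>2 + 2 * (norm (- (c - b)))\<^sup>2"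
    by (rule norm_add_square_le)
  finally show ?thesis
    unfolding norm_minus_cancel by (smt (verit) zero_le_power2)
qed

section \<open>Increments and the Slobodeckij seminorm\<close>

context weak_gradient
begin

definition increment :: "'a \<Rightarrow> ennreal" where
  "increment z = (\<integral>\<^sup>+x. indicator \<Omega> x * indicator \<Omega> (x + z) * ennreal ((norm (u x - u (x + z)))\<^sup>2) \<partial>lborel)"

definition mass :: ennreal where
  "mass = (\<integral>\<^sup>+x. ennreal ((norm (u x))\<^sup>2) \<partial>lborel)"

lemma increment_le_mass: "increment z \<le> 4 * mass"
proof -
  have "increment z \<le> (\<integral>\<^sup>+x. 2 * ennreal ((norm (u x))\<^sup>2) + 2 * ennreal ((norm (u (x + z)))\<^sup>2) \<partial>lborel)"
    unfolding increment_def
  proof (rule nn_integral_mono)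
    fix x
    have "ennreal ((norm (u x - u (x + z)))\<^sup>2) \<le> ennreal (2 * (norm (u x))\<^sup>2 + 2 * (norm (u (x + z)))\<^sup>2)"
      using norm_add_square_le[of "u x" "- u (x + z)"] by (intro ennreal_leI) simp
    also have "\<dots> = 2 * ennreal ((norm (u x))\<^sup>2) + 2 * ennreal ((norm (u (x + z)))\<^sup>2)"
      by (simp add: ennreal_mult')
    finally show "indicator \<Omega> x * indicator \<Omega> (x + z) * ennreal ((norm (u x - u (x + z)))\<^sup>2)
        \<le> 2 * ennreal ((norm (u x))\<^sup>2) + 2 * ennreal ((norm (u (x + z)))\<^sup>2)"
      by (auto simp: indicator_def)
  qed
  also have "\<dots> = 2 * mass + 2 * (\<integral>\<^sup>+x. ennreal ((norm (u (x + z)))\<^sup>2) \<partial>lborel)"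
    unfolding mass_def by (subst nn_integral_add) (simp_all add: nn_integral_cmult)
  also have "(\<integral>\<^sup>+x. ennreal ((norm (u (x + z)))\<^sup>2) \<partial>lborel) = mass"
    unfolding mass_def by (rule nn_integral_translate[of "\<lambda>x. ennreal ((norm (u x))\<^sup>2)"]) simp
  also have "2 * mass + 2 * mass = 4 * mass"
    by (simp flip: distrib_right)
  finally show ?thesis .
qed

text \<open>The direction \<open>w\<close> depends on \<open>x\<close>; summing the estimate over
  all of the finite set \<open>W\<close> avoids choosing it measurably. The constant collects two
  lifts of length \<open>norm z * norm w\<close> and one move of length
  \<open>norm z\<close>.\<close>

lemma increment_le_energy:
  assumes W: "finite W"
    and chain: "\<And>x. x \<in> \<Omega> \<Longrightarrow> x + z \<in> \<Omega> \<Longrightarrow> \<exists>w\<in>W. chain \<Omega> w x z"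
  shows "increment z \<le> ennreal (\<Sum>w\<in>W. 4 * (2 * (norm w)\<^sup>2 + 1)) * ennreal ((norm z)\<^sup>2) * energy"
proof -
  let ?D = "\<lambda>w x. ennreal ((norm (u (x + w) - u x))\<^sup>2) * indicator (segment_kernel \<Omega> w) x"
  let ?h = "\<lambda>w::'a. norm z *\<^sub>R w"
  have [measurable]: "segment_kernel \<Omega> w \<in> sets borel" for w
    using open_segment_kernel[OF \<Omega>] by simp
  have D: "(\<integral>\<^sup>+x. ?D w (x + c) \<partial>lborel) \<le> ennreal ((norm w)\<^sup>2) * energy" for w c
    using nn_integral_translate[of "?D w" c] translation_estimate[of w] by simp
  have "increment z \<le> (\<integral>\<^sup>+x. (\<Sum>w\<in>W. 4 * (?D (?h w) x + ?D z (x + ?h w) + ?D (?h w) (x + z))) \<partial>lborel)"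
    unfolding increment_def
  proof (rule nn_integral_mono)
    fix x
    let ?S = "\<lambda>w. 4 * (?D (?h w) x + ?D z (x + ?h w) + ?D (?h w) (x + z))"
    show "indicator \<Omega> x * indicator \<Omega> (x + z) * ennreal ((norm (u x - u (x + z)))\<^sup>2) \<le> (\<Sum>w\<in>W. ?S w)"
    proof (cases "x \<in> \<Omega> \<and> x + z \<in> \<Omega>")
      case True
      then obtain w where w: "w \<in> W" "chain \<Omega> w x z"
        using chain by blast
      have "ennreal ((norm (u x - u (x + z)))\<^sup>2) \<le> ennreal (4 * (norm (u (x + ?h w) - u x))\<^sup>2
          + 4 * (norm (u (x + ?h w + z) - u (x + ?h w)))\<^sup>2 + 4 * (norm (u (x + ?h w + z) - u (x + z)))\<^sup>2)"
        by (intro ennreal_leI norm_diff_square_le_chain)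
      also have "\<dots> = ?S w"
        using w(2) by (simp add: chain_def ennreal_mult' distrib_left add_ac)
      also have "\<dots> \<le> (\<Sum>w\<in>W. ?S w)"
        using w(1) W by (intro member_le_sum) auto
      finally show ?thesis using True by simp
    qed (auto simp: indicator_def)
  qed
  also have "\<dots> = (\<Sum>w\<in>W. 4 * ((\<integral>\<^sup>+x. ?D (?h w) x \<partial>lborel) + (\<integral>\<^sup>+x. ?D z (x + ?h w) \<partial>lborel)
      + (\<integral>\<^sup>+x. ?D (?h w) (x + z) \<partial>lborel)))"
    by (simp add: nn_integral_sum nn_integral_cmult nn_integral_add)
  also have "\<dots> \<le> (\<Sum>w\<in>W. 4 * (ennreal ((norm (?h w))\<^sup>2) * energy + ennreal ((norm z)\<^sup>2) * energy
      + ennreal ((norm (?h w))\<^sup>2) * energy))"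
    by (intro sum_mono mult_left_mono add_mono D translation_estimate) auto
  also have "\<dots> = (\<Sum>w\<in>W. ennreal (4 * (2 * (norm w)\<^sup>2 + 1)) * ennreal ((norm z)\<^sup>2) * energy)"
  proof (intro sum.cong refl)
    fix w
    have "4 * (ennreal ((norm (?h w))\<^sup>2) * energy + ennreal ((norm z)\<^sup>2) * energy + ennreal ((norm (?h w))\<^sup>2) * energy)
        = 4 * (ennreal ((norm (?h w))\<^sup>2) + ennreal ((norm z)\<^sup>2) + ennreal ((norm (?h w))\<^sup>2)) * energy"
      by (simp add: algebra_simps)
    also have "4 * (ennreal ((norm (?h w))\<^sup>2) + ennreal ((norm z)\<^sup>2) + ennreal ((norm (?h w))\<^sup>2))
        = ennreal (4 * ((norm (?h w))\<^sup>2 + (norm z)\<^sup>2 + (norm (?h w))\<^sup>2))"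
      by (subst ennreal_mult') (simp_all flip: ennreal_plus)
    also have "4 * ((norm (?h w))\<^sup>2 + (norm z)\<^sup>2 + (norm (?h w))\<^sup>2) = (4 * (2 * (norm w)\<^sup>2 + 1)) * (norm z)\<^sup>2"
      by (simp add: power_mult_distrib algebra_simps)
    also have "ennreal \<dots> = ennreal (4 * (2 * (norm w)\<^sup>2 + 1)) * ennreal ((norm z)\<^sup>2)"
      by (intro ennreal_mult) auto
    finally show "4 * (ennreal ((norm (?h w))\<^sup>2) * energy + ennreal ((norm z)\<^sup>2) * energy + ennreal ((norm (?h w))\<^sup>2) * energy)
        = ennreal (4 * (2 * (norm w)\<^sup>2 + 1)) * ennreal ((norm z)\<^sup>2) * energy" .
  qed
  also have "\<dots> = ennreal (\<Sum>w\<in>W. 4 * (2 * (norm w)\<^sup>2 + 1)) * ennreal ((norm z)\<^sup>2) * energy"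
    unfolding sum_distrib_right[symmetric] by (subst sum_ennreal) simp_all
  finally show ?thesis .
qed

text \<open>Substituting y = x + z and exchanging the integrals isolates the singular weight, which
  depends on \<open>z\<close> alone.\<close>

lemma slobodeckij_eq_increment:
  "slobodeckij \<Omega> r u = (\<integral>\<^sup>+z. ennreal (1 / norm z powr (real DIM('a) + 2 * r)) * increment z \<partial>lborel)"
proof -
  define q where "q = real DIM('a) + 2 * r"
  have [measurable]: "\<Omega> \<in> sets borel" using \<Omega> by simp
  let ?T = "\<lambda>x z. indicator \<Omega> x * (ennreal ((norm (u x - u (x + z)))\<^sup>2 / norm z powr q) * indicator \<Omega> (x + z))"
  have "slobodeckij \<Omega> r u = (\<integral>\<^sup>+x. (\<integral>\<^sup>+y. indicator \<Omega> x * (ennreal ((norm (u x - u y))\<^sup>2 / norm (x - y) powr q) * indicator \<Omega> y) \<partial>lborel) \<partial>lborel)"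
    unfolding slobodeckij_def nn_integral_completion q_def
    by (intro nn_integral_cong) (auto simp: indicator_def)
  also have "\<dots> = (\<integral>\<^sup>+x. (\<integral>\<^sup>+z. ?T x z \<partial>lborel) \<partial>lborel)"
  proof (rule nn_integral_cong)
    fix x
    show "(\<integral>\<^sup>+y. indicator \<Omega> x * (ennreal ((norm (u x - u y))\<^sup>2 / norm (x - y) powr q) * indicator \<Omega> y) \<partial>lborel)
        = (\<integral>\<^sup>+z. ?T x z \<partial>lborel)"
      using nn_integral_translate[of "\<lambda>y. indicator \<Omega> x * (ennreal ((norm (u x - u y))\<^sup>2 / norm (x - y) powr q) * indicator \<Omega> y)" x]
      by (simp add: add.commute)
  qed
  also have "\<dots> = (\<integral>\<^sup>+z. (\<integral>\<^sup>+x. ?T x z \<partial>lborel) \<partial>lborel)"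
    by (rule lborel_pair.Fubini'[symmetric]) measurable
  also have "\<dots> = (\<integral>\<^sup>+z. ennreal (1 / norm z powr q) * increment z \<partial>lborel)"
    unfolding increment_def
    by (subst nn_integral_cmult[symmetric])
      (auto intro!: nn_integral_cong simp: mult_ac simp flip: ennreal_mult')
  finally show ?thesis by (simp add: q_def)
qed

end

lemma nn_integral_linear_combination:
  assumes "f \<in> borel_measurable M" "g \<in> borel_measurable M"
  shows "(\<integral>\<^sup>+x. a * f x + b * g x \<partial>M) = a * (\<integral>\<^sup>+x. f x \<partial>M) + b * (\<integral>\<^sup>+x. g x \<partial>M)"
  using assms by (subst nn_integral_add) (auto simp: nn_integral_cmult)

text \<open>The embedding of H^1 into H^r. \<open>K\<close> is fixed before \<open>u\<close> and
  \<open>G\<close>, as a bound on an operator norm requires. Increments shorter than \<delta> are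
  paid for by the energy, longer ones by the mass.\<close>

lemma slobodeckij_bound:
  fixes \<Omega> :: "'a::euclidean_space set"
  assumes \<Omega>: "bounded_lipschitz_domain \<Omega>" and r: "0 < r" "r < 1"
  obtains K :: real where "K \<ge> 0"
    "\<And>(u :: 'a \<Rightarrow> 'k::{real_normed_field,euclidean_space}) G. weak_gradient \<Omega> u G \<Longrightarrow>
      slobodeckij \<Omega> r u \<le> ennreal K * (weak_gradient.mass u + weak_gradient.energy G)"
proof -
  define q where "q = real DIM('a) + 2 * r"
  obtain W \<delta> where W: "finite W" and \<delta>: "\<delta> > 0"
    and chain: "\<And>x z. x \<in> \<Omega> \<Longrightarrow> x + z \<in> \<Omega> \<Longrightarrow> norm z < \<delta> \<Longrightarrow> \<exists>w\<in>W. chain \<Omega> w x z"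
    using lipschitz_domain_chain[OF \<Omega>] by metis
  obtain R where R: "\<And>x. x \<in> \<Omega> \<Longrightarrow> norm x \<le> R"
    using \<Omega> unfolding bounded_lipschitz_domain_def bounded_iff by metis
  let ?c = "\<Sum>w\<in>W. 4 * (2 * (norm w)\<^sup>2 + 1)"
  \<comment> \<open>The energy bound contributes |z|^2 to the weight |z|^(-q), and 2 - q = (2 - 2r)
    - n; the excess 2 - 2r over -n is positive because r < 1.\<close>
  let ?near = "\<lambda>z::'a. ennreal (norm z powr ((2 - 2 * r) - real DIM('a))) * indicator (ball 0 \<delta>) z"
  \<comment> \<open>Two points of \<open>\<Omega>\<close> differ by at most 2R, so beyond that
    radius the increment vanishes, and the weight is bounded by its value at \<delta>.\<close>
  let ?far = "\<lambda>z::'a. ennreal (1 / \<delta> powr q) * indicator (cball 0 (2 * R)) z"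
  define N where "N = (\<integral>\<^sup>+z. ?near z \<partial>lborel)"
  define F where "F = (\<integral>\<^sup>+z. ?far z \<partial>lborel)"
  define c where "c = ennreal ?c"
  define K where "K = c * N + 4 * F"
  have [measurable]: "ball (0::'a) \<delta> \<in> sets borel"
    by simp
  have near: "?near \<in> borel_measurable lborel"
    by measurable
  have far: "?far \<in> borel_measurable lborel"
    by (intro borel_measurable_times_ennreal borel_measurable_indicator) simp_all
  have "N < \<infinity>"
    unfolding N_def using nn_integral_norm_powr_ball[of "2 - 2 * r" \<delta>] r \<delta> by simp
  moreover have "F < \<infinity>"
    unfolding F_def using emeasure_bounded_finite[of "cball (0::'a) (2 * R)"] by (simp add: nn_integral_cmult_indicator ennreal_mult_less_top)
  ultimately have K: "K < \<infinity>"
    by (simp add: K_def c_def ennreal_mult_less_top)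
  show thesis
  proof (rule that[of "enn2real K"])
    fix u :: "'a \<Rightarrow> 'k" and G assume "weak_gradient \<Omega> u G"
    then interpret weak_gradient \<Omega> u G .
    have "ennreal (1 / norm z powr q) * increment z \<le> ennreal ?c * energy * ?near z + 4 * mass * ?far z" for z
    proof (cases "norm z < \<delta>")
      case True
      have "increment z \<le> ennreal ?c * ennreal ((norm z)\<^sup>2) * energy"
        using chain True by (intro increment_le_energy W) auto
      then have "ennreal (1 / norm z powr q) * increment z
          \<le> ennreal (1 / norm z powr q) * (ennreal ?c * ennreal ((norm z)\<^sup>2) * energy)"
        by (rule mult_left_mono) simp
      also have "\<dots> = ennreal ?c * energy * (ennreal (1 / norm z powr q) * ennreal ((norm z)\<^sup>2))"
        by (simp only: mult_ac)
      also have "ennreal (1 / norm z powr q) * ennreal ((norm z)\<^sup>2) = ?near z"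
      proof (cases "z = 0")
        case False
        have "1 / norm z powr q * (norm z)\<^sup>2 = norm z powr (2 - q)"
          using False by (simp add: powr_diff powr_numeral)
        then have "1 / norm z powr q * (norm z)\<^sup>2 = norm z powr ((2 - 2 * r) - real DIM('a))"
          by (simp add: q_def algebra_simps)
        then show ?thesis using True by (simp flip: ennreal_mult')
      qed simp
      finally show ?thesis
        by (rule order.trans) simp
    next
      case False
      show ?thesis
      proof (cases "norm z \<le> 2 * R")
        case True
        have "\<delta> powr q \<le> norm z powr q"
          using False \<delta> r by (intro powr_mono2) (auto simp: q_def)
        then have "ennreal (1 / norm z powr q) \<le> ennreal (1 / \<delta> powr q)"
          using \<delta> by (intro ennreal_leI frac_le) auto
        then have "ennreal (1 / norm z powr q) * increment z \<le> ennreal (1 / \<delta> powr q) * (4 * mass)"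
          by (intro mult_mono increment_le_mass) auto
        also have "\<dots> \<le> ennreal ?c * energy * ?near z + 4 * mass * ?far z"
          using True by (simp add: mult_ac)
        finally show ?thesis .
      next
        case False
        have "x \<notin> \<Omega> \<or> x + z \<notin> \<Omega>" for x
          using R[of x] R[of "x + z"] False norm_triangle_ineq4[of "x + z" x] by auto
        then have "(\<lambda>x. indicator \<Omega> x * indicator \<Omega> (x + z) * ennreal ((norm (u x - u (x + z)))\<^sup>2)) = (\<lambda>_. 0)"
          by (auto simp: indicator_def)
        then have "increment z = 0"
          by (simp only: increment_def nn_integral_const mult_zero_left)
        then show ?thesis by simp
      qed
    qed
    then have "slobodeckij \<Omega> r u \<le> (\<integral>\<^sup>+z. (c * energy) * ?near z + (4 * mass) * ?far z \<partial>lborel)"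
      unfolding slobodeckij_eq_increment q_def[symmetric] c_def by (intro nn_integral_mono)
    also have "\<dots> = (c * energy) * N + (4 * mass) * F"
      unfolding N_def F_def using near far by (rule nn_integral_linear_combination)
    also have "\<dots> = (c * N) * energy + (4 * F) * mass"
      by (simp only: mult_ac)
    also have "\<dots> \<le> K * energy + K * mass"
      unfolding K_def by (intro add_mono mult_right_mono) auto
    also have "\<dots> = ennreal (enn2real K) * (mass + energy)"
      using K by (simp add: algebra_simps)
    finally show "slobodeckij \<Omega> r u \<le> ennreal (enn2real K) * (mass + energy)" .
  qed simp
qed

subsection \<open>Integral operators with square integrable kernels\<close>

locale L2_kernel =
  fixes \<Omega> :: "'a::euclidean_space set" and g :: "'a \<times> 'a \<Rightarrow> real"
  assumes \<Omega>: "open \<Omega>" "bounded \<Omega>"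
    and g: "g \<in> borel_measurable borel" "\<And>z. z \<notin> \<Omega> \<times> \<Omega> \<Longrightarrow> g z = 0"
    and g_L2: "(\<integral>\<^sup>+z. ennreal ((norm (g z))\<^sup>2) \<partial>lborel) < \<infinity>"
begin

lemma g_measurable [measurable]: "g \<in> borel_measurable (lborel \<Otimes>\<^sub>M lborel)"
  using g(1) by (simp add: lborel_prod)

text \<open>The squared Hilbert--Schmidt norm of the integral operator.\<close>

definition kernel_sq :: ennreal where
  "kernel_sq = (\<integral>\<^sup>+z. ennreal ((norm (g z))\<^sup>2) \<partial>lborel)"

lemma kernel_sq_finite: "kernel_sq < \<infinity>"
  using g_L2 by (simp add: kernel_sq_def)

lemma kernel_sq_eq: "kernel_sq = (\<integral>\<^sup>+x. \<integral>\<^sup>+y. ennreal ((norm (g (x, y)))\<^sup>2) \<partial>lborel \<partial>lborel)"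
  unfolding kernel_sq_def lborel_prod[symmetric] by (rule lborel.nn_integral_fst[symmetric]) measurable

definition op :: "('a \<Rightarrow> 'k::{real_normed_field,euclidean_space}) \<Rightarrow> 'a \<Rightarrow> 'k" where
  "op f x = (LINT y|lborel. g (x, y) *\<^sub>R f y)"

lemma op_eq_0: "x \<notin> \<Omega> \<Longrightarrow> op f x = 0"
  by (simp add: op_def g(2))

lemma op_measurable [measurable]:
  assumes [measurable]: "f \<in> borel_measurable borel"
  shows "op f \<in> borel_measurable borel"
proof -
  have "op f \<in> borel_measurable lborel"
    unfolding op_def by measurable
  then show ?thesis by simp
qed

text \<open>The bound |g f| \<le> |g|^2 + |f|^2 suffices: |f|^2, as a function of both variables on
  \<open>\<Omega> \<times> \<Omega>\<close>, is integrable because \<open>\<Omega>\<close> has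
  finite measure.\<close>

lemma product_integrable:
  fixes f :: "'a \<Rightarrow> 'k::{real_normed_field,euclidean_space}"
  assumes f[measurable]: "f \<in> borel_measurable borel" and f2: "(\<integral>\<^sup>+y. ennreal ((norm (f y))\<^sup>2) \<partial>lborel) < \<infinity>"
  shows "integrable (lborel \<Otimes>\<^sub>M lborel) (\<lambda>(x, y). g (x, y) *\<^sub>R f y)"
proof (rule integrableI_bounded)
  have [measurable]: "\<Omega> \<in> sets borel" using \<Omega>(1) by simp
  let ?r = "\<lambda>(x, y). indicator \<Omega> x * ennreal ((norm (f y))\<^sup>2)"
  have "(\<integral>\<^sup>+z. ennreal (norm (case z of (x, y) \<Rightarrow> g (x, y) *\<^sub>R f y)) \<partial>(lborel \<Otimes>\<^sub>M lborel))
      \<le> (\<integral>\<^sup>+z. ennreal ((norm (g z))\<^sup>2) + ?r z \<partial>(lborel \<Otimes>\<^sub>M lborel))"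
  proof (rule nn_integral_mono)
    fix z :: "'a \<times> 'a"
    obtain x y where z: "z = (x, y)" by fastforce
    show "ennreal (norm (case z of (x, y) \<Rightarrow> g (x, y) *\<^sub>R f y)) \<le> ennreal ((norm (g z))\<^sup>2) + ?r z"
    proof (cases "x \<in> \<Omega>")
      case True
      have "2 * (\<bar>g z\<bar> * norm (f y)) \<le> (norm (g z))\<^sup>2 + (norm (f y))\<^sup>2"
        using sum_squares_bound[of "\<bar>g z\<bar>" "norm (f y)"] by simp
      moreover have "0 \<le> \<bar>g z\<bar> * norm (f y)" by simp
      ultimately have "\<bar>g z\<bar> * norm (f y) \<le> (norm (g z))\<^sup>2 + (norm (f y))\<^sup>2" by linarith
      then have "ennreal (\<bar>g z\<bar> * norm (f y)) \<le> ennreal ((norm (g z))\<^sup>2 + (norm (f y))\<^sup>2)"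
        by (rule ennreal_leI)
      then show ?thesis using True z by simp
    qed (simp add: z g(2))
  qed
  also have "\<dots> = kernel_sq + (\<integral>\<^sup>+z. ?r z \<partial>(lborel \<Otimes>\<^sub>M lborel))"
    unfolding kernel_sq_def lborel_prod[symmetric] by (rule nn_integral_add) measurable
  also have "(\<integral>\<^sup>+z. ?r z \<partial>(lborel \<Otimes>\<^sub>M lborel)) = (\<integral>\<^sup>+x. \<integral>\<^sup>+y. indicator \<Omega> x * ennreal ((norm (f y))\<^sup>2) \<partial>lborel \<partial>lborel)"
    by (subst lborel.nn_integral_fst[symmetric]) simp_all
  also have "\<dots> = (\<integral>\<^sup>+y. ennreal ((norm (f y))\<^sup>2) \<partial>lborel) * emeasure lborel \<Omega>"
    by (simp add: nn_integral_cmult nn_integral_multc mult.commute)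
  also have "kernel_sq + \<dots> < \<infinity>"
    using kernel_sq_finite f2 emeasure_bounded_finite[OF \<Omega>(2)] by (simp add: ennreal_mult_less_top)
  finally show "(\<integral>\<^sup>+z. ennreal (norm (case z of (x, y) \<Rightarrow> g (x, y) *\<^sub>R f y)) \<partial>(lborel \<Otimes>\<^sub>M lborel)) < \<infinity>" .
qed measurable

lemma op_integrable:
  fixes f :: "'a \<Rightarrow> 'k::{real_normed_field,euclidean_space}"
  assumes "f \<in> borel_measurable borel" "(\<integral>\<^sup>+y. ennreal ((norm (f y))\<^sup>2) \<partial>lborel) < \<infinity>"
  shows "integrable lborel (op f)" "AE x in lborel. integrable lborel (\<lambda>y. g (x, y) *\<^sub>R f y)"
  using lborel_pair.integrable_fst[OF product_integrable[OF assms]]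
    lborel_pair.AE_integrable_fst[OF product_integrable[OF assms]]
  by (simp_all add: op_def[abs_def])

lemma nn_integral_op:
  fixes f :: "'a \<Rightarrow> 'k::{real_normed_field,euclidean_space}"
  assumes [measurable]: "f \<in> borel_measurable borel"
  shows "(\<integral>\<^sup>+x. ennreal ((norm (op f x))\<^sup>2) \<partial>lborel) \<le> kernel_sq * (\<integral>\<^sup>+y. ennreal ((norm (f y))\<^sup>2) \<partial>lborel)"
proof -
  have "ennreal ((norm (op f x))\<^sup>2) \<le> (\<integral>\<^sup>+y. ennreal ((norm (g (x, y)))\<^sup>2) \<partial>lborel) * (\<integral>\<^sup>+y. ennreal ((norm (f y))\<^sup>2) \<partial>lborel)" for x
  proof -
    have "ennreal (norm (op f x)) \<le> (\<integral>\<^sup>+y. ennreal (norm (g (x, y) *\<^sub>R f y)) \<partial>lborel)"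
      unfolding op_def
    proof (cases "integrable lborel (\<lambda>y. g (x, y) *\<^sub>R f y)")
      case True
      from integral_norm_bound_ennreal[OF this]
      show "ennreal (norm (LINT y|lborel. g (x, y) *\<^sub>R f y)) \<le> (\<integral>\<^sup>+y. ennreal (norm (g (x, y) *\<^sub>R f y)) \<partial>lborel)" .
    qed (simp add: not_integrable_integral_eq)
    also have "\<dots> = (\<integral>\<^sup>+y. ennreal (norm (g (x, y))) * ennreal (norm (f y)) \<partial>lborel)"
      by (simp add: ennreal_mult)
    finally have "(ennreal (norm (op f x)))\<^sup>2 \<le> (\<integral>\<^sup>+y. ennreal (norm (g (x, y))) * ennreal (norm (f y)) \<partial>lborel)\<^sup>2"
      by (intro power_mono) auto
    also have "\<dots> \<le> (\<integral>\<^sup>+y. (ennreal (norm (g (x, y))))\<^sup>2 \<partial>lborel) * (\<integral>\<^sup>+y. (ennreal (norm (f y)))\<^sup>2 \<partial>lborel)"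
      by (intro Cauchy_Schwarz_nn_integral) measurable
    finally show ?thesis
      by (simp add: ennreal_power)
  qed
  then have "(\<integral>\<^sup>+x. ennreal ((norm (op f x))\<^sup>2) \<partial>lborel)
      \<le> (\<integral>\<^sup>+x. (\<integral>\<^sup>+y. ennreal ((norm (g (x, y)))\<^sup>2) \<partial>lborel) * (\<integral>\<^sup>+y. ennreal ((norm (f y))\<^sup>2) \<partial>lborel) \<partial>lborel)"
    by (rule nn_integral_mono)
  also have "\<dots> = kernel_sq * (\<integral>\<^sup>+y. ennreal ((norm (f y))\<^sup>2) \<partial>lborel)"
    unfolding kernel_sq_eq by (rule nn_integral_multc) measurable
  finally show ?thesis .
qed

lemma op_L2:
  fixes f :: "'a \<Rightarrow> 'k::{real_normed_field,euclidean_space}"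
  assumes f: "f \<in> borel_measurable borel" and "(\<integral>\<^sup>+y. ennreal ((norm (f y))\<^sup>2) \<partial>lborel) < \<infinity>"
  shows "op f \<in> L2 \<Omega>"
proof -
  have "L2_sq \<Omega> (op f) = (\<integral>\<^sup>+x. ennreal ((norm (op f x))\<^sup>2) \<partial>lborel)"
    by (rule L2_sq_lborel) (rule op_eq_0)
  then have "L2_sq \<Omega> (op f) < \<infinity>"
    using nn_integral_op[OF f] kernel_sq_finite assms(2)
    by (auto intro: le_less_trans simp: ennreal_mult_less_top)
  then show ?thesis
    using \<Omega>(1) f by (simp add: L2_iff borel_measurable_lebesgue_onI op_measurable)
qed

text \<open>The transposed operator applied to a test function.\<close>

definition test_op :: "('a \<Rightarrow> real) \<Rightarrow> 'a \<Rightarrow> real" where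
  "test_op \<phi> y = (LINT x|lborel. \<phi> x * g (x, y))"

lemma test_product_integrable:
  fixes f :: "'a \<Rightarrow> 'k::{real_normed_field,euclidean_space}"
  assumes \<phi>: "\<phi> \<in> test_functions A"
    and f[measurable]: "f \<in> borel_measurable borel" and f2: "(\<integral>\<^sup>+y. ennreal ((norm (f y))\<^sup>2) \<partial>lborel) < \<infinity>"
  shows "integrable (lborel \<Otimes>\<^sub>M lborel) (\<lambda>(x, y). (\<phi> x * g (x, y)) *\<^sub>R f y)"
proof -
  note [measurable] = test_functions_measurable[OF \<phi>]
  obtain B where B: "B \<ge> 0" "\<And>x. \<bar>\<phi> x\<bar> \<le> B"
    using test_functions_bounded[OF \<phi>] by blast
  have "integrable (lborel \<Otimes>\<^sub>M lborel) (\<lambda>z. B *\<^sub>R (case z of (x, y) \<Rightarrow> g (x, y) *\<^sub>R f y))"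
    by (intro integrable_scaleR_right product_integrable f f2)
  then show ?thesis
  proof (rule Bochner_Integration.integrable_bound)
    show "AE z in lborel \<Otimes>\<^sub>M lborel. norm (case z of (x, y) \<Rightarrow> (\<phi> x * g (x, y)) *\<^sub>R f y)
        \<le> norm (B *\<^sub>R (case z of (x, y) \<Rightarrow> g (x, y) *\<^sub>R f y))"
      using B by (intro AE_I2) (auto simp: abs_mult mult.assoc intro!: mult_right_mono)
  qed measurable
qed

text \<open>The product estimate with the indicator of \<open>\<Omega>\<close> for \<open>f\<close>,
  which changes nothing since \<open>g\<close> vanishes elsewhere.\<close>

lemma test_op_integrable:
  assumes \<phi>: "\<phi> \<in> test_functions A"
  shows "integrable lborel (test_op \<phi>)" "AE y in lborel. integrable lborel (\<lambda>x. \<phi> x * g (x, y))"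
proof -
  have [measurable]: "\<Omega> \<in> sets borel" using \<Omega>(1) by simp
  have "(\<integral>\<^sup>+y. ennreal ((norm (indicator \<Omega> y :: real))\<^sup>2) \<partial>lborel) = (\<integral>\<^sup>+y. indicator \<Omega> y \<partial>lborel)"
    by (intro nn_integral_cong) (auto simp: indicator_def)
  then have "(\<integral>\<^sup>+y. ennreal ((norm (indicator \<Omega> y :: real))\<^sup>2) \<partial>lborel) < \<infinity>"
    using emeasure_bounded_finite[OF \<Omega>(2)] by simp
  then have "integrable (lborel \<Otimes>\<^sub>M lborel) (\<lambda>(x, y). (\<phi> x * g (x, y)) *\<^sub>R (indicator \<Omega> y :: real))"
    by (intro test_product_integrable[OF \<phi>]) auto
  moreover have "(\<lambda>(x, y). (\<phi> x * g (x, y)) *\<^sub>R (indicator \<Omega> y :: real)) = (\<lambda>(x, y). \<phi> x * g (x, y))"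
    using g(2) by (auto simp: indicator_def fun_eq_iff)
  ultimately have *: "integrable (lborel \<Otimes>\<^sub>M lborel) (\<lambda>(x, y). \<phi> x * g (x, y))" by simp
  show "integrable lborel (test_op \<phi>)" "AE y in lborel. integrable lborel (\<lambda>x. \<phi> x * g (x, y))"
    using lborel_pair.integrable_snd[OF *] lborel_pair.AE_integrable_snd[OF *]
    by (simp_all add: test_op_def[abs_def])
qed

lemma integral_test_op:
  fixes f :: "'a \<Rightarrow> 'k::{real_normed_field,euclidean_space}"
  assumes \<phi>: "\<phi> \<in> test_functions A"
    and f[measurable]: "f \<in> borel_measurable borel" and f2: "(\<integral>\<^sup>+y. ennreal ((norm (f y))\<^sup>2) \<partial>lborel) < \<infinity>"
  shows "integrable lborel (\<lambda>y. test_op \<phi> y *\<^sub>R f y)"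
    and "(LINT y|lborel. test_op \<phi> y *\<^sub>R f y) = (LINT x|lborel. \<phi> x *\<^sub>R op f x)"
proof -
  note [measurable] = test_functions_measurable[OF \<phi>]
  note int = test_product_integrable[OF \<phi> f f2]
  have meas[measurable]: "test_op \<phi> \<in> borel_measurable borel"
    using borel_measurable_integrable[OF test_op_integrable(1)[OF \<phi>]] by simp
  have eq: "AE y in lborel. (LINT x|lborel. (\<phi> x * g (x, y)) *\<^sub>R f y) = test_op \<phi> y *\<^sub>R f y"
    using test_op_integrable(2)[OF \<phi>] by eventually_elim (simp add: test_op_def)
  have int_snd: "integrable lborel (\<lambda>y. LINT x|lborel. (\<phi> x * g (x, y)) *\<^sub>R f y)"
    using lborel_pair.integrable_snd[OF int] by simp
  show "integrable lborel (\<lambda>y. test_op \<phi> y *\<^sub>R f y)"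
    by (rule integrable_cong_AE_imp[OF int_snd _ eq]) measurable
  have "(LINT y|lborel. test_op \<phi> y *\<^sub>R f y) = (LINT y|lborel. LINT x|lborel. (\<phi> x * g (x, y)) *\<^sub>R f y)"
    using eq by (intro integral_cong_AE) (auto elim: eventually_mono)
  also have "\<dots> = (LINT x|lborel. LINT y|lborel. (\<phi> x * g (x, y)) *\<^sub>R f y)"
    by (rule lborel_pair.Fubini_integral[OF int])
  also have "\<dots> = (LINT x|lborel. \<phi> x *\<^sub>R op f x)"
    by (simp add: op_def flip: scaleR_scaleR)
  finally show "(LINT y|lborel. test_op \<phi> y *\<^sub>R f y) = (LINT x|lborel. \<phi> x *\<^sub>R op f x)" .
qed

lemma test_function_L2:
  fixes \<psi> :: "'a \<Rightarrow> real"
  assumes \<psi>: "\<psi> \<in> test_functions A"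
  shows "(\<integral>\<^sup>+y. ennreal ((norm (\<psi> y))\<^sup>2) \<partial>lborel) < \<infinity>"
proof -
  obtain K where K: "compact K" "K \<subseteq> A" "\<And>x. x \<notin> K \<Longrightarrow> \<psi> x = 0"
    using test_functions_support[OF \<psi>] by blast
  obtain B where B: "B \<ge> 0" "\<And>x. \<bar>\<psi> x\<bar> \<le> B"
    using test_functions_bounded[OF \<psi>] by blast
  have "(\<integral>\<^sup>+y. ennreal ((norm (\<psi> y))\<^sup>2) \<partial>lborel) \<le> (\<integral>\<^sup>+y. ennreal (B\<^sup>2) * indicator K y \<partial>lborel)"
  proof (rule nn_integral_mono)
    fix y
    have "(norm (\<psi> y))\<^sup>2 \<le> B\<^sup>2"
      using B by (intro power_mono) auto
    then show "ennreal ((norm (\<psi> y))\<^sup>2) \<le> ennreal (B\<^sup>2) * indicator K y"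
      using K(3)[of y] by (auto simp: indicator_def intro: ennreal_leI simp del: power2_abs real_norm_def)
  qed
  also have "\<dots> = ennreal (B\<^sup>2) * emeasure lborel K"
    using K(1) by (intro nn_integral_cmult_indicator) (auto dest: compact_imp_closed)
  also have "\<dots> < \<infinity>"
    using emeasure_compact_finite[OF K(1)] by (simp add: ennreal_mult_less_top)
  finally show ?thesis .
qed

text \<open>Turns the weak derivative identity on the product domain into one for functions of
  \<open>y\<close> alone, ready for the fundamental lemma.\<close>

lemma integral_tensor:
  assumes \<phi>: "\<phi> \<in> test_functions A" and \<psi>: "\<psi> \<in> test_functions B"
  shows "(LINT z:\<Omega> \<times> \<Omega>|lebesgue. (case z of (x, y) \<Rightarrow> \<phi> x * \<psi> y) *\<^sub>R g z) = (LINT y|lborel. test_op \<phi> y *\<^sub>R \<psi> y)"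
proof -
  note [measurable] = test_functions_measurable[OF \<phi>] test_functions_measurable[OF \<psi>]
  have "(\<lambda>(x, y). \<phi> x * \<psi> y) \<in> borel_measurable (borel \<Otimes>\<^sub>M borel)"
    by measurable
  then have "(LINT z:\<Omega> \<times> \<Omega>|lebesgue. (case z of (x, y) \<Rightarrow> \<phi> x * \<psi> y) *\<^sub>R g z)
      = (LINT z|lborel. (case z of (x, y) \<Rightarrow> \<phi> x * \<psi> y) *\<^sub>R g z)"
    using g by (intro set_integral_lborel) (auto simp: borel_prod)
  also have "\<dots> = integral\<^sup>L (lborel \<Otimes>\<^sub>M lborel) (\<lambda>(x, y). (\<phi> x * g (x, y)) *\<^sub>R \<psi> y)"
    unfolding lborel_prod by (intro Bochner_Integration.integral_cong) auto
  also have "\<dots> = (LINT x|lborel. LINT y|lborel. (\<phi> x * g (x, y)) *\<^sub>R \<psi> y)"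
    by (rule lborel_pair.integral_fst[symmetric])
      (rule test_product_integrable[OF \<phi> _ test_function_L2[OF \<psi>]], measurable)
  also have "\<dots> = (LINT x|lborel. \<phi> x *\<^sub>R op \<psi> x)"
    by (simp add: op_def mult.assoc)
  also have "\<dots> = (LINT y|lborel. test_op \<phi> y *\<^sub>R \<psi> y)"
    by (rule integral_test_op(2)[OF \<phi> _ test_function_L2[OF \<psi>], symmetric]) measurable
  finally show ?thesis .
qed

end

lemma mi_order_first_arg: "mi_order (first_arg \<alpha> :: 'a::euclidean_space \<times> 'b::euclidean_space \<Rightarrow> nat) = mi_order \<alpha>"
proof -
  have "mi_order (first_arg \<alpha> :: 'a \<times> 'b \<Rightarrow> nat)
      = (\<Sum>i\<in>(\<lambda>u::'a. (u, 0::'b)) ` Basis. first_arg \<alpha> i) + (\<Sum>i\<in>(\<lambda>v::'b. (0::'a, v)) ` Basis. first_arg \<alpha> i)"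
    unfolding mi_order_def Basis_prod_def by (rule sum.union_disjoint) auto
  also have "(\<Sum>i\<in>(\<lambda>v::'b. (0::'a, v)) ` Basis. first_arg \<alpha> i) = 0"
    by (intro sum.neutral) (auto simp: first_arg_def)
  also have "(\<Sum>i\<in>(\<lambda>u::'a. (u, 0::'b)) ` Basis. first_arg \<alpha> i) = mi_order \<alpha>"
    unfolding mi_order_def by (subst sum.reindex) (auto simp: inj_on_def first_arg_def)
  finally show ?thesis by simp
qed

text \<open>
  Tensor products \<open>\<phi> \<otimes> \<psi>\<close> are only available for smooth \<open>\<psi>\<close>. Testing with all of them shows that
  the function \<open>d\<close> of the second variable left after integrating against \<open>\<phi>\<close> vanishes almost
  everywhere, and then \<open>\<psi>\<close> may be replaced by the square integrable \<open>f\<close>.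
\<close>

lemma has_weak_deriv_op:
  fixes f :: "'a::euclidean_space \<Rightarrow> 'k::{real_normed_field,euclidean_space}"
  assumes g: "L2_kernel \<Omega> g" and h: "L2_kernel \<Omega> h"
    and deriv: "has_weak_deriv (\<Omega> \<times> \<Omega>) (first_arg \<alpha>) g h"
    and f: "f \<in> borel_measurable borel" "(\<integral>\<^sup>+y. ennreal ((norm (f y))\<^sup>2) \<partial>lborel) < \<infinity>" "\<And>x. x \<notin> \<Omega> \<Longrightarrow> f x = 0"
  shows "has_weak_deriv \<Omega> \<alpha> (L2_kernel.op g f) (L2_kernel.op h f)"
proof -
  interpret g: L2_kernel \<Omega> g by fact
  interpret h: L2_kernel \<Omega> h by fact
  note \<Omega> = g.\<Omega>
  define c :: real where "c = (-1) ^ mi_order \<alpha>"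
  have "(LINT x:\<Omega>|lebesgue. multi_deriv \<alpha> \<phi> x *\<^sub>R g.op f x) = (-1) ^ mi_order \<alpha> * (LINT x:\<Omega>|lebesgue. \<phi> x *\<^sub>R h.op f x)"
    if \<phi>: "\<phi> \<in> test_functions \<Omega>" for \<phi>
  proof -
    let ?a = "multi_deriv \<alpha> \<phi>"
    note a = test_functions_multi_deriv[OF \<phi>, of \<alpha>]
    define d where "d y = g.test_op ?a y - c * h.test_op \<phi> y" for y
    have d: "integrable lborel d"
      unfolding d_def using g.test_op_integrable(1)[OF a] h.test_op_integrable(1)[OF \<phi>] by simp
    have "AE y in lebesgue. y \<in> \<Omega> \<longrightarrow> d y = 0"
    proof (rule locally_integrable_AE_zero[OF \<Omega>(1)])
      have "integrable lebesgue d"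
        using d by (simp add: integrable_completion)
      then show "locally_integrable \<Omega> d"
        unfolding locally_integrable_def set_integrable_def
        by (auto intro!: integrable_mult_indicator[where 'b = real, simplified] dest: compact_imp_closed)
      fix \<psi> assume \<psi>: "\<psi> \<in> test_functions \<Omega>"
      note m = test_functions_measurable[OF \<psi>] g.test_function_L2[OF \<psi>]
      have "(LINT z:\<Omega> \<times> \<Omega>|lebesgue. multi_deriv (first_arg \<alpha>) (\<lambda>(x, y). \<phi> x * \<psi> y) z *\<^sub>R g z)
          = c * (LINT z:\<Omega> \<times> \<Omega>|lebesgue. (\<lambda>(x, y). \<phi> x * \<psi> y) z *\<^sub>R h z)"
        using deriv test_functions_tensor[OF \<phi> \<psi>]
        unfolding has_weak_deriv_def mi_order_first_arg c_def by blast
      then have "(LINT z:\<Omega> \<times> \<Omega>|lebesgue. (case z of (x, y) \<Rightarrow> ?a x * \<psi> y) *\<^sub>R g z)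
          = c * (LINT z:\<Omega> \<times> \<Omega>|lebesgue. (case z of (x, y) \<Rightarrow> \<phi> x * \<psi> y) *\<^sub>R h z)"
        using multi_deriv_tensor[OF test_functions_smooth[OF \<phi>] test_functions_smooth[OF \<psi>]] by simp
      then have "(LINT y|lborel. g.test_op ?a y *\<^sub>R \<psi> y) = c * (LINT y|lborel. h.test_op \<phi> y *\<^sub>R \<psi> y)"
        unfolding g.integral_tensor[OF a \<psi>] h.integral_tensor[OF \<phi> \<psi>] .
      then have "(LINT y|lborel. \<psi> y *\<^sub>R d y) = 0"
        using g.integral_test_op(1)[OF a m] h.integral_test_op(1)[OF \<phi> m]
        by (simp add: d_def algebra_simps)
      moreover have "(LINT y:\<Omega>|lebesgue. \<psi> y *\<^sub>R d y) = (LINT y|lborel. \<psi> y *\<^sub>R d y)"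
      proof (rule set_integral_lborel)
        show "d y = 0 \<or> \<psi> y = 0" if "y \<notin> \<Omega>" for y
          using that test_functions_support[OF \<psi>] by (metis subsetD)
      qed (use d m in auto)
      ultimately show "(LINT y:\<Omega>|lebesgue. \<psi> y *\<^sub>R d y) = 0" by simp
    qed
    \<comment> \<open>The fundamental lemma speaks about \<open>\<Omega>\<close> only; elsewhere
      \<open>f\<close> is zero.\<close>
    then have "AE y in lborel. d y *\<^sub>R f y = 0"
      unfolding AE_completion_iff by eventually_elim (use f(3) in auto)
    then have "(LINT y|lborel. d y *\<^sub>R f y) = 0"
      by (simp add: integral_eq_zero_AE)
    moreover have "(LINT y|lborel. d y *\<^sub>R f y)
        = (LINT y|lborel. g.test_op ?a y *\<^sub>R f y) - c *\<^sub>R (LINT y|lborel. h.test_op \<phi> y *\<^sub>R f y)"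
      using g.integral_test_op(1)[OF a f(1,2)] h.integral_test_op(1)[OF \<phi> f(1,2)]
      by (simp add: d_def scaleR_diff_left flip: scaleR_scaleR)
    ultimately have "(LINT x|lborel. ?a x *\<^sub>R g.op f x) = c *\<^sub>R (LINT x|lborel. \<phi> x *\<^sub>R h.op f x)"
      unfolding g.integral_test_op(2)[OF a f(1,2)] h.integral_test_op(2)[OF \<phi> f(1,2)] by simp
    moreover have "(LINT x:\<Omega>|lebesgue. ?a x *\<^sub>R g.op f x) = (LINT x|lborel. ?a x *\<^sub>R g.op f x)"
      using g.op_measurable[OF f(1)] test_functions_measurable[OF a] g.op_eq_0
      by (intro set_integral_lborel) auto
    moreover have "(LINT x:\<Omega>|lebesgue. \<phi> x *\<^sub>R h.op f x) = (LINT x|lborel. \<phi> x *\<^sub>R h.op f x)"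
      using h.op_measurable[OF f(1)] test_functions_measurable[OF \<phi>] h.op_eq_0
      by (intro set_integral_lborel) auto
    \<comment> \<open>The sign occurs both as a real scalar and as an element of the field
      \<open>'k\<close>.\<close>
    moreover have "c *\<^sub>R y = (-1) ^ mi_order \<alpha> * y" for y :: 'k
      unfolding c_def by (cases "even (mi_order \<alpha>)") auto
    ultimately show ?thesis by simp
  qed
  moreover have "locally_integrable \<Omega> (g.op f)" "locally_integrable \<Omega> (h.op f)"
    using g.op_L2[OF f(1,2)] h.op_L2[OF f(1,2)] \<Omega>(1) by (auto intro!: L2_locally_integrable)
  ultimately show ?thesis
    by (simp add: has_weak_deriv_def)
qed

lemma ex_L2_kernel:
  fixes p :: "'a::euclidean_space \<times> 'a \<Rightarrow> real"
  assumes \<Omega>: "open \<Omega>" "bounded \<Omega>" and "g \<in> L2 (\<Omega> \<times> \<Omega>)" "has_weak_deriv (\<Omega> \<times> \<Omega>) \<alpha> p g"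
  obtains h where "L2_kernel \<Omega> h" "has_weak_deriv (\<Omega> \<times> \<Omega>) \<alpha> p h"
proof -
  have op: "open (\<Omega> \<times> \<Omega>)" using \<Omega>(1) by (simp add: open_Times)
  have g: "g \<in> borel_measurable (lebesgue_on (\<Omega> \<times> \<Omega>))" "L2_sq (\<Omega> \<times> \<Omega>) g < \<infinity>"
    using assms(3) op L2_iff[of "\<Omega> \<times> \<Omega>" g] by auto
  obtain h where h: "h \<in> borel_measurable borel" "\<And>z. z \<notin> \<Omega> \<times> \<Omega> \<Longrightarrow> h z = 0"
    "AE z in lebesgue. z \<in> \<Omega> \<times> \<Omega> \<longrightarrow> g z = h z"
    using ex_borel_representative[OF op g(1)] by blast
  show thesis
  proof
    have "(\<integral>\<^sup>+z. ennreal ((norm (h z))\<^sup>2) \<partial>lborel) = L2_sq (\<Omega> \<times> \<Omega>) h"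
      by (rule L2_sq_lborel[symmetric]) (rule h(2))
    also have "\<dots> < \<infinity>"
      using g(2) L2_sq_cong_AE[OF h(3)] by simp
    finally show "L2_kernel \<Omega> h"
      by unfold_locales (use \<Omega> h(1,2) in auto)
    show "has_weak_deriv (\<Omega> \<times> \<Omega>) \<alpha> p h"
      by (rule has_weak_deriv_cong_AE[OF assms(4) _ h(3)]) simp
  qed
qed

subsection \<open>The Koopman operator of a kernel with density\<close>

lemma slobodeckij_cong_AE:
  assumes "AE x in lebesgue. x \<in> \<Omega> \<longrightarrow> u x = v x"
  shows "slobodeckij \<Omega> r u = slobodeckij \<Omega> r v"
  unfolding slobodeckij_def
proof (rule nn_integral_cong_AE)
  let ?F = "\<lambda>u x y. ennreal ((norm (u x - u y))\<^sup>2 / norm (x - y) powr (real DIM('a) + 2 * r)) * indicator \<Omega> y"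
  show "AE x in lebesgue. (\<integral>\<^sup>+y. ?F u x y \<partial>lebesgue) * indicator \<Omega> x = (\<integral>\<^sup>+y. ?F v x y \<partial>lebesgue) * indicator \<Omega> x"
    using assms
  proof eventually_elim
    fix x assume x: "x \<in> \<Omega> \<longrightarrow> u x = v x"
    have "(\<integral>\<^sup>+y. ?F u x y \<partial>lebesgue) = (\<integral>\<^sup>+y. ?F v x y \<partial>lebesgue)" if "x \<in> \<Omega>"
      by (intro nn_integral_cong_AE) (use assms in \<open>eventually_elim, use x that in \<open>auto simp: indicator_def\<close>\<close>)
    then show "(\<integral>\<^sup>+y. ?F u x y \<partial>lebesgue) * indicator \<Omega> x = (\<integral>\<^sup>+y. ?F v x y \<partial>lebesgue) * indicator \<Omega> x"
      by (auto simp: indicator_def)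
  qed
qed

definition ext_zero :: "'a set \<Rightarrow> ('a \<Rightarrow> 'k::real_normed_vector) \<Rightarrow> 'a \<Rightarrow> 'k" where
  "ext_zero \<Omega> f x = indicator \<Omega> x *\<^sub>R f x"

lemma ext_zero_eq_0: "x \<notin> \<Omega> \<Longrightarrow> ext_zero \<Omega> f x = 0"
  by (simp add: ext_zero_def)

lemma nn_integral_ext_zero:
  "(\<integral>\<^sup>+y. ennreal ((norm (ext_zero \<Omega> f y))\<^sup>2) \<partial>lborel) = L2_sq \<Omega> f"
proof -
  have "L2_sq \<Omega> (ext_zero \<Omega> f) = L2_sq \<Omega> f"
    by (intro L2_sq_cong_AE AE_I2) (simp add: ext_zero_def)
  then show ?thesis
    using L2_sq_lborel[of \<Omega> "ext_zero \<Omega> f"] by (simp add: ext_zero_eq_0)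
qed

lemma has_weak_deriv_weak_deriv: "has_weak_deriv \<Omega> \<alpha> f g \<Longrightarrow> has_weak_deriv \<Omega> \<alpha> f (weak_deriv \<Omega> \<alpha> f)"
  unfolding weak_deriv_def by (rule someI[of "has_weak_deriv \<Omega> \<alpha> f"])

text \<open>The \<open>g \<alpha>\<close> are Borel representatives of the derivatives of
  \<open>p\<close>. Since \<open>p\<close> is not assumed to be Borel on the product,
  \<open>g (\<lambda>_. 0)\<close> stands in for it whenever an integral operator is formed.\<close>

locale koopman_density =
  fixes \<Omega> :: "'a::euclidean_space set" and \<rho> :: "'a \<Rightarrow> 'a measure" and p :: "'a \<times> 'a \<Rightarrow> real"
    and g :: "('a \<Rightarrow> nat) \<Rightarrow> 'a \<times> 'a \<Rightarrow> real" and l :: nat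
  assumes domain: "bounded_lipschitz_domain \<Omega>"
    and kernel: "markov_kernel \<Omega> \<rho>"
    and p_nonneg: "\<And>x y. x \<in> \<Omega> \<Longrightarrow> y \<in> \<Omega> \<Longrightarrow> 0 \<le> p (x, y)"
    and p_measurable: "\<And>x. x \<in> \<Omega> \<Longrightarrow> (\<lambda>y. p (x, y)) \<in> borel_measurable (lebesgue_on \<Omega>)"
    and p_density: "\<And>x \<Delta>. x \<in> \<Omega> \<Longrightarrow> \<Delta> \<in> sets borel \<Longrightarrow> \<Delta> \<subseteq> \<Omega> \<Longrightarrow>
      emeasure (\<rho> x) \<Delta> = (\<integral>\<^sup>+y\<in>\<Delta>. ennreal (p (x, y)) \<partial>lebesgue)"
    and g_kernel: "\<And>\<alpha>. \<alpha> \<in> multi_indices \<Longrightarrow> mi_order \<alpha> \<le> l \<Longrightarrow> L2_kernel \<Omega> (g \<alpha>)"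
    and g_deriv: "\<And>\<alpha>. \<alpha> \<in> multi_indices \<Longrightarrow> mi_order \<alpha> \<le> l \<Longrightarrow> has_weak_deriv (\<Omega> \<times> \<Omega>) (first_arg \<alpha>) p (g \<alpha>)"
begin

lemma open_\<Omega>: "open \<Omega>" and bounded_\<Omega>: "bounded \<Omega>"
  using domain by (auto simp: bounded_lipschitz_domain_def)

lemma sets_\<Omega> [measurable]: "\<Omega> \<in> sets borel" "\<Omega> \<in> sets lebesgue"
  using open_\<Omega> by auto

lemma id_measurable: "(\<lambda>y. y) \<in> lebesgue_on \<Omega> \<rightarrow>\<^sub>M restrict_space borel \<Omega>"
  by (rule measurable_restrict_space2) (auto intro: borel_measurable_lebesgue_onI)

text \<open>The density refers to completed Lebesgue measure but \<open>\<rho> x\<close> lives on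
  Borel sets; the pushforward under the identity only shrinks the sigma-algebra.\<close>

lemma rho_eq:
  assumes x: "x \<in> \<Omega>"
  shows "\<rho> x = distr (density (lebesgue_on \<Omega>) (\<lambda>y. ennreal (p (x, y)))) (restrict_space borel \<Omega>) (\<lambda>y. y)"
    (is "_ = distr ?N ?R _")
proof (rule measure_eqI)
  have id: "(\<lambda>y. y) \<in> ?N \<rightarrow>\<^sub>M ?R"
    using id_measurable by simp
  have "x \<in> space ?R"
    using x by (simp add: space_restrict_space)
  then have "\<rho> x \<in> space (prob_algebra ?R)"
    by (rule measurable_space[OF kernel])
  then have sets: "sets (\<rho> x) = sets ?R"
    by (simp add: space_prob_algebra)
  then show "sets (\<rho> x) = sets (distr ?N ?R (\<lambda>y. y))" by simp
  fix A assume "A \<in> sets (\<rho> x)"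
  then have A: "A \<in> sets ?R" "A \<in> sets borel" "A \<subseteq> \<Omega>"
    using sets sets_\<Omega>(1) by (auto simp: sets_restrict_space)
  have "A \<in> sets lebesgue" using A(2) by simp
  then have A': "A \<in> sets (lebesgue_on \<Omega>)"
    using A(3) by (auto simp: sets_restrict_space)
  have "emeasure (distr ?N ?R (\<lambda>y. y)) A = emeasure ?N A"
    using A(3) by (subst emeasure_distr[OF id A(1)]) (simp add: Int_absorb2)
  also have "\<dots> = (\<integral>\<^sup>+y. ennreal (p (x, y)) * indicator A y \<partial>lebesgue_on \<Omega>)"
    using p_measurable[OF x] A' by (intro emeasure_density) auto
  also have "\<dots> = (\<integral>\<^sup>+y\<in>A. ennreal (p (x, y)) \<partial>lebesgue)"
    using A(3) by (subst nn_integral_restrict_space) (auto intro!: nn_integral_cong simp: indicator_def)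
  finally show "emeasure (\<rho> x) A = emeasure (distr ?N ?R (\<lambda>y. y)) A"
    using p_density[OF x A(2,3)] by simp
qed

lemma integral_rho:
  fixes f :: "'a \<Rightarrow> 'k::{real_normed_field,euclidean_space}"
  assumes x: "x \<in> \<Omega>" and f: "f \<in> borel_measurable (restrict_space borel \<Omega>)"
  shows "integrable (\<rho> x) f \<longleftrightarrow> set_integrable lebesgue \<Omega> (\<lambda>y. p (x, y) *\<^sub>R f y)"
    and "integral\<^sup>L (\<rho> x) f = (LINT y:\<Omega>|lebesgue. p (x, y) *\<^sub>R f y)"
proof -
  let ?N = "density (lebesgue_on \<Omega>) (\<lambda>y. ennreal (p (x, y)))"
  let ?R = "restrict_space borel \<Omega>"
  note id0 = id_measurable
  then have id: "(\<lambda>y. y) \<in> ?N \<rightarrow>\<^sub>M ?R" by simp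
  have f': "f \<in> borel_measurable (lebesgue_on \<Omega>)"
    using measurable_compose[OF id0 f] .
  have nn: "AE y in lebesgue_on \<Omega>. 0 \<le> p (x, y)"
    using p_nonneg[OF x] by (intro AE_I2) simp
  have "integrable (\<rho> x) f \<longleftrightarrow> integrable ?N f"
    unfolding rho_eq[OF x] by (rule integrable_distr_eq[OF id f])
  also have "\<dots> \<longleftrightarrow> integrable (lebesgue_on \<Omega>) (\<lambda>y. p (x, y) *\<^sub>R f y)"
    by (rule integrable_density[OF f' p_measurable[OF x] nn])
  finally show "integrable (\<rho> x) f \<longleftrightarrow> set_integrable lebesgue \<Omega> (\<lambda>y. p (x, y) *\<^sub>R f y)"
    by (simp add: integrable_restrict_space set_integrable_def)
  have "integral\<^sup>L (\<rho> x) f = integral\<^sup>L ?N f"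
    unfolding rho_eq[OF x] by (rule integral_distr[OF id f])
  also have "\<dots> = integral\<^sup>L (lebesgue_on \<Omega>) (\<lambda>y. p (x, y) *\<^sub>R f y)"
    by (rule integral_density[OF f' p_measurable[OF x] nn])
  finally show "integral\<^sup>L (\<rho> x) f = (LINT y:\<Omega>|lebesgue. p (x, y) *\<^sub>R f y)"
    by (simp add: integral_restrict_space set_lebesgue_integral_def)
qed

text \<open>\<open>sobolev\<close> asks for a Borel function on all of \<open>\<Omega>\<close>; this
  comes from the measurability of the kernel \<rho>, since the density formula is available only for
  almost every \<open>x\<close>.\<close>

lemma koopman_measurable:
  fixes f :: "'a \<Rightarrow> 'k::{real_normed_field,euclidean_space}"
  assumes f: "f \<in> borel_measurable (restrict_space borel \<Omega>)"
  shows "koopman \<rho> f \<in> borel_measurable (restrict_space borel \<Omega>)"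
proof -
  have "(\<lambda>M. integral\<^sup>L M f) \<in> borel_measurable (subprob_algebra (restrict_space borel \<Omega>))"
    using f by (rule integral_measurable_subprob_algebra)
  moreover have "\<rho> \<in> restrict_space borel \<Omega> \<rightarrow>\<^sub>M subprob_algebra (restrict_space borel \<Omega>)"
    using kernel by (rule measurable_prob_algebraD)
  ultimately show ?thesis
    unfolding koopman_def[abs_def] using measurable_compose by blast
qed

abbreviation g0 :: "'a \<times> 'a \<Rightarrow> real" where "g0 \<equiv> g (\<lambda>_. 0)"

lemma zero_index: "(\<lambda>_::'a. 0) \<in> multi_indices" "mi_order (\<lambda>_::'a. 0) = 0"
  by (simp_all add: multi_indices_def mi_order_def)

lemma g0_kernel: "L2_kernel \<Omega> g0"
  using g_kernel zero_index by simp

lemma p_AE_eq_g0: "AE z in lebesgue. z \<in> \<Omega> \<times> \<Omega> \<longrightarrow> p z = g0 z"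
proof (rule has_weak_deriv_zero_AE_eq)
  show "open (\<Omega> \<times> \<Omega>)" using open_\<Omega> by (simp add: open_Times)
  have "first_arg (\<lambda>_. 0) = (\<lambda>_ :: 'a \<times> 'a. 0)"
    by (auto simp: first_arg_def)
  then show "has_weak_deriv (\<Omega> \<times> \<Omega>) (\<lambda>_. 0) p g0"
    using g_deriv[OF zero_index(1)] zero_index(2) by simp
qed

lemma ext_zero_measurable:
  fixes f :: "'a \<Rightarrow> 'k::{real_normed_field,euclidean_space}"
  assumes "f \<in> borel_measurable (restrict_space borel \<Omega>)"
  shows "ext_zero \<Omega> f \<in> borel_measurable borel"
  using assms unfolding ext_zero_def[abs_def] by (simp add: borel_measurable_restrict_space_iff)

text \<open>\<open>p\<close> and \<open>g0\<close> agree almost everywhere on the product, so by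
  Fubini almost every section in \<open>y\<close> agrees almost everywhere. The exceptional
  \<open>x\<close> cannot be avoided: there \<open>f\<close> may fail to be integrable.\<close>

lemma koopman_AE:
  fixes f :: "'a \<Rightarrow> 'k::{real_normed_field,euclidean_space}"
  assumes f: "f \<in> borel_measurable (restrict_space borel \<Omega>)" and f2: "L2_sq \<Omega> f < \<infinity>"
  shows "AE x in lebesgue. x \<in> \<Omega> \<longrightarrow>
    integrable (\<rho> x) f \<and> koopman \<rho> f x = L2_kernel.op g0 (ext_zero \<Omega> f) x"
proof -
  interpret g0: L2_kernel \<Omega> g0 by (rule g0_kernel)
  note f' = ext_zero_measurable[OF f]
  have f2': "(\<integral>\<^sup>+y. ennreal ((norm (ext_zero \<Omega> f y))\<^sup>2) \<partial>lborel) < \<infinity>"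
    using f2 by (simp add: nn_integral_ext_zero)
  have "AE z in lborel \<Otimes>\<^sub>M lborel. z \<in> \<Omega> \<times> \<Omega> \<longrightarrow> p z = g0 z"
    using p_AE_eq_g0 unfolding AE_completion_iff lborel_prod .
  then have "AE x in lborel. AE y in lborel. (x, y) \<in> \<Omega> \<times> \<Omega> \<longrightarrow> p (x, y) = g0 (x, y)"
    by (rule lborel_pair.AE_pair)
  then have "AE x in lborel. x \<in> \<Omega> \<longrightarrow>
    integrable (\<rho> x) f \<and> koopman \<rho> f x = L2_kernel.op g0 (ext_zero \<Omega> f) x"
    using g0.op_integrable(2)[OF f' f2']
  proof eventually_elim
    fix x assume eq: "AE y in lborel. (x, y) \<in> \<Omega> \<times> \<Omega> \<longrightarrow> p (x, y) = g0 (x, y)"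
      and int: "integrable lborel (\<lambda>y. g0 (x, y) *\<^sub>R ext_zero \<Omega> f y)"
    let ?h = "\<lambda>y. g0 (x, y) *\<^sub>R ext_zero \<Omega> f y"
    have h: "(\<lambda>y. indicator \<Omega> y *\<^sub>R ?h y) = ?h"
      by (auto simp: ext_zero_def indicator_def fun_eq_iff)
    show "x \<in> \<Omega> \<longrightarrow> integrable (\<rho> x) f \<and> koopman \<rho> f x = g0.op (ext_zero \<Omega> f) x"
    proof
      assume x: "x \<in> \<Omega>"
      have meas: "?h \<in> borel_measurable lborel"
        using int by (rule borel_measurable_integrable)
      have "set_integrable lebesgue \<Omega> ?h"
        unfolding set_integrable_def h using int meas by (simp add: integrable_completion)
      moreover have "AE y in lebesgue. y \<in> \<Omega> \<longrightarrow> ?h y = p (x, y) *\<^sub>R f y"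
        unfolding AE_completion_iff using eq by eventually_elim (use x in \<open>simp add: ext_zero_def\<close>)
      ultimately have "set_integrable lebesgue \<Omega> (\<lambda>y. p (x, y) *\<^sub>R f y)"
        "(LINT y:\<Omega>|lebesgue. ?h y) = (LINT y:\<Omega>|lebesgue. p (x, y) *\<^sub>R f y)"
        by (rule set_integrable_cong_AE)+
      moreover have "(LINT y:\<Omega>|lebesgue. ?h y) = g0.op (ext_zero \<Omega> f) x"
        unfolding set_lebesgue_integral_def h g0.op_def using meas by (rule integral_completion)
      ultimately show "integrable (\<rho> x) f \<and> koopman \<rho> f x = g0.op (ext_zero \<Omega> f) x"
        using integral_rho[OF x f] by (simp add: koopman_def)
    qed
  qed
  then show ?thesis by (rule AE_completion)
qed

section \<open>Derivatives of the image of a fixed square integrable function\<close>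

context
  fixes f :: "'a \<Rightarrow> 'k::{real_normed_field,euclidean_space}"
  assumes f: "f \<in> borel_measurable (restrict_space borel \<Omega>)" and f2: "L2_sq \<Omega> f < \<infinity>"
begin

abbreviation V :: "('a \<Rightarrow> nat) \<Rightarrow> 'a \<Rightarrow> 'k" where
  "V \<alpha> \<equiv> L2_kernel.op (g \<alpha>) (ext_zero \<Omega> f)"

lemma ext_zero_finite: "(\<integral>\<^sup>+y. ennreal ((norm (ext_zero \<Omega> f y))\<^sup>2) \<partial>lborel) < \<infinity>"
  using f2 by (simp add: nn_integral_ext_zero)

lemma V_L2:
  assumes "\<alpha> \<in> multi_indices" "mi_order \<alpha> \<le> l"
  shows "V \<alpha> \<in> L2 \<Omega>"
  by (rule L2_kernel.op_L2[OF g_kernel[OF assms] ext_zero_measurable[OF f] ext_zero_finite])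

lemma L2_sq_V:
  assumes "\<alpha> \<in> multi_indices" "mi_order \<alpha> \<le> l"
  shows "L2_sq \<Omega> (V \<alpha>) \<le> L2_kernel.kernel_sq (g \<alpha>) * L2_sq \<Omega> f"
proof -
  interpret L2_kernel \<Omega> "g \<alpha>" by (rule g_kernel[OF assms])
  have "L2_sq \<Omega> (V \<alpha>) = (\<integral>\<^sup>+x. ennreal ((norm (V \<alpha> x))\<^sup>2) \<partial>lborel)"
    by (rule L2_sq_lborel) (rule op_eq_0)
  then show ?thesis
    using nn_integral_op[OF ext_zero_measurable[OF f]] unfolding nn_integral_ext_zero by simp
qed

lemma has_weak_deriv_V:
  assumes "\<alpha> \<in> multi_indices" "mi_order \<alpha> \<le> l"
  shows "has_weak_deriv \<Omega> \<alpha> (koopman \<rho> f) (V \<alpha>)"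
proof -
  have "has_weak_deriv (\<Omega> \<times> \<Omega>) (first_arg \<alpha>) g0 (g \<alpha>)"
    by (rule has_weak_deriv_cong_AE[OF g_deriv[OF assms] p_AE_eq_g0]) simp
  then have "has_weak_deriv \<Omega> \<alpha> (V (\<lambda>_. 0)) (V \<alpha>)"
    by (intro has_weak_deriv_op g0_kernel g_kernel assms ext_zero_measurable[OF f] ext_zero_finite ext_zero_eq_0)
  then show ?thesis
  proof (rule has_weak_deriv_cong_AE)
    show "AE x in lebesgue. x \<in> \<Omega> \<longrightarrow> V (\<lambda>_. 0) x = koopman \<rho> f x"
      using koopman_AE[OF f f2] by eventually_elim simp
  qed simp
qed

lemma weak_deriv_koopman:
  assumes "\<alpha> \<in> multi_indices" "mi_order \<alpha> \<le> l"
  shows "AE x in lebesgue. x \<in> \<Omega> \<longrightarrow> weak_deriv \<Omega> \<alpha> (koopman \<rho> f) x = V \<alpha> x"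
  by (rule has_weak_deriv_unique[OF open_\<Omega> has_weak_deriv_weak_deriv[OF has_weak_deriv_V[OF assms]]
    has_weak_deriv_V[OF assms]])

lemma L2_weak_deriv_koopman:
  assumes "\<alpha> \<in> multi_indices" "mi_order \<alpha> \<le> l"
  shows "ennreal ((L2_norm \<Omega> (weak_deriv \<Omega> \<alpha> (koopman \<rho> f)))\<^sup>2) \<le> L2_kernel.kernel_sq (g \<alpha>) * L2_sq \<Omega> f"
proof -
  have "weak_deriv \<Omega> \<alpha> (koopman \<rho> f) \<in> borel_measurable (lebesgue_on \<Omega>)"
    using locally_integrable_measurable[OF open_\<Omega>] has_weak_deriv_weak_deriv[OF has_weak_deriv_V[OF assms]]
    by (auto simp: has_weak_deriv_def)
  moreover have eq: "L2_sq \<Omega> (weak_deriv \<Omega> \<alpha> (koopman \<rho> f)) = L2_sq \<Omega> (V \<alpha>)"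
    by (rule L2_sq_cong_AE[OF weak_deriv_koopman[OF assms]])
  moreover have "L2_sq \<Omega> (V \<alpha>) < \<infinity>"
    using V_L2[OF assms] by (simp add: L2_iff)
  ultimately have "weak_deriv \<Omega> \<alpha> (koopman \<rho> f) \<in> L2 \<Omega>"
    by (simp add: L2_iff)
  from L2_norm_sq[OF _ this] show ?thesis
    using L2_sq_V[OF assms] eq by simp
qed

text \<open>\<open>V \<alpha>\<close> and its neighbours at order one higher are derivatives of the
  same function \<open>koopman \<rho> f\<close>, so the neighbours form the gradient of
  \<open>V \<alpha>\<close>.\<close>

lemma weak_gradient_V:
  assumes "\<alpha> \<in> multi_indices" "Suc (mi_order \<alpha>) \<le> l"
  shows "weak_gradient \<Omega> (V \<alpha>) (\<lambda>b. V (\<alpha>(b := Suc (\<alpha> b))))"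
proof -
  have int: "integrable lborel (V \<beta>)" and zero: "\<And>x. x \<notin> \<Omega> \<Longrightarrow> V \<beta> x = 0"
    if "\<beta> \<in> multi_indices" "mi_order \<beta> \<le> l" for \<beta>
    using L2_kernel.op_integrable(1)[OF g_kernel[OF that] ext_zero_measurable[OF f] ext_zero_finite]
      L2_kernel.op_eq_0[OF g_kernel[OF that]] by blast+
  have \<alpha>: "\<alpha> \<in> multi_indices" "mi_order \<alpha> \<le> l" using assms by auto
  have \<beta>: "\<alpha>(b := Suc (\<alpha> b)) \<in> multi_indices" "mi_order (\<alpha>(b := Suc (\<alpha> b))) \<le> l" if "b \<in> Basis" for b
    using assms that by (auto simp: multi_indices_Suc mi_order_Suc)
  show ?thesis
  proof
    show "has_weak_deriv \<Omega> ((\<lambda>_. 0)(b := Suc 0)) (V \<alpha>) (V (\<alpha>(b := Suc (\<alpha> b))))" if b: "b \<in> Basis" for b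
      by (rule has_weak_deriv_Suc[OF b has_weak_deriv_V[OF \<alpha>] has_weak_deriv_V[OF \<beta>[OF b]]])
  qed (use open_\<Omega> int zero \<alpha> \<beta> in auto)
qed

text \<open>The embedding constant enters as a hypothesis so that it is chosen before
  \<open>f\<close>.\<close>

lemma slobodeckij_koopman:
  assumes \<alpha>: "\<alpha> \<in> multi_indices" "Suc (mi_order \<alpha>) \<le> l"
    and K: "\<And>(u :: 'a \<Rightarrow> 'k) G. weak_gradient \<Omega> u G \<Longrightarrow>
      slobodeckij \<Omega> r u \<le> ennreal K * (weak_gradient.mass u + weak_gradient.energy G)"
  shows "slobodeckij \<Omega> r (weak_deriv \<Omega> \<alpha> (koopman \<rho> f))
    \<le> ennreal K * (L2_kernel.kernel_sq (g \<alpha>) + (\<Sum>b\<in>Basis. L2_kernel.kernel_sq (g (\<alpha>(b := Suc (\<alpha> b))))))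
        * L2_sq \<Omega> f"
proof -
  interpret weak_gradient \<Omega> "V \<alpha>" "\<lambda>b. V (\<alpha>(b := Suc (\<alpha> b)))"
    by (rule weak_gradient_V[OF \<alpha>])
  have \<alpha>': "mi_order \<alpha> \<le> l" using \<alpha>(2) by simp
  have \<beta>: "\<alpha>(b := Suc (\<alpha> b)) \<in> multi_indices" "mi_order (\<alpha>(b := Suc (\<alpha> b))) \<le> l" if "b \<in> Basis" for b
    using \<alpha> that by (auto simp: multi_indices_Suc mi_order_Suc)
  have "mass = L2_sq \<Omega> (V \<alpha>)"
    unfolding mass_def by (rule L2_sq_lborel[symmetric]) (rule u(2))
  then have mass: "mass \<le> L2_kernel.kernel_sq (g \<alpha>) * L2_sq \<Omega> f"
    using L2_sq_V[OF \<alpha>(1) \<alpha>'] by simp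
  have "energy = (\<Sum>b\<in>Basis. L2_sq \<Omega> (V (\<alpha>(b := Suc (\<alpha> b)))))"
    unfolding energy_def by (intro sum.cong refl L2_sq_lborel[symmetric] G(2))
  also have "\<dots> \<le> (\<Sum>b\<in>Basis. L2_kernel.kernel_sq (g (\<alpha>(b := Suc (\<alpha> b)))) * L2_sq \<Omega> f)"
    by (intro sum_mono L2_sq_V \<beta>)
  finally have energy: "energy \<le> (\<Sum>b\<in>Basis. L2_kernel.kernel_sq (g (\<alpha>(b := Suc (\<alpha> b))))) * L2_sq \<Omega> f"
    by (simp add: sum_distrib_right)
  have "slobodeckij \<Omega> r (weak_deriv \<Omega> \<alpha> (koopman \<rho> f)) = slobodeckij \<Omega> r (V \<alpha>)"
    by (rule slobodeckij_cong_AE[OF weak_deriv_koopman[OF \<alpha>(1) \<alpha>']])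
  also have "\<dots> \<le> ennreal K * (mass + energy)"
    by (rule K[OF weak_gradient_axioms])
  also have "\<dots> \<le> ennreal K * (L2_kernel.kernel_sq (g \<alpha>) * L2_sq \<Omega> f
      + (\<Sum>b\<in>Basis. L2_kernel.kernel_sq (g (\<alpha>(b := Suc (\<alpha> b))))) * L2_sq \<Omega> f)"
    by (intro mult_left_mono add_mono mass energy) simp
  also have "\<dots> = ennreal K * (L2_kernel.kernel_sq (g \<alpha>) + (\<Sum>b\<in>Basis. L2_kernel.kernel_sq (g (\<alpha>(b := Suc (\<alpha> b))))))
        * L2_sq \<Omega> f"
    by (simp only: distrib_right mult.assoc)
  finally show ?thesis .
qed

end

end

text \<open>All that the operator uses about \<open>f\<close>: the zero multi-index contributes its
  L2 norm to the Sobolev norm, up to the almost everywhere equality of \<open>f\<close> with its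
  chosen derivative of order zero.\<close>

lemma sobolev_L2_sq:
  fixes f :: "'a::euclidean_space \<Rightarrow> 'k::{real_normed_field,euclidean_space}"
  assumes \<Omega>: "open \<Omega>" and f: "f \<in> sobolev \<Omega> s"
  shows "f \<in> borel_measurable (restrict_space borel \<Omega>)" "L2_sq \<Omega> f < \<infinity>"
    "L2_sq \<Omega> f \<le> ennreal ((sobolev_norm \<Omega> s f)\<^sup>2)"
proof -
  show "f \<in> borel_measurable (restrict_space borel \<Omega>)"
    using f by (simp add: sobolev_def)
  let ?I = "{\<alpha> :: 'a \<Rightarrow> nat. \<alpha> \<in> multi_indices \<and> mi_order \<alpha> \<le> nat \<lfloor>s\<rfloor>}"
  have zero: "(\<lambda>_::'a. 0) \<in> ?I"
    by (simp add: multi_indices_def mi_order_def)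
  then obtain h where h: "h \<in> L2 \<Omega>" "has_weak_deriv \<Omega> (\<lambda>_. 0) f h"
    using f by (auto simp: sobolev_def)
  let ?d = "weak_deriv \<Omega> (\<lambda>_. 0) f"
  have d: "has_weak_deriv \<Omega> (\<lambda>_. 0) f ?d"
    by (rule has_weak_deriv_weak_deriv[OF h(2)])
  have fh: "L2_sq \<Omega> f = L2_sq \<Omega> h" and fd: "L2_sq \<Omega> f = L2_sq \<Omega> ?d"
    using has_weak_deriv_zero_AE_eq[OF \<Omega> h(2)] has_weak_deriv_zero_AE_eq[OF \<Omega> d] by (auto intro: L2_sq_cong_AE)
  show fin: "L2_sq \<Omega> f < \<infinity>"
    using h(1) \<Omega> by (simp add: fh L2_iff)
  have "?d \<in> borel_measurable (lebesgue_on \<Omega>)"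
    using locally_integrable_measurable[OF \<Omega>] d by (auto simp: has_weak_deriv_def)
  then have "?d \<in> L2 \<Omega>"
    using fin \<Omega> by (simp add: fd L2_iff)
  then have "L2_sq \<Omega> f = ennreal ((L2_norm \<Omega> ?d)\<^sup>2)"
    using L2_norm_sq[of \<Omega> ?d] \<Omega> by (simp add: fd)
  also have "\<dots> \<le> ennreal ((sobolev_norm \<Omega> s f)\<^sup>2)"
  proof (rule ennreal_leI)
    have "(L2_norm \<Omega> ?d)\<^sup>2 \<le> (\<Sum>\<alpha>\<in>?I. (L2_norm \<Omega> (weak_deriv \<Omega> \<alpha> f))\<^sup>2)"
      using finite_multi_indices_le[where ?'a = 'a]
      by (intro member_le_sum[OF zero, of "\<lambda>\<alpha>. (L2_norm \<Omega> (weak_deriv \<Omega> \<alpha> f))\<^sup>2"]) auto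
    also have "\<dots> \<le> (sobolev_norm \<Omega> s f)\<^sup>2"
      unfolding sobolev_norm_def by (subst real_sqrt_pow2) (auto intro!: add_nonneg_nonneg sum_nonneg)
    finally show "(L2_norm \<Omega> ?d)\<^sup>2 \<le> (sobolev_norm \<Omega> s f)\<^sup>2" .
  qed
  finally show "L2_sq \<Omega> f \<le> ennreal ((sobolev_norm \<Omega> s f)\<^sup>2)" .
qed

lemma le_enn2real_times:
  assumes "ennreal x \<le> A * y" "y \<le> ennreal c" "A < \<infinity>" "0 \<le> c"
  shows "x \<le> enn2real A * c"
proof -
  have "ennreal x \<le> A * ennreal c"
    using assms(1,2) by (meson mult_left_mono order.trans zero_le)
  also have "\<dots> = ennreal (enn2real A * c)"
    using assms(3,4) by (simp add: ennreal_mult)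
  finally show ?thesis
    using assms(4) by (subst (asm) ennreal_le_iff) simp_all
qed

section \<open>Boundedness on the Sobolev spaces\<close>

context koopman_density
begin

text \<open>A noninteger s \<le> l is strictly below l; this is the spare derivative that provides
  the gradient.\<close>

lemma Suc_floor_le:
  assumes "0 < s" "s \<le> real l" "s \<notin> \<int>"
  shows "Suc (nat \<lfloor>s\<rfloor>) \<le> l"
proof -
  have "s \<noteq> real l" using assms(3) by auto
  then have "\<lfloor>s\<rfloor> < int l" using assms(2) by (simp add: floor_less_iff)
  then show ?thesis using assms(1) by (simp add: Suc_le_eq nat_less_iff)
qed

lemma kernel_sq_finite:
  "\<alpha> \<in> multi_indices \<Longrightarrow> mi_order \<alpha> \<le> l \<Longrightarrow> L2_kernel.kernel_sq (g \<alpha>) < \<infinity>"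
  by (rule L2_kernel.kernel_sq_finite[OF g_kernel])

lemma kernel_sq_gradient_finite:
  assumes "\<alpha> \<in> multi_indices" "Suc (mi_order \<alpha>) \<le> l"
  shows "ennreal K * (L2_kernel.kernel_sq (g \<alpha>) + (\<Sum>b\<in>Basis. L2_kernel.kernel_sq (g (\<alpha>(b := Suc (\<alpha> b)))))) < \<infinity>"
  using assms kernel_sq_finite[of \<alpha>] kernel_sq_finite[of "\<alpha>(_ := Suc (\<alpha> _))"]
  by (auto simp: ennreal_mult_less_top multi_indices_Suc mi_order_Suc)

lemma slobodeckij_koopman_bound:
  assumes s: "0 < s" "s \<le> real l" "s \<notin> \<int>"
  obtains A :: "('a \<Rightarrow> nat) \<Rightarrow> ennreal" where
    "\<And>\<alpha>. \<alpha> \<in> multi_indices \<Longrightarrow> mi_order \<alpha> = nat \<lfloor>s\<rfloor> \<Longrightarrow> A \<alpha> < \<infinity>"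
    "\<And>\<alpha> (f :: 'a \<Rightarrow> 'k::{real_normed_field,euclidean_space}).
      \<alpha> \<in> multi_indices \<Longrightarrow> mi_order \<alpha> = nat \<lfloor>s\<rfloor> \<Longrightarrow>
      f \<in> borel_measurable (restrict_space borel \<Omega>) \<Longrightarrow> L2_sq \<Omega> f < \<infinity> \<Longrightarrow>
      slobodeckij \<Omega> (frac s) (weak_deriv \<Omega> \<alpha> (koopman \<rho> f)) \<le> A \<alpha> * L2_sq \<Omega> f"
proof -
  have "0 < frac s" "frac s < 1"
    using s(3) by (simp_all add: frac_gt_0_iff frac_lt_1)
  then obtain K :: real where K: "\<And>(u :: 'a \<Rightarrow> 'k) G. weak_gradient \<Omega> u G \<Longrightarrow>
      slobodeckij \<Omega> (frac s) u \<le> ennreal K * (weak_gradient.mass u + weak_gradient.energy G)"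
    using slobodeckij_bound[OF domain, where ?'k = 'k] by blast
  show thesis
    by (rule that[OF kernel_sq_gradient_finite[of _ K] slobodeckij_koopman[OF _ _ _ _ K]])
      (use Suc_floor_le[OF s] in simp_all)
qed

lemma koopman_sobolev:
  fixes f :: "'a \<Rightarrow> 'k::{real_normed_field,euclidean_space}"
  assumes s: "0 < s" "s \<le> real l" and f: "f \<in> sobolev \<Omega> s"
  shows "koopman \<rho> f \<in> sobolev \<Omega> s"
proof -
  note f' = sobolev_L2_sq[OF open_\<Omega> f]
  have "nat \<lfloor>s\<rfloor> \<le> l" using s by linarith
  then have "\<exists>h\<in>L2 \<Omega>. has_weak_deriv \<Omega> \<alpha> (koopman \<rho> f) h"
    if "\<alpha> \<in> multi_indices" "mi_order \<alpha> \<le> nat \<lfloor>s\<rfloor>" for \<alpha>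
    using that V_L2[OF f'(1,2)] has_weak_deriv_V[OF f'(1,2)] by (meson order.trans)
  moreover have "slobodeckij \<Omega> (frac s) (weak_deriv \<Omega> \<alpha> (koopman \<rho> f)) < \<infinity>"
    if si: "s \<notin> \<int>" and \<alpha>: "\<alpha> \<in> multi_indices" "mi_order \<alpha> = nat \<lfloor>s\<rfloor>" for \<alpha>
  proof -
    obtain A where A: "A \<alpha> < \<infinity>" "slobodeckij \<Omega> (frac s) (weak_deriv \<Omega> \<alpha> (koopman \<rho> f)) \<le> A \<alpha> * L2_sq \<Omega> f"
      using slobodeckij_koopman_bound[OF s si, where ?'k = 'k] \<alpha> f'(1,2) by metis
    then show ?thesis
      using f'(2) by (auto intro: le_less_trans simp: ennreal_mult_less_top)
  qed
  ultimately show ?thesis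
    unfolding sobolev_def using koopman_measurable[OF f'(1)] by blast
qed

lemma koopman_norm_bound:
  assumes s: "0 < s" "s \<le> real l"
  shows "\<exists>B. \<forall>f \<in> (sobolev \<Omega> s :: ('a \<Rightarrow> 'k::{real_normed_field,euclidean_space}) set).
    sobolev_norm \<Omega> s (koopman \<rho> f) \<le> B * sobolev_norm \<Omega> s f"
proof -
  let ?I = "{\<alpha> :: 'a \<Rightarrow> nat. \<alpha> \<in> multi_indices \<and> mi_order \<alpha> \<le> nat \<lfloor>s\<rfloor>}"
  let ?J = "{\<alpha> :: 'a \<Rightarrow> nat. \<alpha> \<in> multi_indices \<and> mi_order \<alpha> = nat \<lfloor>s\<rfloor>}"
  have ord: "nat \<lfloor>s\<rfloor> \<le> l" using s by linarith
  obtain A :: "('a \<Rightarrow> nat) \<Rightarrow> ennreal" where A: "s \<notin> \<int> \<Longrightarrow> \<alpha> \<in> ?J \<Longrightarrow> A \<alpha> < \<infinity>"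
    "s \<notin> \<int> \<Longrightarrow> \<alpha> \<in> ?J \<Longrightarrow> f \<in> borel_measurable (restrict_space borel \<Omega>) \<Longrightarrow> L2_sq \<Omega> f < \<infinity> \<Longrightarrow>
      slobodeckij \<Omega> (frac s) (weak_deriv \<Omega> \<alpha> (koopman \<rho> f)) \<le> A \<alpha> * L2_sq \<Omega> f" for \<alpha> and f :: "'a \<Rightarrow> 'k"
  \<comment> \<open>For integer \<open>s\<close> both requirements are vacuous and any
    \<open>A\<close> will do.\<close>
  proof (cases "s \<in> \<int>")
    case False
    show thesis
      by (rule slobodeckij_koopman_bound[OF s False, where ?'k = 'k]) (rule that, auto)
  qed (use that in blast)
  define a where "a = (\<Sum>\<alpha>\<in>?I. enn2real (L2_kernel.kernel_sq (g \<alpha>)))"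
  define b where "b = (if s \<in> \<int> then 0 else \<Sum>\<alpha>\<in>?J. enn2real (A \<alpha>))"
  have "sobolev_norm \<Omega> s (koopman \<rho> f) \<le> sqrt (a + b) * sobolev_norm \<Omega> s f"
    if f: "f \<in> sobolev \<Omega> s" for f :: "'a \<Rightarrow> 'k"
  proof -
    note f' = sobolev_L2_sq[OF open_\<Omega> f]
    let ?N = "(sobolev_norm \<Omega> s f)\<^sup>2"
    have "(\<Sum>\<alpha>\<in>?I. (L2_norm \<Omega> (weak_deriv \<Omega> \<alpha> (koopman \<rho> f)))\<^sup>2) \<le> a * ?N"
      unfolding a_def sum_distrib_right
    proof (rule sum_mono)
      fix \<alpha> assume "\<alpha> \<in> ?I"
      then have \<alpha>: "\<alpha> \<in> multi_indices" "mi_order \<alpha> \<le> l" using ord by auto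
      show "(L2_norm \<Omega> (weak_deriv \<Omega> \<alpha> (koopman \<rho> f)))\<^sup>2 \<le> enn2real (L2_kernel.kernel_sq (g \<alpha>)) * ?N"
        by (rule le_enn2real_times[OF L2_weak_deriv_koopman[OF f'(1,2) \<alpha>] f'(3) kernel_sq_finite[OF \<alpha>]]) simp
    qed
    moreover have "(\<Sum>\<alpha>\<in>?J. enn2real (slobodeckij \<Omega> (frac s) (weak_deriv \<Omega> \<alpha> (koopman \<rho> f))))
        \<le> (\<Sum>\<alpha>\<in>?J. enn2real (A \<alpha>)) * ?N" if si: "s \<notin> \<int>"
      unfolding sum_distrib_right
    proof (rule sum_mono)
      fix \<alpha> assume \<alpha>: "\<alpha> \<in> ?J"
      let ?S = "slobodeckij \<Omega> (frac s) (weak_deriv \<Omega> \<alpha> (koopman \<rho> f))"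
      have le: "?S \<le> A \<alpha> * L2_sq \<Omega> f"
        by (rule A(2)[OF si \<alpha> f'(1,2)])
      \<comment> \<open>Finiteness lets \<open>enn2real\<close> be undone; at infinity it would
        return 0.\<close>
      also have "\<dots> < \<infinity>"
        using A(1)[OF si \<alpha>] f'(2) by (simp add: ennreal_mult_less_top)
      finally have "ennreal (enn2real ?S) \<le> A \<alpha> * L2_sq \<Omega> f"
        using le by simp
      then show "enn2real ?S \<le> enn2real (A \<alpha>) * ?N"
        by (rule le_enn2real_times[OF _ f'(3) A(1)[OF si \<alpha>]]) simp
    qed
    ultimately have "sobolev_norm \<Omega> s (koopman \<rho> f) \<le> sqrt ((a + b) * ?N)"
      unfolding sobolev_norm_def[of \<Omega> s "koopman \<rho> f"] b_def distrib_right
      by (intro real_sqrt_le_mono add_mono) auto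
    also have "\<dots> = sqrt (a + b) * sobolev_norm \<Omega> s f"
    proof -
      have "0 \<le> sobolev_norm \<Omega> s f"
        unfolding sobolev_norm_def by (auto intro!: add_nonneg_nonneg sum_nonneg)
      then show ?thesis by (simp add: real_sqrt_mult)
    qed
    finally show ?thesis .
  qed
  then show ?thesis by blast
qed

text \<open>Functions equal almost everywhere have zero extensions with the same image under
  \<open>g0.op\<close> at every point, so the operator is well defined on classes. Additivity holds
  at each \<open>x\<close> where both functions are integrable with respect to
  \<open>\<rho> x\<close>.\<close>

lemma koopman_bounded_operator:
  assumes s: "0 < s" "s \<le> real l"
  shows "(\<forall>f \<in> (sobolev \<Omega> s :: ('a \<Rightarrow> 'k::{real_normed_field,euclidean_space}) set).
      AE x in lebesgue_on \<Omega>. integrable (\<rho> x) f) \<and>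
    bounded_operator_ae (lebesgue_on \<Omega>) (sobolev \<Omega> s :: ('a \<Rightarrow> 'k) set) (sobolev_norm \<Omega> s) (koopman \<rho>)"
proof -
  have AE_on: "(AE x in lebesgue_on \<Omega>. P x) \<longleftrightarrow> (AE x in lebesgue. x \<in> \<Omega> \<longrightarrow> P x)" for P
    by (simp add: AE_restrict_space_iff)
  have int: "AE x in lebesgue_on \<Omega>. integrable (\<rho> x) f" if "f \<in> sobolev \<Omega> s" for f :: "'a \<Rightarrow> 'k"
    unfolding AE_on using koopman_AE[OF sobolev_L2_sq(1,2)[OF open_\<Omega> that]] by eventually_elim simp
  have "AE x in lebesgue_on \<Omega>. koopman \<rho> f x = koopman \<rho> h x"
    if f: "f \<in> sobolev \<Omega> s" and h: "h \<in> sobolev \<Omega> s" and fh: "AE x in lebesgue_on \<Omega>. f x = h x"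
    for f h :: "'a \<Rightarrow> 'k"
  proof -
    note f' = sobolev_L2_sq[OF open_\<Omega> f] and h' = sobolev_L2_sq[OF open_\<Omega> h]
    interpret g0: L2_kernel \<Omega> g0 by (rule g0_kernel)
    have "AE y in lborel. ext_zero \<Omega> f y = ext_zero \<Omega> h y"
      using fh unfolding AE_on AE_completion_iff by eventually_elim (auto simp: ext_zero_def)
    moreover note [measurable] = ext_zero_measurable[OF f'(1)] ext_zero_measurable[OF h'(1)]
    ultimately have eq: "g0.op (ext_zero \<Omega> f) x = g0.op (ext_zero \<Omega> h) x" for x
      unfolding g0.op_def by (intro integral_cong_AE) (auto elim: eventually_mono)
    show ?thesis
      using koopman_AE[OF f'(1,2)] koopman_AE[OF h'(1,2)] unfolding AE_on by eventually_elim (simp add: eq)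
  qed
  moreover have "AE x in lebesgue_on \<Omega>. koopman \<rho> (\<lambda>y. f y + h y) x = koopman \<rho> f x + koopman \<rho> h x"
    if "f \<in> sobolev \<Omega> s" "h \<in> sobolev \<Omega> s" for f h :: "'a \<Rightarrow> 'k"
    using int[OF that(1)] int[OF that(2)] by eventually_elim (simp add: koopman_def)
  moreover have "AE x in lebesgue_on \<Omega>. koopman \<rho> (\<lambda>y. c * f y) x = c * koopman \<rho> f x"
    if "f \<in> sobolev \<Omega> s" for c and f :: "'a \<Rightarrow> 'k"
    using int[OF that] by eventually_elim (simp add: koopman_def)
  ultimately show ?thesis
    unfolding bounded_operator_ae_def using int koopman_sobolev[OF s] koopman_norm_bound[OF s] by blast
qed

end

theorem theorem2p7:
  fixes \<Omega> :: "(real ^ 'n) set"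
    and \<rho> :: "real ^ 'n \<Rightarrow> (real ^ 'n) measure"
    and p :: "(real ^ 'n) \<times> (real ^ 'n) \<Rightarrow> real"
    and C :: real and l :: nat
  assumes "bounded_lipschitz_domain \<Omega>"
    and "markov_kernel \<Omega> \<rho>"
    and "\<forall>x\<in>\<Omega>. \<forall>y\<in>\<Omega>. 0 \<le> p (x, y)"
    and "\<forall>x\<in>\<Omega>. (\<lambda>y. p (x, y)) \<in> borel_measurable (lebesgue_on \<Omega>)"
    and "\<forall>x\<in>\<Omega>. \<forall>\<Delta>\<in>sets borel. \<Delta> \<subseteq> \<Omega> \<longrightarrow>
          emeasure (\<rho> x) \<Delta> = (\<integral>\<^sup>+y\<in>\<Delta>. ennreal (p (x, y)) \<partial>lebesgue)"
    and "\<forall>\<alpha>\<in>multi_indices. mi_order \<alpha> \<le> l \<longrightarrow>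
          (\<exists>g\<in>L2 (\<Omega> \<times> \<Omega>). has_weak_deriv (\<Omega> \<times> \<Omega>) (first_arg \<alpha>) p g)"
    and "C > 0"
    and "(\<Sum>\<alpha> | \<alpha> \<in> multi_indices \<and> mi_order \<alpha> \<le> l.
            L2_norm (\<Omega> \<times> \<Omega>) (weak_deriv (\<Omega> \<times> \<Omega>) (first_arg \<alpha>) p)) \<le> C"
  shows "\<forall>s. 0 < s \<and> s \<le> real l \<longrightarrow>
          (\<forall>f \<in> (sobolev \<Omega> s :: (real ^ 'n \<Rightarrow> 'k::{real_normed_field,euclidean_space}) set).
            AE x in lebesgue_on \<Omega>. integrable (\<rho> x) f) \<and>
          bounded_operator_ae (lebesgue_on \<Omega>)
            (sobolev \<Omega> s :: (real ^ 'n \<Rightarrow> 'k) set) (sobolev_norm \<Omega> s) (koopman \<rho>)"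
proof -
  have \<Omega>: "open \<Omega>" "bounded \<Omega>"
    using assms(1) by (auto simp: bounded_lipschitz_domain_def)
  \<comment> \<open>The conditions on \<alpha> stand below the quantifier so that a single choice
    function \<open>g\<close> on all \<alpha> can be extracted.\<close>
  have "\<exists>h. \<alpha> \<in> multi_indices \<longrightarrow> mi_order \<alpha> \<le> l \<longrightarrow>
      L2_kernel \<Omega> h \<and> has_weak_deriv (\<Omega> \<times> \<Omega>) (first_arg \<alpha>) p h" for \<alpha>
  proof (cases "\<alpha> \<in> multi_indices \<and> mi_order \<alpha> \<le> l")
    case True
    then obtain h where "h \<in> L2 (\<Omega> \<times> \<Omega>)" "has_weak_deriv (\<Omega> \<times> \<Omega>) (first_arg \<alpha>) p h"
      using assms(6) by blast
    then show ?thesis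
      by (rule ex_L2_kernel[OF \<Omega>]) blast
  qed blast
  then obtain g where "\<And>\<alpha>. \<alpha> \<in> multi_indices \<Longrightarrow> mi_order \<alpha> \<le> l \<Longrightarrow>
      L2_kernel \<Omega> (g \<alpha>) \<and> has_weak_deriv (\<Omega> \<times> \<Omega>) (first_arg \<alpha>) p (g \<alpha>)"
    by metis
  then interpret koopman_density \<Omega> \<rho> p g l
    using assms(1-5) by (intro koopman_density.intro) auto
  show ?thesis
    using koopman_bounded_operator by blast
qed

end
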